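(* Let $V_+,V_-\in\mathbb{C}$ be such that $\mathrm{Im}\,V_+\ne\mathrm{Im}\,V_-$, let $\alpha\in\mathbb{C}\setminus\{0\}$, let $V(x)=V_+$ for $x\ge0$ and $V(x)=V_-$ for $x<0$, and let $\mathcal{L}_\alpha$ be the operator on $L^2(\mathbb{R})$ given by $$\mathrm{Dom}(\mathcal{L}_\alpha)=\{u\in H^1(\mathbb{R})\cap H^2(\mathbb{R}\setminus\{0\}):u'(0^+)-u'(0^-)=\alpha u(0)\},\qquad \mathcal{L}_\alpha u=-u''+V(x)u.$$ For $z\in\rho(\mathcal{L}_\alpha)$ define $$\Psi_{z,\alpha}(x)=\left(n_1(z,\alpha)e^{k_-(z)x}+n_2(z)e^{\overline{k_-(z)}x}\right)\mathbf{1}_{\mathbb{R}_-}(x)+\left(p_1(z,\alpha)e^{-k_+(z)x}+p_2(z)e^{-\overline{k_+(z)}x}\right)\mathbf{1}_{\mathbb{R}_+}(x),$$ where $$\begin{aligned} n_1(z,\alpha)&=\frac{k_+(z)+\overline{k_-(z)}+\alpha}{k_+(z)+k_-(z)+\alpha}|\mathrm{Im}\,V_+-\mathrm{Im}\,z|+\frac{k_+(z)-\overline{k_+(z)}}{k_+(z)+k_-(z)+\alpha}|\mathrm{Im}\,V_--\mathrm{Im}\,z|,\\ p_1(z,\alpha)&=-\frac{k_-(z)-\overline{k_-(z)}}{k_+(z)+k_-(z)+\alpha}|\mathrm{Im}\,V_+-\mathrm{Im}\,z|-\frac{\overline{k_+(z)}+k_-(z)+\alpha}{k_+(z)+k_-(z)+\alpha}|\mathrm{Im}\,V_--\mathrm{Im}\,z|,\\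 n_2(z)&=-|\mathrm{Im}\,V_+-\mathrm{Im}\,z|,\\ p_2(z)&=|\mathrm{Im}\,V_--\mathrm{Im}\,z|. \end{aligned}$$ Then $\Psi_{z,\alpha}\in\mathrm{Dom}(\mathcal{L}_\alpha)$ for all $z\in\rho(\mathcal{L}_\alpha)$, and $$\frac{\|(\mathcal{L}_\alpha-z)\Psi_{z,\alpha}\|}{\|\Psi_{z,\alpha}\|}=\frac{|\alpha|}{|\mathrm{Im}\,V_+-\mathrm{Im}\,V_-|}\,\frac{|\mathrm{Im}\,V_+-\mathrm{Im}\,z|\,|\mathrm{Im}\,V_--\mathrm{Im}\,z|}{\sqrt{\mathrm{Re}\,z}}\left(1+\mathcal{O}\left(\frac{1}{|\mathrm{Re}\,z|^{1/2}}\right)\right)$$ as $\mathrm{Re}\,z\to+\infty$, uniformly for all $\mathrm{Im}\,z\in|(\mathrm{Im}\,V_+,\mathrm{Im}\,V_-)|$.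
   Context: $k_\pm(z):=\sqrt{V_\pm-z}$ with the principal branch of the square root (holomorphic on $\mathbb{C}\setminus(-\infty,0]$, positive on $(0,+\infty)$). $\rho(\mathcal{L}_\alpha)$ is the resolvent set; $\mathbb{R}_+=(0,+\infty)$, $\mathbb{R}_-=(-\infty,0)$; $\mathbf{1}_E$ is the indicator function of $E$; $\|\cdot\|$ is the $L^2(\mathbb{R})$ norm; $\Psi_{z,\alpha}$ is regarded as an element of $L^2(\mathbb{R})$ (defined almost everywhere). For real $a\ne b$, $|(a,b)|$ denotes the open interval with endpoints $a$ and $b$. The asymptotic statement means: there are constants $M,C>0$ depending only on $V_+,V_-,\alpha$ such that for all $z$ with $\mathrm{Re}\,z\ge M$ and $\mathrm{Im}\,z\in|(\mathrm{Im}\,V_+,\mathrm{Im}\,V_-)|$, $z$ lies in $\rho(\mathcal{L}_\alpha)$ and the left side divided by the explicit leading factor on the right differs from $1$ by at most $C/|\mathrm{Re}\,z|^{1/2}$ in absolute value. *)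

theory Defs
  imports "HOL-Analysis.Analysis"
begin

text \<open>
  Elements of \<open>L\<^sup>2\<close> and of Sobolev spaces are functions \<open>real \<Rightarrow> complex\<close>. The spaces \<open>L2\<close>,
  \<open>sobolev_H\<close> and \<open>dom_L\<close> are closed under almost everywhere equality, and equality in \<open>L\<^sup>2\<close> is written
  \<open>AE x in lebesgue. f x = g x\<close>.
\<close>

subsection \<open>Square integrable functions and Sobolev spaces on open subsets of the line\<close>

definition L2 :: "real set \<Rightarrow> (real \<Rightarrow> complex) set" where
  "L2 \<Omega> = {f. f \<in> borel_measurable (lebesgue_on \<Omega>) \<and>
              integrable (lebesgue_on \<Omega>) (\<lambda>x. (cmod (f x))\<^sup>2)}"

definition L2_norm :: "(real \<Rightarrow> complex) \<Rightarrow> real" where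
  "L2_norm f = sqrt (LINT x|lebesgue. (cmod (f x))\<^sup>2)"

text \<open>
  The space \<open>C\<^sub>c\<^sup>\<infinity>(\<Omega>)\<close>. Real-valued test functions suffice to test complex-valued functions,
  by linearity.
\<close>

definition test_functions :: "real set \<Rightarrow> (real \<Rightarrow> real) set" where
  "test_functions \<Omega> =
     {\<phi>. (\<forall>n x. ((deriv ^^ n) \<phi>) field_differentiable (at x)) \<and>
         compact (closure {x. \<phi> x \<noteq> 0}) \<and> closure {x. \<phi> x \<noteq> 0} \<subseteq> \<Omega>}"

definition locally_integrable :: "real set \<Rightarrow> (real \<Rightarrow> complex) \<Rightarrow> bool" where
  "locally_integrable \<Omega> u \<longleftrightarrow> (\<forall>K. compact K \<and> K \<subseteq> \<Omega> \<longrightarrow> u absolutely_integrable_on K)"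

definition has_weak_deriv :: "real set \<Rightarrow> (real \<Rightarrow> complex) \<Rightarrow> (real \<Rightarrow> complex) \<Rightarrow> bool" where
  "has_weak_deriv \<Omega> u g \<longleftrightarrow>
     locally_integrable \<Omega> u \<and> locally_integrable \<Omega> g \<and>
     (\<forall>\<phi>\<in>test_functions \<Omega>.
        (LINT x|lebesgue_on \<Omega>. u x * complex_of_real (deriv \<phi> x)) =
        - (LINT x|lebesgue_on \<Omega>. g x * complex_of_real (\<phi> x)))"

text \<open>A weak derivative is determined up to almost everywhere equality on \<open>\<Omega>\<close>; one is chosen.\<close>

definition weak_deriv :: "real set \<Rightarrow> (real \<Rightarrow> complex) \<Rightarrow> real \<Rightarrow> complex" where
  "weak_deriv \<Omega> u = (SOME g. has_weak_deriv \<Omega> u g)"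

fun sobolev_H :: "nat \<Rightarrow> real set \<Rightarrow> (real \<Rightarrow> complex) set" where
  "sobolev_H 0 \<Omega> = L2 \<Omega>"
| "sobolev_H (Suc k) \<Omega> = {u \<in> L2 \<Omega>. \<exists>g\<in>sobolev_H k \<Omega>. has_weak_deriv \<Omega> u g}"

text \<open>
  Pointwise values of Sobolev functions are those of the continuous representative, which for
  open \<open>S\<close> is unique on \<open>S\<close> (its values outside \<open>S\<close> are irrelevant).
\<close>

definition cont_rep :: "real set \<Rightarrow> (real \<Rightarrow> complex) \<Rightarrow> real \<Rightarrow> complex" where
  "cont_rep S u = (SOME v. continuous_on S v \<and> (AE x in lebesgue_on S. v x = u x))"

subsection \<open>Resolvent set\<close>

text \<open>
  For an operator \<open>A\<close> on \<open>L\<^sup>2(\<real>)\<close> with domain \<open>D\<close>: the points \<open>z\<close> for which \<open>A - z\<close> is a bijection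
  from \<open>D\<close> onto \<open>L\<^sup>2(\<real>)\<close> (up to almost everywhere equality) with bounded inverse.
\<close>

definition resolvent_set ::
  "(real \<Rightarrow> complex) set \<Rightarrow> ((real \<Rightarrow> complex) \<Rightarrow> real \<Rightarrow> complex) \<Rightarrow> complex set" where
  "resolvent_set D A =
     {z. (\<forall>u\<in>D. \<forall>v\<in>D. (AE x in lebesgue. A u x - z * u x = A v x - z * v x) \<longrightarrow>
                        (AE x in lebesgue. u x = v x)) \<and>
         (\<forall>f\<in>L2 UNIV. \<exists>u\<in>D. AE x in lebesgue. A u x - z * u x = f x) \<and>
         (\<exists>C. \<forall>u\<in>D. L2_norm u \<le> C * L2_norm (\<lambda>x. A u x - z * u x))}"

subsection \<open>The operator\<close>

definition step_potential :: "complex \<Rightarrow> complex \<Rightarrow> real \<Rightarrow> complex" where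
  "step_potential Vp Vm x = (if x \<ge> 0 then Vp else Vm)"

definition dom_L :: "complex \<Rightarrow> (real \<Rightarrow> complex) set" where
  "dom_L \<alpha> =
     {u \<in> sobolev_H 1 UNIV \<inter> sobolev_H 2 (UNIV - {0}).
        Lim (at_right 0) (cont_rep {0<..} (weak_deriv (UNIV - {0}) u)) -
        Lim (at_left 0) (cont_rep {..<0} (weak_deriv (UNIV - {0}) u)) =
        \<alpha> * cont_rep UNIV u 0}"

text \<open>
  The second derivative is the one of \<open>H\<^sup>2(\<real> - {0})\<close>, hence does not see the jump of \<open>u'\<close> at the
  origin; the parameter \<open>\<alpha>\<close> enters only through the domain.
\<close>

definition op_L :: "complex \<Rightarrow> complex \<Rightarrow> (real \<Rightarrow> complex) \<Rightarrow> real \<Rightarrow> complex" where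
  "op_L Vp Vm u x =
     - weak_deriv (UNIV - {0}) (weak_deriv (UNIV - {0}) u) x + step_potential Vp Vm x * u x"

definition rho_L :: "complex \<Rightarrow> complex \<Rightarrow> complex \<Rightarrow> complex set" where
  "rho_L Vp Vm \<alpha> = resolvent_set (dom_L \<alpha>) (op_L Vp Vm)"

subsection \<open>The pseudomodes\<close>

text \<open>\<open>wave_k V\<^sub>+\<close> is \<open>k\<^sub>+\<close> and \<open>wave_k V\<^sub>-\<close> is \<open>k\<^sub>-\<close>.\<close>

definition wave_k :: "complex \<Rightarrow> complex \<Rightarrow> complex" where
  "wave_k V z = csqrt (V - z)"

definition n1 :: "complex \<Rightarrow> complex \<Rightarrow> complex \<Rightarrow> complex \<Rightarrow> complex" where
  "n1 Vp Vm \<alpha> z =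
     (wave_k Vp z + cnj (wave_k Vm z) + \<alpha>) / (wave_k Vp z + wave_k Vm z + \<alpha>)
       * complex_of_real \<bar>Im Vp - Im z\<bar>
     + (wave_k Vp z - cnj (wave_k Vp z)) / (wave_k Vp z + wave_k Vm z + \<alpha>)
       * complex_of_real \<bar>Im Vm - Im z\<bar>"

definition p1 :: "complex \<Rightarrow> complex \<Rightarrow> complex \<Rightarrow> complex \<Rightarrow> complex" where
  "p1 Vp Vm \<alpha> z =
     - ((wave_k Vm z - cnj (wave_k Vm z)) / (wave_k Vp z + wave_k Vm z + \<alpha>))
       * complex_of_real \<bar>Im Vp - Im z\<bar>
     - (cnj (wave_k Vp z) + wave_k Vm z + \<alpha>) / (wave_k Vp z + wave_k Vm z + \<alpha>)
       * complex_of_real \<bar>Im Vm - Im z\<bar>"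

definition n2 :: "complex \<Rightarrow> complex \<Rightarrow> complex" where
  "n2 Vp z = - complex_of_real \<bar>Im Vp - Im z\<bar>"

definition p2 :: "complex \<Rightarrow> complex \<Rightarrow> complex" where
  "p2 Vm z = complex_of_real \<bar>Im Vm - Im z\<bar>"

definition Psi :: "complex \<Rightarrow> complex \<Rightarrow> complex \<Rightarrow> complex \<Rightarrow> real \<Rightarrow> complex" where
  "Psi Vp Vm \<alpha> z x =
     (n1 Vp Vm \<alpha> z * exp (wave_k Vm z * complex_of_real x)
       + n2 Vp z * exp (cnj (wave_k Vm z) * complex_of_real x)) * indicator {..<0} x
     + (p1 Vp Vm \<alpha> z * exp (- wave_k Vp z * complex_of_real x)
       + p2 Vm z * exp (- cnj (wave_k Vp z) * complex_of_real x)) * indicator {0<..} x"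

end

theory Submission
  imports Defs
begin

text \<open>
  Write \<open>k\<close> and \<open>m\<close> for the two roots \<open>wave_k Vp z\<close> and \<open>wave_k Vm z\<close>, \<open>a\<close> and \<open>b\<close> for the distances of \<open>Im z\<close> from
  \<open>Im Vp\<close> and \<open>Im Vm\<close>, and \<open>L\<close> for the distance between \<open>Im Vp\<close> and \<open>Im Vm\<close>.

  The pseudomode combines two exponentials on each half-line. Those with exponents \<open>k\<close> and \<open>m\<close> solve
  the homogeneous equation; the conjugate ones do not, and their residuals are explicit because
  \<open>k\<^sup>2 - (cnj k)\<^sup>2 = 2 \<i> Im (Vp - z)\<close>. The coefficients \<open>n1\<close> and \<open>p1\<close> solve the interface conditions at the origin. The squared norm of
  the residual is therefore exactly \<open>(2 a b)\<^sup>2 S\<close> with \<open>S = 1 / (2 Re k) + 1 / (2 Re m)\<close>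
  (\<open>Psi_dom_and_residual\<close>). For large \<open>r = sqrt (Re z)\<close> the roots are \<open>\<plusminus> \<i> r + O(1 / r)\<close> with opposite signs, since \<open>Im z\<close> lies
  between \<open>Im Vp\<close> and \<open>Im Vm\<close>; so \<open>k + m + \<alpha>\<close> tends to \<open>\<alpha>\<close>, and \<open>\<bar>n1\<bar>\<close> and \<open>\<bar>p1\<bar>\<close> are
  \<open>2 r L / \<bar>\<alpha>\<bar> + O(1)\<close>, while \<open>n2\<close> and \<open>p2\<close> are bounded. All exponentials on one half-line have the same modulus, so the norm of the
  pseudomode is \<open>(2 r L / \<bar>\<alpha>\<bar> + O(1)) sqrt S\<close>. In the quotient of the norms \<open>sqrt S\<close> cancels, and with it the only
  quantities that degenerate when \<open>Im z\<close> approaches an end of the segment: this is why the result is uniform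
  (\<open>pseudomode_asymptotics\<close>).

  The membership claims need the resolvent set. On a half-line the equation \<open>- v'' + k\<^sup>2 v = f\<close> factors into
  \<open>y' = k y - f\<close> and \<open>v' = - k v + y\<close>, and for \<open>Re k > 0\<close> energy identities for \<open>\<bar>y\<bar>\<^sup>2\<close> and \<open>\<bar>v\<bar>\<^sup>2\<close>
  bound \<open>y\<close>, \<open>y 0\<close> and \<open>v\<close> (\<open>half_line_estimate\<close>, \<open>half_line_solution\<close>). The interface condition becomes
  \<open>(k + m + \<alpha>) u(0) = y\<^sub>+(0) + y\<^sub>-(0)\<close>. Hence \<open>z\<close> is in the resolvent set if \<open>Re k > 0\<close>, \<open>Re m > 0\<close> and \<open>k + m + \<alpha> \<noteq> 0\<close> (\<open>rho_L_I\<close>).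
  Conversely, an imaginary root admits approximate eigenfunctions made of slowly damped exponentials, and \<open>k + m + \<alpha> = 0\<close>
  admits an eigenfunction (\<open>rho_L_D\<close>); so every point of the resolvent set satisfies the three conditions that put
  the pseudomode into the domain.

  All of this concerns classical functions. The link to weak derivatives is the du Bois-Reymond lemma: a function with an
  integrable weak derivative on an interval is, almost everywhere, a primitive of it. It rests on explicit
  smooth bumps and identifies the domain with pairs of half-line functions matched at the origin
  (\<open>dom_L_I\<close>, \<open>dom_L_E\<close>).
\<close>

section \<open>Absolutely continuous functions as primitives\<close>

text \<open>
  Absolute continuity in integrated form: \<open>v\<close> is an antiderivative of a function \<open>g\<close> that
  may be merely integrable and matters only up to null sets. The representatives of Sobolev functions on an interval are exactly
  of this kind. On \<open>{0..}\<close> and \<open>{..0}\<close> the notion includes the endpoint, and hence the traces at the origin.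
\<close>

definition primitive_on :: "real set \<Rightarrow> (real \<Rightarrow> complex) \<Rightarrow> (real \<Rightarrow> complex) \<Rightarrow> bool" where
  "primitive_on I v g \<longleftrightarrow>
     (\<forall>s\<in>I. \<forall>t\<in>I. s \<le> t \<longrightarrow> g absolutely_integrable_on {s..t} \<and> integral {s..t} g = v t - v s)"

lemma is_interval_Icc_subset:
  fixes s t :: real
  assumes "is_interval I" "s \<in> I" "t \<in> I"
  shows "{s..t} \<subseteq> I"
  using assms unfolding is_interval_1 subset_iff atLeastAtMost_iff by blast

lemma primitive_on_subset: "primitive_on I v g \<Longrightarrow> J \<subseteq> I \<Longrightarrow> primitive_on J v g"
  unfolding primitive_on_def by blast

lemma primitive_onD:
  assumes "primitive_on I v g" "s \<in> I" "t \<in> I" "s \<le> t"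
  shows "g absolutely_integrable_on {s..t}" "integral {s..t} g = v t - v s"
    "g integrable_on {s..t}"
  using assms set_lebesgue_integral_eq_integral(1) unfolding primitive_on_def by blast+

lemma primitive_on_Icc_continuous:
  assumes "primitive_on {a..b} v g"
  shows "continuous_on {a..b} v"
proof (cases "a \<le> b")
  case True
  have "continuous_on {a..b} (\<lambda>x. v a + integral {a..x} g)"
    using primitive_onD(3)[OF assms, of a b] True
    by (intro continuous_intros indefinite_integral_continuous_1) auto
  then show ?thesis
    by (rule continuous_on_eq) (use primitive_onD(2)[OF assms, of a] True in auto)
qed simp

lemma primitive_on_Ici_continuous:
  assumes "primitive_on {a..} v g"
  shows "continuous_on {a..} v"
  unfolding continuous_on_eq_continuous_within
proof
  fix x assume x: "x \<in> {a..}"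
  have "continuous_on {a..x+1} v"
    by (rule primitive_on_Icc_continuous, rule primitive_on_subset[OF assms]) auto
  then have "continuous (at x within {a..x+1}) v"
    using x by (simp add: continuous_on_eq_continuous_within)
  moreover have "at x within {a..x+1} = at x within {a..}"
    by (rule at_within_nhd[of _ "{..<x+1}"]) auto
  ultimately show "continuous (at x within {a..}) v"
    by (simp add: continuous_within)
qed

lemma primitive_on_UNIV_continuous:
  assumes "primitive_on UNIV v g"
  shows "continuous_on UNIV v"
  unfolding continuous_on_eq_continuous_within
proof
  fix x :: real
  have "continuous_on {x-1..} v"
    by (rule primitive_on_Ici_continuous, rule primitive_on_subset[OF assms]) auto
  then have "continuous (at x within {x-1..}) v"
    by (simp add: continuous_on_eq_continuous_within)
  moreover have "at x within {x-1..} = at x within UNIV"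
    by (rule at_within_nhd[of _ "{x-1<..}"]) auto
  ultimately show "continuous (at x within UNIV) v"
    by (simp add: continuous_within)
qed

lemma absolutely_integrable_continuous_mult:
  fixes v g :: "real \<Rightarrow> complex"
  assumes "continuous_on {a..b} v" "g absolutely_integrable_on {a..b}"
  shows "(\<lambda>x. v x * g x) absolutely_integrable_on {a..b}"
    "(\<lambda>x. g x * v x) absolutely_integrable_on {a..b}"
proof -
  have *: "v \<in> borel_measurable (lebesgue_on {a..b})"
    by (rule continuous_imp_measurable_on_sets_lebesgue[OF assms(1)]) auto
  have b: "bounded (v ` {a..b})"
    by (intro compact_imp_bounded compact_continuous_image assms) auto
  show "(\<lambda>x. v x * g x) absolutely_integrable_on {a..b}"
    by (rule absolutely_integrable_bounded_measurable_product[OF bilinear_times * _ b assms(2)]) auto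
  then show "(\<lambda>x. g x * v x) absolutely_integrable_on {a..b}"
    by (simp add: mult.commute)
qed

lemma integral_Icc_diff:
  fixes k :: "real \<Rightarrow> 'a::euclidean_space"
  assumes "a \<le> s \<and> s \<le> t" "k absolutely_integrable_on {a..t}"
  shows "integral {a..t} k - integral {a..s} k = integral {s..t} k"
proof -
  have "integral {a..s} k + integral {s..t} k = integral {a..t} k"
    using assms set_lebesgue_integral_eq_integral(1)
    by (intro Henstock_Kurzweil_Integration.integral_combine) auto
  then show ?thesis by (metis add_diff_cancel_left')
qed

text \<open>
  A function whose increments over short intervals are dominated by those of \<open>H\<close> is dominated globally;
  the increments are summed over a fine equidistant partition.
\<close>

lemma norm_increment_le:
  fixes F :: "real \<Rightarrow> 'a::real_normed_vector" and H :: "real \<Rightarrow> real"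
  assumes "a \<le> b" "\<delta> > 0"
    and step: "\<And>s t. a \<le> s \<Longrightarrow> s \<le> t \<Longrightarrow> t \<le> b \<Longrightarrow> t - s < \<delta> \<Longrightarrow> norm (F t - F s) \<le> \<epsilon> * (H t - H s)"
  shows "norm (F b - F a) \<le> \<epsilon> * (H b - H a)"
proof -
  obtain n :: nat where n: "(b - a) / \<delta> < real n" using reals_Archimedean2 by blast
  have n0: "n > 0" using n assms by (metis divide_nonneg_pos diff_ge_0_iff_ge gr0I not_less of_nat_0)
  define x where "x i = a + real i * ((b - a) / real n)" for i :: nat
  have x0: "x 0 = a" and xn: "x n = b" using n0 by (auto simp: x_def)
  have d: "(b - a) / real n < \<delta>" "(b - a) / real n \<ge> 0" using n n0 assms by (auto simp: field_simps)
  have dx: "x (Suc i) - x i = (b - a) / real n" for i by (simp add: x_def algebra_simps add_divide_distrib diff_divide_distrib)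
  have xb: "a \<le> x i" "i \<le> n \<Longrightarrow> x i \<le> b" for i
  proof -
    show "a \<le> x i" using mult_nonneg_nonneg[OF of_nat_0_le_iff d(2), of i] unfolding x_def by linarith
    assume "i \<le> n"
    then have "real i * ((b - a) / real n) \<le> real n * ((b - a) / real n)"
      using d by (intro mult_right_mono) auto
    then show "x i \<le> b" using xn by (simp add: x_def)
  qed
  have "i \<le> n \<Longrightarrow> norm (F (x i) - F a) \<le> \<epsilon> * (H (x i) - H a)" for i
  proof (induction i)
    case (Suc i)
    have "norm (F (x (Suc i)) - F (x i)) \<le> \<epsilon> * (H (x (Suc i)) - H (x i))"
      using step[of "x i" "x (Suc i)"] xb[of i] xb[of "Suc i"] dx[of i] d Suc.prems by auto
    moreover have "norm (F (x (Suc i)) - F a) \<le> norm (F (x (Suc i)) - F (x i)) + norm (F (x i) - F a)"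
      by (metis add.commute add_diff_eq diff_add_cancel norm_triangle_ineq)
    ultimately show ?case using Suc by (simp add: algebra_simps)
  qed (simp add: x0)
  from this[of n] show ?thesis by (simp add: xn)
qed

text \<open>
  The product rule for absolutely continuous functions without differentiation and without Fubini. Over
  a short interval \<open>[s, t]\<close> the increment of \<open>v w\<close> is exactly \<open>\<integral> (f w(s) + v(t) g)\<close>; replacing the frozen values by
  \<open>w(x)\<close> and \<open>v(x)\<close> costs at most \<open>\<epsilon> \<integral> (\<bar>f\<bar> + \<bar>g\<bar>)\<close> by uniform continuity, and these errors add up to
  \<open>\<epsilon>\<close> times a constant over the whole interval.
\<close>

lemma primitive_on_Icc_mult:
  assumes ab: "a \<le> b" and v: "primitive_on {a..b} v f" and w: "primitive_on {a..b} w g"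
  shows "(\<lambda>x. f x * w x + v x * g x) absolutely_integrable_on {a..b} \<and>
    integral {a..b} (\<lambda>x. f x * w x + v x * g x) = v b * w b - v a * w a"
proof -
  let ?h = "\<lambda>x. f x * w x + v x * g x"
  note cv = primitive_on_Icc_continuous[OF v] and cw = primitive_on_Icc_continuous[OF w]
  have fi: "f absolutely_integrable_on {a..b}" and gi: "g absolutely_integrable_on {a..b}"
    using v w ab by (auto simp: primitive_on_def)
  have hi: "?h absolutely_integrable_on {a..b}"
    by (intro set_integral_add absolutely_integrable_continuous_mult cv cw fi gi)
  have sub: "k absolutely_integrable_on {s..t}"
    if "k absolutely_integrable_on {a..b}" "a \<le> s" "t \<le> b" for k :: "real \<Rightarrow> 'c::euclidean_space" and s t
    by (rule absolutely_integrable_on_subinterval[OF that(1)]) (use that in auto)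
  define N where "N x = norm (f x) + norm (g x)" for x
  have Ni: "N absolutely_integrable_on {a..b}"
    unfolding N_def by (intro set_integral_add absolutely_integrable_norm[unfolded o_def] fi gi)
  \<comment> \<open>\<open>F\<close> is the defect of the product rule up to \<open>x\<close>, and \<open>H\<close> the mass that controls its increments.\<close>
  define H where "H x = integral {a..x} N" for x
  define F where "F x = v x * w x - integral {a..x} ?h" for x
  have key: "norm (F b - F a) \<le> \<epsilon> * (H b - H a)" if e: "\<epsilon> > 0" for \<epsilon>
  proof -
    have "uniformly_continuous_on {a..b} v" "uniformly_continuous_on {a..b} w"
      by (intro compact_uniformly_continuous cv cw compact_Icc)+
    then obtain d1 d2 where d: "d1 > 0" "d2 > 0"
       and d1: "\<forall>x\<in>{a..b}. \<forall>y\<in>{a..b}. dist y x < d1 \<longrightarrow> dist (v y) (v x) < \<epsilon>"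
       and d2: "\<forall>x\<in>{a..b}. \<forall>y\<in>{a..b}. dist y x < d2 \<longrightarrow> dist (w y) (w x) < \<epsilon>"
      using e unfolding uniformly_continuous_on_def by blast
    show ?thesis
    proof (rule norm_increment_le[OF ab, of "min d1 d2"])
      fix s t assume st: "a \<le> s" "s \<le> t" "t \<le> b" "t - s < min d1 d2"
      have prim: "integral {s..t} f = v t - v s" "integral {s..t} g = w t - w s"
        using primitive_onD(2)[OF v, of s] primitive_onD(2)[OF w, of s] st by auto
      have I: "f absolutely_integrable_on {s..t}" "g absolutely_integrable_on {s..t}"
        "?h absolutely_integrable_on {s..t}" "N absolutely_integrable_on {s..t}"
        using sub[OF fi] sub[OF gi] sub[OF hi] sub[OF Ni] st by blast+
      note J = I[THEN set_lebesgue_integral_eq_integral(1)]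
      have H: "H t - H s = integral {s..t} N"
        unfolding H_def by (rule integral_Icc_diff[OF _ sub[OF Ni]]) (use st in auto)
      have ih: "integral {a..t} ?h - integral {a..s} ?h = integral {s..t} ?h"
        by (rule integral_Icc_diff[OF _ sub[OF hi]]) (use st in auto)
      have "v t * w t - v s * w s = (v t - v s) * w s + v t * (w t - w s)" by (simp add: algebra_simps)
      also have "\<dots> = integral {s..t} (\<lambda>x. f x * w s + v t * g x)"
        using integral_add[OF integrable_on_mult_left[OF J(1), of "w s"] integrable_on_mult_right[OF J(2), of "v t"]]
        by (simp add: prim)
      finally have "F t - F s = integral {s..t} (\<lambda>x. f x * w s + v t * g x) - integral {s..t} ?h"
        using ih by (simp add: F_def algebra_simps)
      also have "\<dots> = integral {s..t} (\<lambda>x. (f x * w s + v t * g x) - ?h x)"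
        by (rule integral_diff[OF integrable_add[OF integrable_on_mult_left[OF J(1)]
              integrable_on_mult_right[OF J(2)]] J(3), symmetric])
      finally have eq: "F t - F s = integral {s..t} (\<lambda>x. (f x * w s + v t * g x) - ?h x)" .
      have "norm (F t - F s) \<le> integral {s..t} (\<lambda>x. \<epsilon> * N x)"
        unfolding eq
      proof (rule integral_norm_bound_integral)
        show "(\<lambda>x. (f x * w s + v t * g x) - ?h x) integrable_on {s..t}"
          by (rule integrable_diff[OF integrable_add[OF integrable_on_mult_left[OF J(1)]
              integrable_on_mult_right[OF J(2)]] J(3)])
        show "(\<lambda>x. \<epsilon> * N x) integrable_on {s..t}" using J by (intro integrable_on_mult_right)
        fix x assume x: "x \<in> {s..t}"
        have "norm (w s - w x) \<le> \<epsilon>" "norm (v t - v x) \<le> \<epsilon>"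
          using d1[rule_format, of x t] d2[rule_format, of x s] x st by (auto simp: dist_norm)
        then have "norm (f x) * norm (w s - w x) + norm (v t - v x) * norm (g x)
            \<le> norm (f x) * \<epsilon> + \<epsilon> * norm (g x)"
          by (intro add_mono mult_left_mono mult_right_mono) auto
        moreover have "(f x * w s + v t * g x) - ?h x = f x * (w s - w x) + (v t - v x) * g x"
          by (simp add: algebra_simps)
        ultimately show "norm ((f x * w s + v t * g x) - ?h x) \<le> \<epsilon> * N x"
          using norm_triangle_ineq[of "f x * (w s - w x)" "(v t - v x) * g x"]
          unfolding N_def norm_mult by (simp add: distrib_left mult.commute)
      qed
      then show "norm (F t - F s) \<le> \<epsilon> * (H t - H s)" by (simp add: H)
    qed (use d in auto)
  qed
  have "norm (F b - F a) \<le> 0"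
  proof (rule field_le_epsilon)
    fix e :: real assume "e > 0"
    have H0: "H b - H a \<ge> 0" unfolding H_def
      using integral_nonneg[OF set_lebesgue_integral_eq_integral(1)[OF Ni]] by (simp add: N_def)
    have "norm (F b - F a) \<le> e / (H b - H a + 1) * (H b - H a)"
      using H0 \<open>e > 0\<close> by (intro key) auto
    also have "\<dots> \<le> e" using H0 \<open>e > 0\<close> by (simp add: field_simps)
    finally show "norm (F b - F a) \<le> 0 + e" by simp
  qed
  then have "v b * w b - integral {a..b} ?h = v a * w a" by (simp add: F_def)
  then have "integral {a..b} ?h = v b * w b - v a * w a"
    by (metis add_diff_cancel_left' diff_add_cancel)
  then show ?thesis using hi by simp
qed

lemma primitive_on_mult:
  assumes "is_interval I" "primitive_on I v f" "primitive_on I w g"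
  shows "primitive_on I (\<lambda>x. v x * w x) (\<lambda>x. f x * w x + v x * g x)"
proof (unfold primitive_on_def, intro ballI impI)
  fix s t assume st: "s \<in> I" "t \<in> I" "s \<le> t"
  have "{s..t} \<subseteq> I" by (rule is_interval_Icc_subset[OF assms(1) st(1,2)])
  then show "(\<lambda>x. f x * w x + v x * g x) absolutely_integrable_on {s..t} \<and>
      integral {s..t} (\<lambda>x. f x * w x + v x * g x) = v t * w t - v s * w s"
    by (intro primitive_on_Icc_mult[OF st(3)] primitive_on_subset[OF assms(2)]
          primitive_on_subset[OF assms(3)])
qed

lemma primitive_on_add:
  assumes "primitive_on I v f" "primitive_on I w g"
  shows "primitive_on I (\<lambda>x. v x + w x) (\<lambda>x. f x + g x)"
  using primitive_onD[OF assms(1)] primitive_onD[OF assms(2)]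
  unfolding primitive_on_def by (auto simp: integral_add intro: set_integral_add)

lemma primitive_on_cmult:
  assumes "primitive_on I v f"
  shows "primitive_on I (\<lambda>x. c * v x) (\<lambda>x. c * f x)"
  using primitive_onD[OF assms]
  unfolding primitive_on_def by (auto simp: right_diff_distrib)

lemma primitive_on_const: "primitive_on I (\<lambda>x. c) (\<lambda>x. 0)"
  unfolding primitive_on_def by auto

lemma primitive_on_has_vector_derivative:
  assumes "\<And>x. x \<in> I \<Longrightarrow> (v has_vector_derivative f x) (at x)" "is_interval I" "continuous_on I f"
  shows "primitive_on I v f"
proof (unfold primitive_on_def, intro ballI impI)
  fix s t assume st: "s \<in> I" "t \<in> I" "s \<le> t"
  have sub: "{s..t} \<subseteq> I" by (rule is_interval_Icc_subset[OF assms(2) st(1,2)])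
  have "(f has_integral (v t - v s)) {s..t}"
    using has_vector_derivative_at_within[OF assms(1)] sub st(3)
    by (intro fundamental_theorem_of_calculus) auto
  moreover have "f absolutely_integrable_on {s..t}"
    by (rule absolutely_integrable_continuous_real, rule continuous_on_subset[OF assms(3) sub])
  ultimately show "f absolutely_integrable_on {s..t} \<and> integral {s..t} f = v t - v s" by auto
qed

lemma primitive_on_cnj:
  assumes "primitive_on I v f"
  shows "primitive_on I (\<lambda>x. cnj (v x)) (\<lambda>x. cnj (f x))"
  unfolding primitive_on_def
proof (intro ballI impI conjI)
  fix s t assume st: "s \<in> I" "t \<in> I" "s \<le> t"
  show "integral {s..t} (\<lambda>x. cnj (f x)) = cnj (v t) - cnj (v s)"
    using primitive_onD(2)[OF assms st] by (simp add: integral_cnj[symmetric])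
  show "(\<lambda>x. cnj (f x)) absolutely_integrable_on {s..t}"
    using absolutely_integrable_linear[OF primitive_onD(1)[OF assms st] bounded_linear_cnj]
    by (simp add: o_def)
qed

section \<open>Smooth bumps and test functions\<close>

lemma power_le_fact_mult_exp:
  fixes t :: real
  assumes "t \<ge> 0"
  shows "t ^ n \<le> fact n * exp t"
proof -
  have "(\<Sum>k\<in>{n}. t ^ k /\<^sub>R fact k) \<le> (\<Sum>k. t ^ k /\<^sub>R fact k)"
    by (rule sum_le_suminf[OF summable_exp_generic]) (use assms in auto)
  also have "\<dots> = exp t" by (simp add: exp_def)
  finally show ?thesis by (simp add: field_simps divideR_right)
qed

text \<open>
  The class \<open>P / w\<^sup>m * exp (- \<epsilon> / w)\<close> on \<open>(a, b)\<close> with \<open>w = (x - a) (b - x)\<close> is closed under differentiation,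
  which makes smoothness a one-step induction. As \<open>\<epsilon>\<close> tends to zero the member with \<open>m = 0\<close> and \<open>P = 1\<close> tends to the
  indicator function of \<open>(a, b)\<close>, so the same functions serve as approximations of intervals.
\<close>

definition bump :: "real \<Rightarrow> real \<Rightarrow> real \<Rightarrow> nat \<Rightarrow> real poly \<Rightarrow> real \<Rightarrow> real" where
  "bump a b \<epsilon> m P x =
     (if a < x \<and> x < b then poly P x / ((x - a) * (b - x)) ^ m * exp (- \<epsilon> / ((x - a) * (b - x))) else 0)"

lemma DERIV_zero_of_quadratic_bound:
  fixes f :: "real \<Rightarrow> real"
  assumes "f c = 0" "\<And>x. \<bar>f x\<bar> \<le> K * (x - c)\<^sup>2"
  shows "(f has_real_derivative 0) (at c)"
proof -
  have "((\<lambda>x. f x / (x - c)) \<longlongrightarrow> 0) (at c)"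
  proof (rule Lim_null_comparison)
    show "\<forall>\<^sub>F x in at c. norm (f x / (x - c)) \<le> K * \<bar>x - c\<bar>"
    proof (rule eventually_at_topological[THEN iffD2], intro exI[of _ UNIV] conjI ballI impI)
      fix x assume "x \<noteq> c"
      then show "norm (f x / (x - c)) \<le> K * \<bar>x - c\<bar>"
        using assms(2)[of x] by (simp add: divide_le_eq power2_eq_square abs_mult mult.assoc)
    qed auto
    show "((\<lambda>x. K * \<bar>x - c\<bar>) \<longlongrightarrow> 0) (at c)"
      by (rule tendsto_eq_rhs[where x="K * \<bar>c - c\<bar>"]) (intro tendsto_intros, simp)
  qed
  then show ?thesis using assms(1) by (simp add: has_field_derivative_iff)
qed

text \<open>
  The exponential beats every negative power of \<open>w\<close>, so the function is \<open>O(w\<^sup>2)\<close>; this gives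
  derivative zero at both endpoints.
\<close>

lemma bump_quadratic_bound:
  assumes "a < b" "\<epsilon> > 0"
  obtains K where "\<And>x. \<bar>bump a b \<epsilon> m P x\<bar> \<le> K * (x - a)\<^sup>2" "\<And>x. \<bar>bump a b \<epsilon> m P x\<bar> \<le> K * (x - b)\<^sup>2"
proof -
  have "bounded (poly P ` {a..b})"
    by (intro compact_imp_bounded compact_continuous_image continuous_intros) auto
  then obtain B where "B > 0" "\<forall>x\<in>{a..b}. \<bar>poly P x\<bar> \<le> B"
    unfolding bounded_pos ball_simps by auto
  then have B: "\<And>x. x \<in> {a..b} \<Longrightarrow> \<bar>poly P x\<bar> \<le> B" "B > 0" by blast+
  define K0 where "K0 = B * (fact (m+2) / \<epsilon> ^ (m+2))"
  have K0: "K0 \<ge> 0" using B assms by (simp add: K0_def)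
  have *: "\<bar>bump a b \<epsilon> m P x\<bar> \<le> K0 * ((x - a) * (b - x))\<^sup>2" for x
  proof (cases "a < x \<and> x < b")
    case True
    define w where "w = (x - a) * (b - x)"
    have w: "w > 0" using True by (simp add: w_def)
    have "(\<epsilon> / w) ^ (m+2) * exp (- \<epsilon> / w) \<le> fact (m+2) * exp (\<epsilon>/w) * exp (- \<epsilon> / w)"
      by (intro mult_right_mono power_le_fact_mult_exp) (use w assms in auto)
    also have "\<dots> = fact (m+2)" by (simp add: mult.assoc flip: exp_add)
    finally have "exp (- \<epsilon> / w) / w ^ m \<le> fact (m+2) / \<epsilon> ^ (m+2) * w\<^sup>2"
    proof -
      assume le: "(\<epsilon> / w) ^ (m+2) * exp (- \<epsilon> / w) \<le> fact (m+2)"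
      define F p where "F = (fact (m+2) :: real)" and "p = \<epsilon> ^ (m+2)"
      have "p > 0" using assms by (simp add: p_def)
      have "p / (w ^ m * w\<^sup>2) * exp (- \<epsilon> / w) \<le> F"
        using le by (simp only: power_divide power_add F_def p_def times_divide_times_eq)
      then show ?thesis
        unfolding F_def[symmetric] p_def[symmetric] using w \<open>p > 0\<close> by (simp add: field_simps)
    qed
    then have "\<bar>poly P x\<bar> * (exp (- \<epsilon> / w) / w ^ m) \<le> B * (fact (m+2) / \<epsilon> ^ (m+2) * w\<^sup>2)"
      using B True w by (intro mult_mono) auto
    then show ?thesis using True w by (simp add: bump_def K0_def abs_mult flip: w_def)
  qed (use K0 in \<open>auto simp: bump_def\<close>)
  have s: "bump a b \<epsilon> m P x = 0" if "\<not> (a < x \<and> x < b)" for x using that by (auto simp: bump_def)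
  have 1: "((x - a) * (b - x))\<^sup>2 \<le> (b-a)\<^sup>2 * (x-a)\<^sup>2" "((x - a) * (b - x))\<^sup>2 \<le> (b-a)\<^sup>2 * (x-b)\<^sup>2"
    if "a < x \<and> x < b" for x
  proof -
    have "(b-x)\<^sup>2 \<le> (b-a)\<^sup>2" "(x-a)\<^sup>2 \<le> (b-a)\<^sup>2" using that by (auto intro!: power_mono)
    then show "((x - a) * (b - x))\<^sup>2 \<le> (b-a)\<^sup>2 * (x-a)\<^sup>2" "((x - a) * (b - x))\<^sup>2 \<le> (b-a)\<^sup>2 * (x-b)\<^sup>2"
      using mult_right_mono[of "(b-x)\<^sup>2" "(b-a)\<^sup>2" "(x-a)\<^sup>2"]
        mult_right_mono[of "(x-a)\<^sup>2" "(b-a)\<^sup>2" "(b-x)\<^sup>2"]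
      unfolding power_mult_distrib power2_commute[of x b] by (simp_all only: mult.commute zero_le_power2)
  qed
  show ?thesis
  proof (rule that[of "K0 * (b-a)\<^sup>2"])
    fix x
    show "\<bar>bump a b \<epsilon> m P x\<bar> \<le> K0 * (b-a)\<^sup>2 * (x - a)\<^sup>2"
      using *[of x] mult_left_mono[OF 1(1)[of x] K0] s[of x] K0
      by (cases "a < x \<and> x < b") (auto simp: mult.assoc intro: order_trans)
    show "\<bar>bump a b \<epsilon> m P x\<bar> \<le> K0 * (b-a)\<^sup>2 * (x - b)\<^sup>2"
      using *[of x] mult_left_mono[OF 1(2)[of x] K0] s[of x] K0
      by (cases "a < x \<and> x < b") (auto simp: mult.assoc intro: order_trans)
  qed
qed

text \<open>
  The numerator of the derivative over the denominator \<open>w ^ (m + 2)\<close>, by the quotient rule.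
\<close>

definition bump_poly_deriv :: "real \<Rightarrow> real \<Rightarrow> real \<Rightarrow> nat \<Rightarrow> real poly \<Rightarrow> real poly" where
  "bump_poly_deriv a b \<epsilon> m P =
     (let w = [:- a, 1:] * [:b, - 1:]
      in pderiv P * w\<^sup>2 - smult (real m) (P * w * pderiv w) + smult \<epsilon> (P * pderiv w))"

lemma DERIV_bump:
  assumes ab: "a < b" "\<epsilon> > 0"
  shows "(bump a b \<epsilon> m P has_real_derivative bump a b \<epsilon> (m + 2) (bump_poly_deriv a b \<epsilon> m P) x) (at x)"
proof -
  obtain K where K: "\<And>x. \<bar>bump a b \<epsilon> m P x\<bar> \<le> K * (x - a)\<^sup>2" "\<And>x. \<bar>bump a b \<epsilon> m P x\<bar> \<le> K * (x - b)\<^sup>2"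
    using bump_quadratic_bound[OF assms] by blast
  consider "x = a" | "x = b" | "x < a" | "x > b" | "a < x" "x < b" by linarith
  then show ?thesis
  proof cases
    case 1
    then show ?thesis using DERIV_zero_of_quadratic_bound[of "bump a b \<epsilon> m P" a K] K by (simp add: bump_def)
  next
    case 2
    then show ?thesis using DERIV_zero_of_quadratic_bound[of "bump a b \<epsilon> m P" b K] K by (simp add: bump_def)
  next
    case 3
    have "(bump a b \<epsilon> m P has_real_derivative 0) (at x)"
      by (rule has_field_derivative_transform_within_open[of "\<lambda>_. 0" _ _ "{..<a}"])
        (use 3 in \<open>auto simp: bump_def\<close>)
    then show ?thesis using 3 by (simp add: bump_def)
  next
    case 4
    have "(bump a b \<epsilon> m P has_real_derivative 0) (at x)"
      by (rule has_field_derivative_transform_within_open[of "\<lambda>_. 0" _ _ "{b<..}"])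
        (use 4 in \<open>auto simp: bump_def\<close>)
    then show ?thesis using 4 by (simp add: bump_def)
  next
    case 5
    define wp where "wp = [:- a, 1:] * [:b, - 1:]"
    define w where "w = poly wp"
    have w: "w x = (x - a) * (b - x)" for x by (simp add: w_def wp_def algebra_simps)
    have wx: "w x > 0" using 5 by (simp add: w)
    have dw: "(w has_real_derivative poly (pderiv wp) x) (at x)"
      unfolding w_def by (rule poly_DERIV)
    have wx': "w x ^ m * exp (\<epsilon> / w x) \<noteq> 0" using wx by simp
    have "((\<lambda>x. poly P x / w x ^ m * exp (- \<epsilon> / w x)) has_real_derivative
       ((poly (pderiv P) x * w x ^ m - poly P x * (real m * w x ^ (m - 1) * poly (pderiv wp) x)) / (w x ^ m * w x ^ m))
        * exp (- \<epsilon> / w x) + poly P x / w x ^ m * (exp (- \<epsilon> / w x) * (\<epsilon> * poly (pderiv wp) x / (w x * w x)))) (at x)"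
      (is "(_ has_real_derivative ?D) _")
      using wx by (auto intro!: derivative_eq_intros dw poly_DERIV) (simp add: divide_simps, simp add: algebra_simps)
    moreover have "?D = poly (bump_poly_deriv a b \<epsilon> m P) x / w x ^ (m+2) * exp (- \<epsilon> / w x)"
    proof -
      have e: "poly (bump_poly_deriv a b \<epsilon> m P) x = poly (pderiv P) x * (w x)\<^sup>2
          - real m * (poly P x * w x * poly (pderiv wp) x) + \<epsilon> * (poly P x * poly (pderiv wp) x)"
        unfolding bump_poly_deriv_def Let_def wp_def[symmetric] by (simp add: w_def)
      show ?thesis
        unfolding e using wx by (cases m) (simp_all add: field_simps power2_eq_square)
    qed
    ultimately have "((\<lambda>x. poly P x / w x ^ m * exp (- \<epsilon> / w x)) has_real_derivative
        bump a b \<epsilon> (m + 2) (bump_poly_deriv a b \<epsilon> m P) x) (at x)"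
      using 5 by (simp add: bump_def w)
    then show ?thesis
      by (rule has_field_derivative_transform_within_open[of _ _ _ "{a<..<b}"])
        (use 5 in \<open>auto simp: bump_def w\<close>)
  qed
qed

lemma test_functionsI:
  assumes "\<And>n x. ((deriv ^^ n) \<phi>) field_differentiable (at x)"
    and "compact K" "K \<subseteq> \<Omega>" "\<And>x. x \<notin> K \<Longrightarrow> \<phi> x = 0"
  shows "\<phi> \<in> test_functions \<Omega>"
proof -
  have "closure {x. \<phi> x \<noteq> 0} \<subseteq> K"
    using assms(2,4) by (intro closure_minimal compact_imp_closed) auto
  then have "closure {x. \<phi> x \<noteq> 0} = K \<inter> closure {x. \<phi> x \<noteq> 0}" "closure {x. \<phi> x \<noteq> 0} \<subseteq> \<Omega>"
    using assms(3) by blast+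
  moreover have "compact (K \<inter> closure {x. \<phi> x \<noteq> 0})"
    by (rule compact_Int_closed[OF assms(2) closed_closure])
  ultimately have "compact (closure {x. \<phi> x \<noteq> 0})" "closure {x. \<phi> x \<noteq> 0} \<subseteq> \<Omega>"
    by simp_all
  then show ?thesis using assms(1) unfolding test_functions_def by blast
qed

lemma test_functionsE:
  assumes "\<phi> \<in> test_functions \<Omega>"
  obtains K where "compact K" "K \<subseteq> \<Omega>" "\<And>x. x \<notin> K \<Longrightarrow> \<phi> x = 0" "\<And>x. x \<notin> K \<Longrightarrow> deriv \<phi> x = 0"
proof -
  obtain S where S: "S = closure {x. \<phi> x \<noteq> 0}" by blast
  have z: "\<phi> y = 0" if "y \<notin> S" for y
    using that closure_subset[of "{x. \<phi> x \<noteq> 0}"] unfolding S by blast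
  have "closed S" by (simp add: S)
  show ?thesis
  proof (rule that[of S])
    show "compact S" "S \<subseteq> \<Omega>" using assms by (simp_all add: test_functions_def S)
    fix x assume x: "x \<notin> S"
    then show "\<phi> x = 0" by (rule z)
    have "(\<phi> has_real_derivative 0) (at x)"
      by (rule has_field_derivative_transform_within_open[of "\<lambda>_. 0" _ _ "- S"])
        (use x z \<open>closed S\<close> in auto)
    then show "deriv \<phi> x = 0" by (rule DERIV_imp_deriv)
  qed
qed

lemma test_functions_mono: "\<phi> \<in> test_functions \<Omega> \<Longrightarrow> \<Omega> \<subseteq> \<Omega>' \<Longrightarrow> \<phi> \<in> test_functions \<Omega>'"
  unfolding test_functions_def by auto

lemma test_functions_smooth:
  "\<phi> \<in> test_functions \<Omega> \<Longrightarrow> ((deriv ^^ n) \<phi>) field_differentiable (at x)"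
  unfolding test_functions_def by blast

lemma test_functions_DERIV:
  assumes "\<phi> \<in> test_functions \<Omega>"
  shows "(\<phi> has_real_derivative deriv \<phi> x) (at x)"
  using test_functions_smooth[OF assms, of 0] by (simp add: DERIV_deriv_iff_field_differentiable)

lemma test_functions_continuous:
  assumes "\<phi> \<in> test_functions \<Omega>"
  shows "continuous_on S \<phi>" "continuous_on S (deriv \<phi>)"
proof -
  have "\<phi> field_differentiable (at x)" "deriv \<phi> field_differentiable (at x)" for x
    using test_functions_smooth[OF assms, of 0 x] test_functions_smooth[OF assms, of 1 x] by auto
  then show "continuous_on S \<phi>" "continuous_on S (deriv \<phi>)"
    by (auto intro!: continuous_at_imp_continuous_on field_differentiable_imp_continuous_at)
qed

lemma bump_test_function:
  assumes "a < b" "\<epsilon> > 0" "{a..b} \<subseteq> \<Omega>"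
  shows "bump a b \<epsilon> m P \<in> test_functions \<Omega>"
proof (rule test_functionsI[of _ "{a..b}"])
  have "\<exists>m' P'. (deriv ^^ n) (bump a b \<epsilon> m P) = bump a b \<epsilon> m' P'" for n
  proof (induction n)
    case (Suc n)
    then obtain m' P' where *: "(deriv ^^ n) (bump a b \<epsilon> m P) = bump a b \<epsilon> m' P'" by blast
    have "deriv (bump a b \<epsilon> m' P') = bump a b \<epsilon> (m'+2) (bump_poly_deriv a b \<epsilon> m' P')"
      by (rule ext, rule DERIV_imp_deriv, rule DERIV_bump[OF assms(1,2)])
    then show ?case using * by auto
  qed auto
  then show "((deriv ^^ n) (bump a b \<epsilon> m P)) field_differentiable (at x)" for n x
    using DERIV_bump[OF assms(1,2)] by (metis field_differentiable_def)
qed (use assms in \<open>auto simp: bump_def\<close>)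

lemma test_functions_diff_cmult:
  assumes "\<phi> \<in> test_functions \<Omega>" "\<psi> \<in> test_functions \<Omega>"
  shows "(\<lambda>x. \<phi> x - c * \<psi> x) \<in> test_functions \<Omega>"
proof -
  obtain K L where K: "compact K" "K \<subseteq> \<Omega>" "\<And>x. x \<notin> K \<Longrightarrow> \<phi> x = 0"
    and L: "compact L" "L \<subseteq> \<Omega>" "\<And>x. x \<notin> L \<Longrightarrow> \<psi> x = 0"
    using test_functionsE[OF assms(1)] test_functionsE[OF assms(2)] by metis
  have *: "(deriv ^^ n) (\<lambda>x. \<phi> x - c * \<psi> x) = (\<lambda>x. (deriv ^^ n) \<phi> x - c * (deriv ^^ n) \<psi> x)" for n
  proof (induction n)
    case (Suc n)
    have "deriv (\<lambda>x. (deriv ^^ n) \<phi> x - c * (deriv ^^ n) \<psi> x) x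
        = (deriv ^^ Suc n) \<phi> x - c * (deriv ^^ Suc n) \<psi> x" for x
      using test_functions_smooth[OF assms(1), of n x] test_functions_smooth[OF assms(2), of n x]
      by (simp add: deriv_diff deriv_cmult field_differentiable_mult field_differentiable_const)
    then show ?case using Suc by auto
  qed auto
  show ?thesis
  proof (rule test_functionsI[of _ "K \<union> L"])
    fix n x
    show "((deriv ^^ n) (\<lambda>x. \<phi> x - c * \<psi> x)) field_differentiable (at x)"
      unfolding * using test_functions_smooth[OF assms(1), of n x] test_functions_smooth[OF assms(2), of n x]
      by (intro field_differentiable_diff field_differentiable_mult field_differentiable_const)
  qed (use K L in auto)
qed

text \<open>
  On an interval the compact support has a convex hull inside the interval; openness leaves room to
  enlarge it, so that the function vanishes at both ends.
\<close>

lemma test_functions_Icc_support: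
  assumes "\<phi> \<in> test_functions J" "open J" "is_interval J" "J \<noteq> {}"
  obtains a b where "a < b" "{a..b} \<subseteq> J" "\<And>x. x \<le> a \<or> b \<le> x \<Longrightarrow> \<phi> x = 0"
    "\<And>x. x \<le> a \<or> b \<le> x \<Longrightarrow> deriv \<phi> x = 0"
proof -
  obtain K where K: "compact K" "K \<subseteq> J" "\<And>x. x \<notin> K \<Longrightarrow> \<phi> x = 0" "\<And>x. x \<notin> K \<Longrightarrow> deriv \<phi> x = 0"
    using test_functionsE[OF assms(1)] by blast
  obtain c where "c \<in> J" using assms by blast
  define L where "L = insert c K"
  have L: "compact L" "L \<noteq> {}" "L \<subseteq> J" using K \<open>c \<in> J\<close> by (auto simp: L_def)
  \<comment> \<open>The set \<open>L\<close> is nonempty even if the support is empty.\<close>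
  obtain p where p: "p \<in> L" "\<And>x. x \<in> L \<Longrightarrow> p \<le> x" using compact_attains_inf[OF L(1,2)] by blast
  obtain q where q: "q \<in> L" "\<And>x. x \<in> L \<Longrightarrow> x \<le> q" using compact_attains_sup[OF L(1,2)] by blast
  obtain d where d: "d > 0" "cball p d \<subseteq> J" using assms(2) p L by (meson open_contains_cball subsetD)
  obtain e where e: "e > 0" "cball q e \<subseteq> J" using assms(2) q L by (meson open_contains_cball subsetD)
  have "p \<le> q" using p q by blast
  have in_J: "p - d \<in> J" "q + e \<in> J" using d e by (auto simp: dist_real_def)
  show ?thesis
  proof (rule that[of "p - d" "q + e"])
    show "{p - d..q + e} \<subseteq> J" by (rule is_interval_Icc_subset[OF assms(3) in_J])
    show "\<phi> x = 0" "deriv \<phi> x = 0" if "x \<le> p - d \<or> q + e \<le> x" for x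
    proof -
      have "x \<notin> L" using that p(2)[of x] q(2)[of x] d(1) e(1) by linarith
      then have "x \<notin> K" by (simp add: L_def)
      then show "\<phi> x = 0" "deriv \<phi> x = 0" using K(3,4) by blast+
    qed
  qed (use d e \<open>p \<le> q\<close> in auto)
qed

text \<open>
  On an interval, the derivatives of test functions are exactly the test functions of mean zero.
  The integral starts at \<open>a - 1\<close> so that every point is interior either to the range of integration or
  to the region below \<open>a\<close>, where the primitive vanishes.
\<close>

lemma test_functions_primitive:
  assumes "\<psi> \<in> test_functions J" "a < b" "{a..b} \<subseteq> J" "\<And>x. x \<le> a \<or> b \<le> x \<Longrightarrow> \<psi> x = 0"
    "integral {a..b} \<psi> = 0"
  obtains \<phi> where "\<phi> \<in> test_functions J" "deriv \<phi> = \<psi>" "\<And>x. x \<le> a \<or> b \<le> x \<Longrightarrow> \<phi> x = 0"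
proof -
  note cont = test_functions_continuous(1)[OF assms(1)]
  define \<phi> where "\<phi> x = integral {a - 1..x} \<psi>" for x
  have zero: "integral S \<psi> = 0" if "\<And>x. x \<in> S \<Longrightarrow> \<psi> x = 0" for S
    using has_integral_is_0[of S \<psi>] that by (simp add: integral_unique)
  have low: "\<phi> x = 0" if "x \<le> a" for x
    unfolding \<phi>_def by (rule zero) (use assms(4) that in auto)
  have high: "\<phi> x = 0" if "b \<le> x" for x
  proof -
    have "\<phi> x = integral {a - 1..a} \<psi> + integral {a..x} \<psi>"
      unfolding \<phi>_def using that assms(2)
      by (intro Henstock_Kurzweil_Integration.integral_combine[symmetric] integrable_continuous_real cont) auto
    also have "integral {a..x} \<psi> = integral {a..b} \<psi> + integral {b..x} \<psi>"
      using that assms(2)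
      by (intro Henstock_Kurzweil_Integration.integral_combine[symmetric] integrable_continuous_real cont) auto
    also have "integral {b..x} \<psi> = 0" by (rule zero) (use assms(4) in auto)
    also have "integral {a - 1..a} \<psi> = 0" by (rule zero) (use assms(4) in auto)
    finally show ?thesis using assms(5) by simp
  qed
  have D: "(\<phi> has_real_derivative \<psi> x) (at x)" for x
  proof (cases "x < a")
    case True
    have "(\<phi> has_real_derivative 0) (at x)"
      by (rule has_field_derivative_transform_within_open[of "\<lambda>_. 0" _ _ "{..<a}"]) (use True low in auto)
    then show ?thesis using assms(4) True by simp
  next
    case False
    have "(\<phi> has_real_derivative \<psi> x) (at x within {a - 1..x + 1})"
      unfolding \<phi>_def by (rule integral_has_real_derivative) (use cont False in auto)
    moreover have "at x within {a - 1..x + 1} = at x"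
      by (rule at_within_Icc_at) (use False in auto)
    ultimately show ?thesis by simp
  qed
  have d: "deriv \<phi> = \<psi>" using D by (auto intro: DERIV_imp_deriv)
  have "\<phi> \<in> test_functions J"
  proof (rule test_functionsI[of _ "{a..b}"])
    show "((deriv ^^ n) \<phi>) field_differentiable (at x)" for n x
    proof (cases n)
      case 0
      then show ?thesis using D by (auto simp: field_differentiable_def)
    next
      case (Suc k)
      then have "(deriv ^^ n) \<phi> = (deriv ^^ k) \<psi>" by (simp only: funpow_Suc_right o_apply d)
      then show ?thesis using test_functions_smooth[OF assms(1)] by simp
    qed
  qed (use assms low high in auto)
  then show ?thesis using that d low high by blast
qed

section \<open>The fundamental lemma and the du Bois-Reymond lemma\<close>

text \<open>
  Bridge between the Lebesgue integrals in the definition of weak derivatives and gauge integrals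
  over the support of a test function.
\<close>

lemma LINT_lebesgue_on_supported:
  fixes f :: "real \<Rightarrow> complex"
  assumes "f absolutely_integrable_on T" "\<And>x. x \<notin> T \<Longrightarrow> f x = 0"
    and "\<Omega> \<in> sets lebesgue" "\<And>x. x \<notin> \<Omega> \<Longrightarrow> f x = 0"
  shows "(LINT x|lebesgue_on \<Omega>. f x) = integral T f" "integrable (lebesgue_on \<Omega>) f"
proof -
  have 1: "(\<lambda>x. indicator \<Omega> x *\<^sub>R f x) = f" "(\<lambda>x. indicator T x *\<^sub>R f x) = f"
    using assms(2,4) by (auto simp: indicator_def fun_eq_iff)
  have "(LINT x|lebesgue_on \<Omega>. f x) = (LINT x|lebesgue. f x)"
    using assms(3) 1 by (simp add: integral_restrict_space)
  also have "\<dots> = integral T f"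
    using set_lebesgue_integral_eq_integral(2)[OF assms(1)] 1 by (simp add: set_lebesgue_integral_def)
  finally show "(LINT x|lebesgue_on \<Omega>. f x) = integral T f" .
  show "integrable (lebesgue_on \<Omega>) f"
    using assms(1,3) 1 by (simp add: integrable_restrict_space set_integrable_def)
qed

text \<open>
  The intervals form an intersection-stable generator of the Borel sets, so vanishing of the integral
  spreads to all Borel sets by Dynkin's lemma, and a function with this property vanishes almost everywhere.
\<close>

lemma AE_zero_if_box_integrals_zero:
  fixes r :: "real \<Rightarrow> real"
  assumes r: "integrable lborel r"
    and supp: "AE x in lborel. x \<notin> {a..b} \<longrightarrow> r x = 0"
    and box: "\<And>s t. (LINT x:{s<..<t}|lborel. r x) = 0"
  shows "AE x in lborel. r x = 0"
proof -
  have "(LINT x:A|lborel. r x) = 0" if "A \<in> sets lborel" for A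
  proof -
    have all: "(LINT x|lborel. r x) = 0"
    proof -
      have "(LINT x|lborel. r x) = (LINT x:{a-1<..<b+1}|lborel. r x)"
        unfolding set_lebesgue_integral_def using r supp
        by (intro integral_cong_AE) (auto simp: indicator_def intro: AE_mp)
      then show ?thesis using box by simp
    qed
    have si: "set_integrable lborel B r" if "B \<in> sets lborel" for B
      using r that unfolding set_integrable_def by (intro integrable_mult_indicator) auto
    have "Int_stable (range (\<lambda>(a, b). box a b :: real set))"
      by (auto simp: Int_stable_def box_Int_box)
    moreover have "range (\<lambda>(a, b). box a b :: real set) \<subseteq> Pow UNIV" by auto
    moreover have "A \<in> sigma_sets UNIV (range (\<lambda>(a, b). box a b))"
      using that unfolding borel_eq_box sets_lborel by (simp del: box_real)
    ultimately show ?thesis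
    proof (induction rule: sigma_sets_induct_disjoint)
      case (basic A)
      then show ?case using box by (auto simp: box_real)
    next
      case empty
      then show ?case by (simp add: set_lebesgue_integral_def)
    next
      case (compl A)
      then have A: "A \<in> sets lborel" by (simp add: borel_eq_box)
      have "(LINT x:UNIV|lborel. r x) = (LINT x:A|lborel. r x) + (LINT x:UNIV - A|lborel. r x)"
        using set_integral_Un[OF _ si[OF A] si[of "UNIV - A"]] A by auto
      then show ?case using compl all by (simp add: set_lebesgue_integral_def)
    next
      case (union F)
      have F: "F i \<in> sets lborel" for i using union by (simp add: borel_eq_box range_subsetD)
      have "(LINT x:(\<Union>i. F i)|lborel. r x) = (\<Sum>i. (LINT x:F i|lborel. r x))"
        by (rule lebesgue_integral_countable_add)
          (use F si union in \<open>auto simp: disjoint_family_on_def\<close>)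
      then show ?case using union by simp
    qed
  qed
  then show ?thesis
    using density_unique_real[OF r, of "\<lambda>_. 0"] by (simp add: set_lebesgue_integral_def)
qed

text \<open>
  The function is only Lebesgue measurable, while intervals generate the Borel sets; the argument is
  carried out for an almost everywhere equal Borel function.
\<close>

lemma AE_zero_if_Icc_integrals_zero_real:
  fixes r :: "real \<Rightarrow> real"
  assumes r: "r absolutely_integrable_on {a..b}"
    and zero: "\<And>s t. a \<le> s \<Longrightarrow> s < t \<Longrightarrow> t \<le> b \<Longrightarrow> integral {s..t} r = 0"
  shows "AE x in lebesgue. x \<in> {a..b} \<longrightarrow> r x = 0"
proof -
  let ?q = "\<lambda>x. indicator {a..b} x *\<^sub>R r x"
  have q: "integrable lebesgue ?q" using r by (simp add: set_integrable_def)
  obtain q' where q': "q' \<in> borel_measurable lborel" and eq: "AE x in lborel. ?q x = q' x"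
    using completion_ex_borel_measurable_real[OF borel_measurable_integrable[OF q]] by blast
  have meas: "q' \<in> borel_measurable lebesgue" using q' by (rule measurable_completion)
  have eqL: "AE x in lebesgue. ?q x = q' x" using eq by (rule AE_completion)
  have iL: "integrable lebesgue q'"
    using integrable_cong_AE[OF _ meas eqL] q by auto
  have i: "integrable lborel q'" using iL q' by (simp add: integrable_completion)
  have "AE x in lborel. q' x = 0"
  proof (rule AE_zero_if_box_integrals_zero[OF i, of a b])
    show "AE x in lborel. x \<notin> {a..b} \<longrightarrow> q' x = 0"
      using eq by eventually_elim (auto simp: indicator_def)
    fix s t
    have "(LINT x:{s<..<t}|lborel. q' x) = (LINT x:{s<..<t}|lebesgue. q' x)"
      unfolding set_lebesgue_integral_def using q' by (intro integral_completion[symmetric]) auto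
    also have "\<dots> = (LINT x:{s<..<t} \<inter> {a..b}|lebesgue. r x)"
      unfolding set_lebesgue_integral_def
    proof (rule integral_cong_AE)
      show "(\<lambda>x. indicat_real {s<..<t} x *\<^sub>R q' x) \<in> borel_measurable lebesgue"
        using meas by (intro borel_measurable_scaleR borel_measurable_indicator) auto
      have "(\<lambda>x. indicat_real {s<..<t} x *\<^sub>R ?q x) \<in> borel_measurable lebesgue"
        by (intro borel_measurable_scaleR borel_measurable_indicator borel_measurable_integrable[OF q]) auto
      moreover have "(\<lambda>x. indicat_real {s<..<t} x *\<^sub>R ?q x) = (\<lambda>x. indicat_real ({s<..<t} \<inter> {a..b}) x *\<^sub>R r x)"
        by (auto simp: indicator_def fun_eq_iff)
      ultimately show "(\<lambda>x. indicat_real ({s<..<t} \<inter> {a..b}) x *\<^sub>R r x) \<in> borel_measurable lebesgue" by simp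
      show "AE x in lebesgue. indicat_real {s<..<t} x *\<^sub>R q' x = indicat_real ({s<..<t} \<inter> {a..b}) x *\<^sub>R r x"
        using eqL by eventually_elim (auto simp: indicator_def split: if_splits)
    qed
    also have "\<dots> = integral ({s<..<t} \<inter> {a..b}) r"
      by (rule set_lebesgue_integral_eq_integral(2), rule set_integrable_subset[OF r]) auto
    also have "\<dots> = integral {max s a..min t b} r"
    proof (rule integral_subset_negligible)
      have "{max s a..min t b} - {s<..<t} \<inter> {a..b} \<subseteq> {s,t}" by auto
      then show "negligible ({max s a..min t b} - {s<..<t} \<inter> {a..b})"
        by (rule negligible_subset[rotated]) auto
    qed auto
    also have "\<dots> = 0"
    proof (cases "max s a < min t b")
      case False
      then have "{max s a..min t b} \<subseteq> {max s a}" by auto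
      then show ?thesis
        by (intro integral_unique has_integral_negligible[of "{max s a}"]) auto
    qed (use zero[of "max s a" "min t b"] in auto)
    finally show "(LINT x:{s<..<t}|lborel. q' x) = 0" .
  qed
  then have "AE x in lborel. ?q x = 0" using eq by eventually_elim simp
  then have "AE x in lebesgue. ?q x = 0" by (rule AE_completion)
  then show ?thesis by eventually_elim (auto simp: indicator_def split: if_splits)
qed

lemma AE_zero_if_Icc_integrals_zero:
  fixes r :: "real \<Rightarrow> complex"
  assumes r: "r absolutely_integrable_on {a..b}"
    and zero: "\<And>s t. a \<le> s \<Longrightarrow> s < t \<Longrightarrow> t \<le> b \<Longrightarrow> integral {s..t} r = 0"
  shows "AE x in lebesgue. x \<in> {a..b} \<longrightarrow> r x = 0"
proof -
  have *: "AE x in lebesgue. x \<in> {a..b} \<longrightarrow> h (r x) = 0" if h: "bounded_linear h" for h :: "complex \<Rightarrow> real"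
  proof (rule AE_zero_if_Icc_integrals_zero_real)
    show "(\<lambda>x. h (r x)) absolutely_integrable_on {a..b}"
      using absolutely_integrable_linear[OF r h] by (simp add: o_def)
    fix s t assume st: "a \<le> s" "s < t" "t \<le> b"
    have "r absolutely_integrable_on {s..t}"
      by (rule absolutely_integrable_on_subinterval[OF r]) (use st in auto)
    then have "integral {s..t} (h \<circ> r) = h (integral {s..t} r)"
      by (intro integral_linear h set_lebesgue_integral_eq_integral(1))
    then show "integral {s..t} (\<lambda>x. h (r x)) = 0"
      using zero[OF st] bounded_linear.linear[OF h] by (simp add: o_def linear_0)
  qed
  show ?thesis using *[OF bounded_linear_Re] *[OF bounded_linear_Im]
    by eventually_elim (auto simp: complex_eq_iff)
qed

lemma AE_zero_on_open_if_Icc_integrals_zero: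
  fixes r :: "real \<Rightarrow> complex"
  assumes "open \<Omega>" and "\<And>a b. a < b \<Longrightarrow> {a..b} \<subseteq> \<Omega> \<Longrightarrow> r absolutely_integrable_on {a..b}"
    and "\<And>a b. a < b \<Longrightarrow> {a..b} \<subseteq> \<Omega> \<Longrightarrow> integral {a..b} r = 0"
  shows "AE x in lebesgue. x \<in> \<Omega> \<longrightarrow> r x = 0"
proof -
  let ?I = "{(p, q). p \<in> \<rat> \<and> q \<in> \<rat> \<and> p < q \<and> {p..q} \<subseteq> \<Omega>} :: (real \<times> real) set"
  have "countable (\<rat> \<times> \<rat> :: (real \<times> real) set)" by (intro countable_SIGMA countable_rat)
  then have "countable ?I" by (rule countable_subset[rotated]) auto
  moreover have "AE x in lebesgue. x \<in> {fst i..snd i} \<longrightarrow> r x = 0" if "i \<in> ?I" for i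
    by (rule AE_zero_if_Icc_integrals_zero) (use that in \<open>auto intro!: assms(2,3)\<close>)
  ultimately have "AE x in lebesgue. \<forall>i\<in>?I. x \<in> {fst i..snd i} \<longrightarrow> r x = 0"
    by (subst AE_ball_countable) auto
  then show ?thesis
  proof eventually_elim
    case (elim x)
    show ?case
    proof
      assume "x \<in> \<Omega>"
      then obtain e where e: "e > 0" "ball x e \<subseteq> \<Omega>" using assms(1) by (meson open_contains_ball)
      obtain p where p: "p \<in> \<rat>" "x - e < p" "p < x" using Rats_dense_in_real[of "x - e" x] e by auto
      obtain q where q: "q \<in> \<rat>" "x < q" "q < x + e" using Rats_dense_in_real[of x "x + e"] e by auto
      have "{p..q} \<subseteq> ball x e" using p q by (auto simp: dist_real_def)
      then have "(p, q) \<in> ?I" using p q e by auto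
      from elim[rule_format, OF this] show "r x = 0" using p q by simp
    qed
  qed
qed

text \<open>
  Testing against bumps that increase to the indicator function of \<open>(a, b)\<close> shows, by dominated convergence,
  that \<open>r\<close> has integral zero over every compact subinterval.
\<close>

lemma fundamental_lemma_of_variations:
  fixes r :: "real \<Rightarrow> complex"
  assumes "open \<Omega>" and r: "\<And>a b. a < b \<Longrightarrow> {a..b} \<subseteq> \<Omega> \<Longrightarrow> r absolutely_integrable_on {a..b}"
    and orth: "\<And>\<psi>. \<psi> \<in> test_functions \<Omega> \<Longrightarrow> (LINT x|lebesgue_on \<Omega>. r x * complex_of_real (\<psi> x)) = 0"
  shows "AE x in lebesgue. x \<in> \<Omega> \<longrightarrow> r x = 0"
proof (rule AE_zero_on_open_if_Icc_integrals_zero[OF assms(1) r])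
  fix a b :: real assume ab: "a < b" "{a..b} \<subseteq> \<Omega>"
  define e where "e n = 1 / real (Suc n)" for n
  have e: "e n > 0" for n by (simp add: e_def)
  define f where "f n x = r x * complex_of_real (bump a b (e n) 0 1 x)" for n x
  have bnd: "0 \<le> bump a b (e n) 0 1 x" "bump a b (e n) 0 1 x \<le> 1" for n x
    using e[of n] by (auto simp: bump_def intro!: divide_nonneg_pos)
  have meas: "continuous_on {a..b} (\<lambda>x. complex_of_real (bump a b (e n) 0 1 x))" for n
    by (rule continuous_on_of_real, rule test_functions_continuous(1)[OF bump_test_function[OF ab(1) e ab(2)]])
  have fi: "f n absolutely_integrable_on {a..b}" for n
    unfolding f_def by (rule absolutely_integrable_continuous_mult(2)[OF meas r[OF ab]])
  have f0: "integral {a..b} (f n) = 0" for n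
  proof -
    have "(LINT x|lebesgue_on \<Omega>. f n x) = integral {a..b} (f n)"
      by (rule LINT_lebesgue_on_supported(1)[OF fi])
        (use ab(2) assms(1) in \<open>auto simp: f_def bump_def subset_iff\<close>)
    then show ?thesis using orth[OF bump_test_function[OF ab(1) e ab(2)]] by (simp add: f_def)
  qed
  have "(\<lambda>n. integral {a..b} (f n)) \<longlonglongrightarrow> integral {a..b} (\<lambda>x. if x \<in> {a<..<b} then r x else 0)"
  proof (rule dominated_convergence(2)[where h="\<lambda>x. norm (r x)"])
    show "f n integrable_on {a..b}" for n using fi set_lebesgue_integral_eq_integral(1) by blast
    show "(\<lambda>x. norm (r x)) integrable_on {a..b}"
      using absolutely_integrable_norm[OF r[OF ab]] set_lebesgue_integral_eq_integral(1)
      by (auto simp: o_def)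
    show "norm (f n x) \<le> norm (r x)" if "x \<in> {a..b}" for n x
      using bnd[where n=n and x=x] by (simp add: f_def norm_mult mult_left_le)
    show "(\<lambda>n. f n x) \<longlonglongrightarrow> (if x \<in> {a<..<b} then r x else 0)" if "x \<in> {a..b}" for x
    proof (cases "x \<in> {a<..<b}")
      case True
      have "e \<longlonglongrightarrow> 0" unfolding e_def using LIMSEQ_inverse_real_of_nat by (simp add: inverse_eq_divide)
      then have "(\<lambda>n. r x * complex_of_real (exp (- e n / ((x - a) * (b - x))))) \<longlonglongrightarrow>
          r x * complex_of_real (exp (- 0 / ((x - a) * (b - x))))"
        using True by (intro tendsto_intros) auto
      then show ?thesis using True by (simp add: f_def bump_def)
    next
      case False
      then have "f n x = 0" for n by (auto simp: f_def bump_def)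
      then show ?thesis using False by auto
    qed
  qed
  then have "integral {a..b} (\<lambda>x. if x \<in> {a<..<b} then r x else 0) = 0"
    using f0 by (simp add: LIMSEQ_const_iff)
  moreover have "integral {a..b} (\<lambda>x. if x \<in> {a<..<b} then r x else 0) = integral {a..b} r"
    by (rule integral_spike[of "{a,b}"]) auto
  ultimately show "integral {a..b} r = 0" by simp
qed

lemma primitive_on_of_real_test:
  assumes "\<phi> \<in> test_functions \<Omega>" "is_interval I"
  shows "primitive_on I (\<lambda>x. complex_of_real (\<phi> x)) (\<lambda>x. complex_of_real (deriv \<phi> x))"
proof (rule primitive_on_has_vector_derivative)
  show "((\<lambda>x. complex_of_real (\<phi> x)) has_vector_derivative complex_of_real (deriv \<phi> x)) (at x)" for x
    using test_functions_DERIV[OF assms(1), of x]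
    by (auto intro: has_vector_derivative_of_real simp: has_real_derivative_iff_has_vector_derivative)
qed (use assms test_functions_continuous[OF assms(1)] in \<open>auto intro!: continuous_intros\<close>)

lemma integral_by_parts_test:
  assumes v: "primitive_on {a..b} v g" and ab: "a \<le> b" and \<phi>: "\<phi> \<in> test_functions \<Omega>"
  shows "integral {a..b} (\<lambda>x. v x * complex_of_real (deriv \<phi> x)) =
    v b * \<phi> b - v a * \<phi> a - integral {a..b} (\<lambda>x. g x * complex_of_real (\<phi> x))"
proof -
  note p = primitive_on_of_real_test[OF \<phi>, of "{a..b}"]
  have c: "continuous_on {a..b} (\<lambda>x. complex_of_real (\<phi> x))" "continuous_on {a..b} (\<lambda>x. complex_of_real (deriv \<phi> x))"
    by (intro continuous_intros test_functions_continuous[OF \<phi>])+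
  have g: "g absolutely_integrable_on {a..b}" using primitive_onD(1)[OF v] ab by auto
  have "integral {a..b} (\<lambda>x. g x * complex_of_real (\<phi> x) + v x * complex_of_real (deriv \<phi> x)) =
      v b * \<phi> b - v a * \<phi> a"
    using primitive_on_Icc_mult[OF ab v p] by simp
  moreover have "(\<lambda>x. g x * complex_of_real (\<phi> x)) integrable_on {a..b}"
    by (intro set_lebesgue_integral_eq_integral(1) absolutely_integrable_continuous_mult c g)
  moreover have "(\<lambda>x. v x * complex_of_real (deriv \<phi> x)) integrable_on {a..b}"
    by (intro integrable_continuous_real continuous_intros c primitive_on_Icc_continuous[OF v])
  ultimately show ?thesis by (simp add: integral_add algebra_simps)
qed

lemma locally_integrable_Icc:
  "locally_integrable \<Omega> u \<Longrightarrow> {a..b} \<subseteq> \<Omega> \<Longrightarrow> u absolutely_integrable_on {a..b}"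
  unfolding locally_integrable_def by auto

lemma test_functions_outside:
  assumes "\<phi> \<in> test_functions \<Omega>" "x \<notin> \<Omega>"
  shows "\<phi> x = 0" "deriv \<phi> x = 0"
  using test_functionsE[OF assms(1)] assms(2) by (metis subsetD)+

text \<open>
  By parts, \<open>r = u - \<Gamma>\<close> is orthogonal to all derivatives of test functions, that is, to all test functions of mean
  zero. Every test function \<open>\<psi>\<close> becomes one of mean zero after subtracting a multiple of a fixed bump
  \<open>\<psi>0\<close>, so \<open>r\<close> minus a constant is orthogonal to everything.
\<close>

lemma du_Bois_Reymond:
  assumes J: "open J" "is_interval J" "J \<noteq> {}"
    and \<Gamma>: "primitive_on J \<Gamma> g" and w: "has_weak_deriv J u g"
  obtains \<kappa> where "AE x in lebesgue. x \<in> J \<longrightarrow> u x = \<Gamma> x + \<kappa>"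
proof -
  have Jm: "J \<in> sets lebesgue" using J(1) by auto
  have u: "u absolutely_integrable_on {a..b}" and g: "g absolutely_integrable_on {a..b}"
    if "{a..b} \<subseteq> J" for a b using w that locally_integrable_Icc by (auto simp: has_weak_deriv_def)
  have \<Gamma>c: "continuous_on {a..b} \<Gamma>" if "{a..b} \<subseteq> J" for a b
    by (rule primitive_on_Icc_continuous, rule primitive_on_subset[OF \<Gamma> that])
  have cr: "(\<lambda>x. h x * complex_of_real (\<psi> x)) absolutely_integrable_on {a..b}"
    if "h absolutely_integrable_on {a..b}" "continuous_on {a..b} \<psi>" for a b :: real and h \<psi>
    by (rule absolutely_integrable_continuous_mult(2)[OF continuous_on_of_real[OF that(2)] that(1)])
  define r where "r x = u x - \<Gamma> x" for x
  have r: "r absolutely_integrable_on {a..b}" if "{a..b} \<subseteq> J" for a b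
    unfolding r_def by (intro set_integral_diff u absolutely_integrable_continuous_real \<Gamma>c that)
  have orth: "(LINT x|lebesgue_on J. r x * complex_of_real (deriv \<phi> x)) = 0" if \<phi>: "\<phi> \<in> test_functions J" for \<phi>
  proof -
    obtain a b where ab: "a < b" "{a..b} \<subseteq> J" "\<And>x. x \<le> a \<or> b \<le> x \<Longrightarrow> \<phi> x = 0"
        "\<And>x. x \<le> a \<or> b \<le> x \<Longrightarrow> deriv \<phi> x = 0"
      using test_functions_Icc_support[OF \<phi> J] by metis
    note c = test_functions_continuous[OF \<phi>]
    have L: "(LINT x|lebesgue_on J. h x * complex_of_real (\<psi> x)) = integral {a..b} (\<lambda>x. h x * complex_of_real (\<psi> x))"
      if "h absolutely_integrable_on {a..b}" "\<psi> = \<phi> \<or> \<psi> = deriv \<phi>" for h \<psi>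
      by (rule LINT_lebesgue_on_supported(1)[OF cr _ Jm])
        (use ab c that test_functions_outside[OF \<phi>] in auto)
    have "integral {a..b} (\<lambda>x. \<Gamma> x * complex_of_real (deriv \<phi> x)) = - integral {a..b} (\<lambda>x. g x * complex_of_real (\<phi> x))"
      using integral_by_parts_test[OF primitive_on_subset[OF \<Gamma> ab(2)] _ \<phi>] ab by simp
    moreover have "integral {a..b} (\<lambda>x. u x * complex_of_real (deriv \<phi> x)) = - integral {a..b} (\<lambda>x. g x * complex_of_real (\<phi> x))"
      using w \<phi> L[OF u[OF ab(2)]] L[OF g[OF ab(2)]] by (auto simp: has_weak_deriv_def)
    moreover have "integral {a..b} (\<lambda>x. r x * complex_of_real (deriv \<phi> x)) =
        integral {a..b} (\<lambda>x. u x * complex_of_real (deriv \<phi> x)) - integral {a..b} (\<lambda>x. \<Gamma> x * complex_of_real (deriv \<phi> x))"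
      unfolding r_def left_diff_distrib
      by (intro integral_diff set_lebesgue_integral_eq_integral(1) cr u absolutely_integrable_continuous_real \<Gamma>c ab c)
    ultimately show ?thesis using L[OF r[OF ab(2)]] by simp
  qed
  obtain c where "c \<in> J" using J by blast
  then obtain d where d: "d > 0" "cball c d \<subseteq> J" using J(1) by (meson open_contains_cball)
  have pq: "c < c + d" "{c..c + d} \<subseteq> J"
    using d by (auto simp: dist_real_def subset_iff)
  define \<psi>0 where "\<psi>0 = bump c (c + d) 1 0 1"
  have \<psi>0: "\<psi>0 \<in> test_functions J" unfolding \<psi>0_def by (rule bump_test_function) (use pq in auto)
  define m0 where "m0 = integral {c..c + d} \<psi>0"
  have pos: "m0 > 0"
  proof -
    have nn: "\<psi>0 x \<ge> 0" for x by (auto simp: \<psi>0_def bump_def)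
    have c0: "continuous_on {c..c+d} \<psi>0" by (rule test_functions_continuous[OF \<psi>0])
    have "m0 \<ge> 0" unfolding m0_def using nn by (intro integral_nonneg integrable_continuous_real c0) auto
    moreover have "m0 \<noteq> 0"
    proof
      assume "m0 = 0"
      then have "\<psi>0 (c + d/2) = 0"
        using integral_eq_0_iff[OF c0 pq(1)] nn d unfolding m0_def by auto
      then show False using d by (simp add: \<psi>0_def bump_def)
    qed
    ultimately show ?thesis by simp
  qed
  define \<kappa> where "\<kappa> = (LINT x|lebesgue_on J. r x * complex_of_real (\<psi>0 x)) / m0"
  have "AE x in lebesgue. x \<in> J \<longrightarrow> r x - \<kappa> = 0"
  proof (rule fundamental_lemma_of_variations[OF J(1)])
    show "(\<lambda>x. r x - \<kappa>) absolutely_integrable_on {a..b}" if "{a..b} \<subseteq> J" for a b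
      by (intro set_integral_diff r that absolutely_integrable_continuous_real continuous_intros)
    fix \<psi> assume \<psi>: "\<psi> \<in> test_functions J"
    define L where "L h \<phi> = (LINT x|lebesgue_on J. h x * complex_of_real (\<phi> x))" for h :: "real \<Rightarrow> complex" and \<phi>
    obtain a1 b1 where ab1: "a1 < b1" "{a1..b1} \<subseteq> J" "\<And>x. x \<le> a1 \<or> b1 \<le> x \<Longrightarrow> \<psi> x = 0"
      using test_functions_Icc_support[OF \<psi> J] by metis
    define a b where "a = min a1 c" and "b = max b1 (c + d)"
    have abJ: "a \<in> J" "b \<in> J" using ab1 pq by (auto simp: a_def b_def min_def max_def)
    have ab: "a < b" "{a..b} \<subseteq> J" "\<And>x. x \<le> a \<or> b \<le> x \<Longrightarrow> \<psi> x = 0" "\<And>x. x \<le> a \<or> b \<le> x \<Longrightarrow> \<psi>0 x = 0"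
      using ab1 pq is_interval_Icc_subset[OF J(2) abJ] by (auto simp: a_def b_def \<psi>0_def bump_def)
    have L: "L h \<phi> = integral {a..b} (\<lambda>x. h x * complex_of_real (\<phi> x))"
      if "h absolutely_integrable_on {a..b}" "\<phi> \<in> test_functions J" "\<And>x. x \<le> a \<or> b \<le> x \<Longrightarrow> \<phi> x = 0" for h \<phi>
      unfolding L_def
      by (rule LINT_lebesgue_on_supported(1)[OF cr _ Jm])
        (use that test_functions_continuous[OF that(2)] test_functions_outside[OF that(2)] in auto)
    have ii: "(\<lambda>x. h x * complex_of_real (\<phi> x)) integrable_on {a..b}"
      if "h absolutely_integrable_on {a..b}" "\<phi> \<in> test_functions J" for h \<phi>
      by (rule set_lebesgue_integral_eq_integral(1)[OF cr[OF that(1) test_functions_continuous(1)[OF that(2)]]])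
    \<comment> \<open>This multiple of \<open>\<psi>0\<close> has the same mean as \<open>\<psi>\<close>.\<close>
    define s where "s = integral {a..b} \<psi> / m0"
    define \<eta> where "\<eta> x = \<psi> x - s * \<psi>0 x" for x
    have \<eta>: "\<eta> \<in> test_functions J" unfolding \<eta>_def by (rule test_functions_diff_cmult[OF \<psi> \<psi>0])
    have m0': "integral {a..b} \<psi>0 = m0" 
    proof -
      have "(\<lambda>x. if x \<in> {a..b} then \<psi>0 x else 0) = (\<lambda>x. if x \<in> {c..c + d} then \<psi>0 x else 0)"
        using ab(4) by (auto simp: fun_eq_iff a_def b_def \<psi>0_def bump_def)
      then show ?thesis unfolding m0_def by (metis integral_restrict_UNIV)
    qed
    have i\<psi>: "\<psi> integrable_on {a..b}" "\<psi>0 integrable_on {a..b}"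
      using test_functions_continuous(1)[OF \<psi>] test_functions_continuous(1)[OF \<psi>0]
      by (auto intro: integrable_continuous_real)
    have "integral {a..b} \<eta> = 0"
    proof -
      have "integral {a..b} \<eta> = integral {a..b} \<psi> - integral {a..b} (\<lambda>x. s * \<psi>0 x)"
        unfolding \<eta>_def by (intro integral_diff i\<psi> integrable_on_cmult_left[where c=s, simplified] integrable_on_mult_right)
      then show ?thesis using pos by (simp add: m0' s_def)
    qed
    then obtain \<phi> where \<phi>: "\<phi> \<in> test_functions J" "deriv \<phi> = \<eta>"
      using test_functions_primitive[OF \<eta> ab(1,2)] ab(3,4) by (auto simp: \<eta>_def)
    have "L r \<eta> = 0" using orth[OF \<phi>(1)] \<phi>(2) by (simp add: L_def)
    moreover have "L r \<eta> = L r \<psi> - complex_of_real s * L r \<psi>0"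
    proof -
      have "integral {a..b} (\<lambda>x. r x * complex_of_real (\<eta> x)) =
          integral {a..b} (\<lambda>x. r x * complex_of_real (\<psi> x) - complex_of_real s * (r x * complex_of_real (\<psi>0 x)))"
        by (simp add: \<eta>_def algebra_simps)
      also have "\<dots> = integral {a..b} (\<lambda>x. r x * complex_of_real (\<psi> x)) -
          integral {a..b} (\<lambda>x. complex_of_real s * (r x * complex_of_real (\<psi>0 x)))"
        by (intro integral_diff integrable_on_mult_right ii r ab \<psi> \<psi>0)
      finally show ?thesis
        using L[OF r[OF ab(2)] \<eta>] L[OF r[OF ab(2)] \<psi>] L[OF r[OF ab(2)] \<psi>0] ab(3,4)
        by (simp add: \<eta>_def)
    qed
    ultimately have 1: "L r \<psi> = s * L r \<psi>0" by simp
    have "L (\<lambda>x. r x - \<kappa>) \<psi> = L r \<psi> - \<kappa> * complex_of_real (integral {a..b} \<psi>)"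
    proof -
      have a: "(\<lambda>x. r x - \<kappa>) absolutely_integrable_on {a..b}"
        by (intro set_integral_diff r ab absolutely_integrable_continuous_real continuous_intros)
      have "integral {a..b} (\<lambda>x. (r x - \<kappa>) * complex_of_real (\<psi> x)) =
         integral {a..b} (\<lambda>x. r x * complex_of_real (\<psi> x) - \<kappa> * complex_of_real (\<psi> x))"
        by (simp add: algebra_simps)
      also have "\<dots> = integral {a..b} (\<lambda>x. r x * complex_of_real (\<psi> x)) - \<kappa> * integral {a..b} (\<lambda>x. complex_of_real (\<psi> x))"
        using ii[OF r[OF ab(2)] \<psi>] integrable_linear[OF i\<psi>(1) bounded_linear_of_real[where 'a=complex]]
        by (subst integral_diff) (auto simp: o_def intro!: integrable_on_mult_right)
      also have "integral {a..b} (\<lambda>x. complex_of_real (\<psi> x)) = complex_of_real (integral {a..b} \<psi>)"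
        using integral_linear[OF i\<psi>(1) bounded_linear_of_real] by (simp add: o_def)
      finally show ?thesis using L[OF a \<psi>] L[OF r[OF ab(2)] \<psi>] ab(3) by simp
    qed
    also have "\<dots> = 0" unfolding 1 using pos by (simp add: \<kappa>_def s_def L_def)
    finally show "(LINT x|lebesgue_on J. (r x - \<kappa>) * complex_of_real (\<psi> x)) = 0" by (simp add: L_def)
  qed
  then have "AE x in lebesgue. x \<in> J \<longrightarrow> u x = \<Gamma> x + \<kappa>"
    by eventually_elim (auto simp: r_def algebra_simps)
  then show ?thesis by (rule that)
qed

section \<open>Square integrable functions on half-lines\<close>

lemma L2_iff:
  assumes "S \<in> sets lebesgue"
  shows "f \<in> L2 S \<longleftrightarrow> (\<lambda>x. indicator S x *\<^sub>R f x) \<in> borel_measurable lebesgue \<and>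
    integrable lebesgue (\<lambda>x. indicator S x *\<^sub>R (cmod (f x))\<^sup>2)"
  using assms unfolding L2_def
  by (simp add: borel_measurable_restrict_space_iff integrable_restrict_space)

lemma L2_UNIV_iff:
  "f \<in> L2 UNIV \<longleftrightarrow> f \<in> borel_measurable lebesgue \<and> integrable lebesgue (\<lambda>x. (cmod (f x))\<^sup>2)"
  by (simp add: L2_iff)

lemma indicator_cmod_sq: "indicator S x *\<^sub>R (cmod (f x))\<^sup>2 = (cmod (indicator S x *\<^sub>R f x))\<^sup>2"
  by (auto simp: indicator_def)

lemma L2_indicator:
  assumes "S \<in> sets lebesgue"
  shows "f \<in> L2 S \<longleftrightarrow> (\<lambda>x. indicator S x *\<^sub>R f x) \<in> L2 UNIV"
  unfolding L2_iff[OF assms] L2_UNIV_iff indicator_cmod_sq ..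

lemma L2_UNIV_cong_AE:
  assumes "f \<in> L2 UNIV" "AE x in lebesgue. f x = g x"
  shows "g \<in> L2 UNIV"
proof -
  have g: "g \<in> borel_measurable lebesgue"
    using assms borel_measurable_AE unfolding L2_UNIV_iff by blast
  moreover have "integrable lebesgue (\<lambda>x. (cmod (g x))\<^sup>2) \<longleftrightarrow> integrable lebesgue (\<lambda>x. (cmod (f x))\<^sup>2)"
    using assms g unfolding L2_UNIV_iff
    by (intro integrable_cong_AE borel_measurable_power borel_measurable_norm) (auto elim: eventually_mono)
  ultimately show ?thesis using assms unfolding L2_UNIV_iff by blast
qed

lemma L2_cong_AE:
  assumes "f \<in> L2 S" "S \<in> sets lebesgue" "AE x in lebesgue. x \<in> S \<longrightarrow> f x = g x"
  shows "g \<in> L2 S"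
proof -
  have "AE x in lebesgue. indicator S x *\<^sub>R f x = indicator S x *\<^sub>R g x"
    using assms(3) by eventually_elim (auto simp: indicator_def)
  then show ?thesis
    using assms(1) unfolding L2_indicator[OF assms(2)] by (rule L2_UNIV_cong_AE[rotated])
qed

lemma L2_subset:
  assumes "f \<in> L2 S" "S \<in> sets lebesgue" "T \<in> sets lebesgue" "T \<subseteq> S"
  shows "f \<in> L2 T"
proof -
  have e: "indicator T x *\<^sub>R f x = indicator T x *\<^sub>R (indicator S x *\<^sub>R f x)"
    "indicator T x *\<^sub>R (cmod (f x))\<^sup>2 = indicator T x *\<^sub>R (indicator S x *\<^sub>R (cmod (f x))\<^sup>2)" for x
    using assms(4) by (auto simp: indicator_def)
  show ?thesis
    unfolding L2_iff[OF assms(3)] e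
  proof
    show "(\<lambda>x. indicat_real T x *\<^sub>R (indicat_real S x *\<^sub>R f x)) \<in> borel_measurable lebesgue"
      using assms(1) unfolding L2_iff[OF assms(2)]
      by (intro borel_measurable_scaleR[OF borel_measurable_indicator[OF assms(3)]]) (rule conjunct1)
    show "integrable lebesgue (\<lambda>x. indicat_real T x *\<^sub>R (indicat_real S x *\<^sub>R (cmod (f x))\<^sup>2))"
      using assms(1) unfolding L2_iff[OF assms(2)]
      by (intro integrable_mult_indicator[OF assms(3)]) (rule conjunct2)
  qed
qed

text \<open>
  Square integrability does not see the origin; only weak differentiability distinguishes the
  punctured line from the full line.
\<close>

lemma L2_minus_point: "L2 (UNIV - {0}) = L2 UNIV"
proof -
  have "AE x in lebesgue. x \<noteq> (0::real)"
    by (rule AE_completion) (rule AE_lborel_singleton)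
  then have *: "AE x in lebesgue. indicator (UNIV - {0}) x *\<^sub>R f x = f x" for f :: "real \<Rightarrow> complex"
    by eventually_elim (auto simp: indicator_def)
  have m: "UNIV - {0} \<in> sets (lebesgue :: real measure)" by auto
  have **: "AE x in lebesgue. f x = indicator (UNIV - {0}) x *\<^sub>R f x" for f :: "real \<Rightarrow> complex"
    using *[of f] by eventually_elim simp
  show ?thesis
    unfolding set_eq_iff L2_indicator[OF m] using L2_UNIV_cong_AE[OF _ *] L2_UNIV_cong_AE[OF _ **] by blast
qed

lemma cmod_add_sq_le: "(cmod (a + b))\<^sup>2 \<le> 2 * (cmod a)\<^sup>2 + 2 * (cmod b)\<^sup>2"
proof -
  have "(cmod (a + b))\<^sup>2 \<le> (cmod a + cmod b)\<^sup>2" by (intro power_mono norm_triangle_ineq) auto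
  also have "\<dots> \<le> 2 * (cmod a)\<^sup>2 + 2 * (cmod b)\<^sup>2"
    using sum_squares_bound[of "cmod a" "cmod b"] by (simp add: power2_sum)
  finally show ?thesis .
qed

lemma L2_add:
  assumes "f \<in> L2 S" "g \<in> L2 S"
  shows "(\<lambda>x. f x + g x) \<in> L2 S"
proof -
  have "integrable (lebesgue_on S) (\<lambda>x. 2 * (cmod (f x))\<^sup>2 + 2 * (cmod (g x))\<^sup>2)"
    using assms unfolding L2_def by auto
  then have "integrable (lebesgue_on S) (\<lambda>x. (cmod (f x + g x))\<^sup>2)"
    by (rule Bochner_Integration.integrable_bound) (use assms cmod_add_sq_le in \<open>auto simp: L2_def\<close>)
  then show ?thesis using assms unfolding L2_def by auto
qed

lemma L2_cmult:
  assumes "f \<in> L2 S"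
  shows "(\<lambda>x. c * f x) \<in> L2 S"
  using assms unfolding L2_def by (auto simp: norm_mult power_mult_distrib)

lemma L2_diff:
  assumes "f \<in> L2 S" "g \<in> L2 S"
  shows "(\<lambda>x. f x - g x) \<in> L2 S"
  using L2_add[OF assms(1) L2_cmult[OF assms(2), of "-1"]] by simp

lemma L2_sq_absolutely_integrable:
  assumes "f \<in> L2 S" "S \<in> sets lebesgue"
  shows "(\<lambda>x. (cmod (f x))\<^sup>2) absolutely_integrable_on S" "(\<lambda>x. (cmod (f x))\<^sup>2) integrable_on S"
proof -
  show "(\<lambda>x. (cmod (f x))\<^sup>2) absolutely_integrable_on S"
    using assms by (simp add: L2_iff set_integrable_def)
  then show "(\<lambda>x. (cmod (f x))\<^sup>2) integrable_on S"
    by (rule set_lebesgue_integral_eq_integral(1))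
qed

lemma L2I_integrable_on:
  assumes "f \<in> borel_measurable (lebesgue_on S)" "S \<in> sets lebesgue" "(\<lambda>x. (cmod (f x))\<^sup>2) integrable_on S"
  shows "f \<in> L2 S"
proof -
  have "(\<lambda>x. (cmod (f x))\<^sup>2) absolutely_integrable_on S"
    using assms by (intro nonnegative_absolutely_integrable_1) auto
  then show ?thesis using assms unfolding L2_def set_integrable_def
    by (simp add: integrable_restrict_space)
qed

text \<open>
  On bounded intervals \<open>L\<^sup>2\<close> embeds into \<open>L\<^sup>1\<close>, because \<open>\<bar>f\<bar> \<le> 1 + \<bar>f\<bar>\<^sup>2\<close>. Hence a weak derivative in \<open>L\<^sup>2\<close>
  has a primitive up to and including the origin, and one-sided traces exist.
\<close>

lemma L2_absolutely_integrable_Icc: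
  assumes "f \<in> L2 S" "S \<in> sets lebesgue" "{s..t} \<subseteq> S"
  shows "f absolutely_integrable_on {s..t}"
proof -
  have f: "f \<in> L2 {s..t}" by (rule L2_subset[OF assms(1,2)]) (use assms in auto)
  show ?thesis
  proof (rule measurable_bounded_by_integrable_imp_absolutely_integrable)
    show "f \<in> borel_measurable (lebesgue_on {s..t})" using f by (simp add: L2_def)
    show "(\<lambda>x. 1 + (cmod (f x))\<^sup>2) integrable_on {s..t}"
      by (intro integrable_add L2_sq_absolutely_integrable(2) f) auto
    fix x
    have "0 \<le> (cmod (f x) - 1)\<^sup>2" by simp
    then show "cmod (f x) \<le> 1 + (cmod (f x))\<^sup>2"
      by (simp add: power2_diff) (smt (verit) norm_ge_zero)
  qed auto
qed

lemma L2_reflect: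
  assumes f: "f \<in> L2 S" and S: "S \<in> sets lebesgue" "uminus ` S \<in> sets lebesgue"
  shows "(\<lambda>x. f (- x)) \<in> L2 (uminus ` S)"
    "integral (uminus ` S) (\<lambda>x. (cmod (f (- x)))\<^sup>2) = integral S (\<lambda>x. (cmod (f x))\<^sup>2)"
proof -
  define F where "F x = indicator S x *\<^sub>R f x" for x
  have e: "indicator (uminus ` S) x *\<^sub>R f (- x) = F (- x)" for x
  proof -
    have "x \<in> uminus ` S \<longleftrightarrow> - x \<in> S" by (metis image_iff minus_minus)
    then show ?thesis by (auto simp: indicator_def F_def)
  qed
  have F: "F \<in> L2 UNIV" using f unfolding L2_indicator[OF S(1)] F_def .
  then have i: "integrable lebesgue (\<lambda>x. (cmod (F x))\<^sup>2)" and m: "F \<in> borel_measurable lebesgue"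
    by (auto simp: L2_UNIV_iff)
  have "(\<lambda>x. F (- x)) \<in> borel_measurable lebesgue"
    using borel_measurable_affine[OF m, of "-1" 0] by simp
  moreover have "integrable lebesgue (\<lambda>x. (cmod (F (- x)))\<^sup>2)"
    using lebesgue_integrable_real_affine[OF i, of "-1" 0] by simp
  ultimately show R: "(\<lambda>x. f (- x)) \<in> L2 (uminus ` S)"
    unfolding L2_indicator[OF S(2)] e L2_UNIV_iff by simp
  have "(LINT x|lebesgue. (cmod (F x))\<^sup>2) = (LINT x|lebesgue. (cmod (F (- x)))\<^sup>2)"
    using lebesgue_integral_real_affine[of "-1" "\<lambda>x. (cmod (F x))\<^sup>2" 0] by simp
  moreover have "integral S (\<lambda>x. (cmod (f x))\<^sup>2) = (LINT x|lebesgue. (cmod (F x))\<^sup>2)"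
    using set_lebesgue_integral_eq_integral(2)[OF L2_sq_absolutely_integrable(1)[OF f S(1)]]
    by (simp only: set_lebesgue_integral_def indicator_cmod_sq F_def)
  moreover have "integral (uminus ` S) (\<lambda>x. (cmod (f (- x)))\<^sup>2) = (LINT x|lebesgue. (cmod (F (- x)))\<^sup>2)"
    using set_lebesgue_integral_eq_integral(2)[OF L2_sq_absolutely_integrable(1)[OF R S(2)]]
    unfolding set_lebesgue_integral_def
    by (subst (asm) indicator_cmod_sq[where f="\<lambda>x. f (- x)"]) (simp only: e)
  ultimately show "integral (uminus ` S) (\<lambda>x. (cmod (f (- x)))\<^sup>2) = integral S (\<lambda>x. (cmod (f x))\<^sup>2)"
    by simp
qed

text \<open>
  The origin goes to the right half, as in \<open>step_potential\<close>, so that multiplication by the potential acts on the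
  two halves separately.
\<close>

definition glue :: "(real \<Rightarrow> complex) \<Rightarrow> (real \<Rightarrow> complex) \<Rightarrow> real \<Rightarrow> complex" where
  "glue r l x = (if 0 \<le> x then r x else l x)"

lemma AE_nonzero: "AE x in lebesgue. x \<noteq> (0::real)"
  by (rule AE_completion) (rule AE_lborel_singleton)

lemma L2_glue:
  assumes r: "r \<in> L2 {0..}" and l: "l \<in> L2 {..0}"
  shows "glue r l \<in> L2 UNIV"
    "(L2_norm (glue r l))\<^sup>2 = integral {0..} (\<lambda>x. (cmod (r x))\<^sup>2) + integral {..0} (\<lambda>x. (cmod (l x))\<^sup>2)"
proof -
  have m: "{0..} \<in> sets (lebesgue::real measure)" "{..0} \<in> sets (lebesgue::real measure)" by auto
  have "(\<lambda>x. indicator {0..} x *\<^sub>R r x + indicator {..0} x *\<^sub>R l x) \<in> L2 UNIV"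
    using r l unfolding L2_indicator[OF m(1)] L2_indicator[OF m(2)] by (rule L2_add)
  moreover have "AE x in lebesgue. indicator {0..} x *\<^sub>R r x + indicator {..0} x *\<^sub>R l x = glue r l x"
    using AE_nonzero by eventually_elim (auto simp: glue_def indicator_def)
  ultimately show g: "glue r l \<in> L2 UNIV" by (rule L2_UNIV_cong_AE)
  note ri = L2_sq_absolutely_integrable(1)[OF r m(1)] and li = L2_sq_absolutely_integrable(1)[OF l m(2)]
  have "(L2_norm (glue r l))\<^sup>2 = (LINT x|lebesgue. (cmod (glue r l x))\<^sup>2)"
    by (simp add: L2_norm_def)
  also have "\<dots> = (LINT x|lebesgue. indicator {0..} x *\<^sub>R (cmod (r x))\<^sup>2 + indicator {..0} x *\<^sub>R (cmod (l x))\<^sup>2)"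
  proof (rule integral_cong_AE)
    show "AE x in lebesgue. (cmod (glue r l x))\<^sup>2 = indicator {0..} x *\<^sub>R (cmod (r x))\<^sup>2 + indicator {..0} x *\<^sub>R (cmod (l x))\<^sup>2"
      using AE_nonzero by eventually_elim (auto simp: glue_def indicator_def)
  qed (use g ri li in \<open>auto simp: L2_UNIV_iff set_integrable_def\<close>)
  also have "\<dots> = integral {0..} (\<lambda>x. (cmod (r x))\<^sup>2) + integral {..0} (\<lambda>x. (cmod (l x))\<^sup>2)"
    using ri li set_lebesgue_integral_eq_integral(2)[OF ri] set_lebesgue_integral_eq_integral(2)[OF li]
    by (simp add: set_integrable_def set_lebesgue_integral_def)
  finally show "(L2_norm (glue r l))\<^sup>2 = integral {0..} (\<lambda>x. (cmod (r x))\<^sup>2) + integral {..0} (\<lambda>x. (cmod (l x))\<^sup>2)" .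
qed

lemma L2_norm_cong_AE:
  assumes "f \<in> L2 UNIV" "AE x in lebesgue. f x = g x"
  shows "L2_norm f = L2_norm g"
proof -
  have "(LINT x|lebesgue. (cmod (f x))\<^sup>2) = (LINT x|lebesgue. (cmod (g x))\<^sup>2)"
    using assms L2_UNIV_cong_AE[OF assms] unfolding L2_UNIV_iff
    by (intro integral_cong_AE) (auto elim: eventually_mono)
  then show ?thesis by (simp add: L2_norm_def)
qed

section \<open>Weak derivatives of functions glued at the origin\<close>

lemma AE_lebesgue_negligible:
  "(AE x in lebesgue. P x) \<longleftrightarrow> (\<exists>N. negligible N \<and> (\<forall>x. x \<notin> N \<longrightarrow> P x))" for P :: "real \<Rightarrow> bool"
  using eventually_ae_filter_negligible[of P] by (auto simp: subset_iff)

lemma primitive_on_cong_AE: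
  assumes "primitive_on I v f" "is_interval I" "AE x in lebesgue. x \<in> I \<longrightarrow> f x = g x"
  shows "primitive_on I v g"
proof -
  obtain N where N: "negligible N" "\<And>x. x \<notin> N \<Longrightarrow> x \<in> I \<longrightarrow> f x = g x"
    using assms(3) unfolding AE_lebesgue_negligible by blast
  show ?thesis
    unfolding primitive_on_def
  proof (intro ballI impI conjI)
    fix s t assume st: "s \<in> I" "t \<in> I" "s \<le> t"
    have sub: "{s..t} \<subseteq> I" by (rule is_interval_Icc_subset[OF assms(2) st(1,2)])
    show "g absolutely_integrable_on {s..t}"
      by (rule absolutely_integrable_spike[OF primitive_onD(1)[OF assms(1) st] N(1)]) (use N sub in auto)
    have "integral {s..t} f = integral {s..t} g"
      by (rule integral_spike[OF N(1)]) (use N sub in auto)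
    then show "integral {s..t} g = v t - v s"
      using primitive_onD(2)[OF assms(1) st] by simp
  qed
qed

lemma primitive_on_reflect:
  assumes "primitive_on I v g"
  shows "primitive_on (uminus ` I) (\<lambda>x. v (- x)) (\<lambda>x. - g (- x))"
  unfolding primitive_on_def
proof (intro ballI impI conjI)
  fix s t assume st: "s \<in> uminus ` I" "t \<in> uminus ` I" "s \<le> t"
  then have st': "- t \<in> I" "- s \<in> I" "- t \<le> - s" by auto
  have "(\<lambda>x. g (- x)) absolutely_integrable_on {s..t}"
    using absolutely_integrable_reflect_real[where f=g and a="- t" and b="- s"] primitive_onD(1)[OF assms st'] by simp
  then show "(\<lambda>x. - g (- x)) absolutely_integrable_on {s..t}"
    using absolutely_integrable_continuous_mult(1)[of s t "\<lambda>_. -1"] by simp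
  show "integral {s..t} (\<lambda>x. - g (- x)) = v (- t) - v (- s)"
    using Henstock_Kurzweil_Integration.integral_reflect_real[where f=g and a="- t" and b="- s"] primitive_onD(2)[OF assms st'] by simp
qed

lemma LINT_lebesgue_on_zero_outside:
  fixes f :: "real \<Rightarrow> complex"
  assumes "\<Omega> \<in> sets lebesgue" "\<And>x. x \<notin> \<Omega> \<Longrightarrow> f x = 0"
  shows "(LINT x|lebesgue_on \<Omega>. f x) = (LINT x|lebesgue. f x)"
proof -
  have "(\<lambda>x. indicator \<Omega> x *\<^sub>R f x) = f" using assms(2) by (auto simp: indicator_def fun_eq_iff)
  then show ?thesis using assms(1) by (simp add: integral_restrict_space)
qed

lemma has_weak_deriv_subset:
  assumes "has_weak_deriv \<Omega> u g" "\<Omega>' \<subseteq> \<Omega>" "\<Omega> \<in> sets lebesgue" "\<Omega>' \<in> sets lebesgue"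
  shows "has_weak_deriv \<Omega>' u g"
  unfolding has_weak_deriv_def
proof (intro conjI ballI)
  show "locally_integrable \<Omega>' u" "locally_integrable \<Omega>' g"
    using assms(1,2) unfolding has_weak_deriv_def locally_integrable_def by auto
  fix \<phi> assume \<phi>: "\<phi> \<in> test_functions \<Omega>'"
  then have \<phi>': "\<phi> \<in> test_functions \<Omega>" using test_functions_mono assms(2) by blast
  have z: "\<phi> x = 0" "deriv \<phi> x = 0" if "x \<notin> \<Omega>'" for x using test_functions_outside[OF \<phi> that] by auto
  have z': "\<phi> x = 0" "deriv \<phi> x = 0" if "x \<notin> \<Omega>" for x using test_functions_outside[OF \<phi>' that] by auto
  have "(LINT x|lebesgue_on \<Omega>. u x * complex_of_real (deriv \<phi> x)) = - (LINT x|lebesgue_on \<Omega>. g x * complex_of_real (\<phi> x))"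
    using assms(1) \<phi>' unfolding has_weak_deriv_def by blast
  then show "(LINT x|lebesgue_on \<Omega>'. u x * complex_of_real (deriv \<phi> x)) = - (LINT x|lebesgue_on \<Omega>'. g x * complex_of_real (\<phi> x))"
    using assms(3,4) z z' by (simp add: LINT_lebesgue_on_zero_outside)
qed

lemma locally_integrable_cong_AE:
  assumes "locally_integrable \<Omega> u" "AE x in lebesgue. u x = u' x"
  shows "locally_integrable \<Omega> u'"
proof -
  obtain N where N: "negligible N" "\<And>x. x \<notin> N \<Longrightarrow> u x = u' x"
    using assms(2) unfolding AE_lebesgue_negligible by blast
  show ?thesis unfolding locally_integrable_def
  proof (intro allI impI)
    fix K assume K: "compact K \<and> K \<subseteq> \<Omega>"
    show "u' absolutely_integrable_on K"
      by (rule absolutely_integrable_spike[OF _ N(1), where f=u])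
        (use N assms(1) K in \<open>auto simp: locally_integrable_def\<close>)
  qed
qed

lemma test_product_integrable:
  assumes "locally_integrable \<Omega> u" "\<phi> \<in> test_functions \<Omega>" "\<Omega> \<in> sets lebesgue"
  shows "integrable (lebesgue_on \<Omega>) (\<lambda>x. u x * complex_of_real (\<phi> x))"
    "integrable (lebesgue_on \<Omega>) (\<lambda>x. u x * complex_of_real (deriv \<phi> x))"
proof -
  obtain K where K: "compact K" "K \<subseteq> \<Omega>" "\<And>x. x \<notin> K \<Longrightarrow> \<phi> x = 0" "\<And>x. x \<notin> K \<Longrightarrow> deriv \<phi> x = 0"
    using test_functionsE[OF assms(2)] by blast
  have u: "u absolutely_integrable_on K" using assms(1) K unfolding locally_integrable_def by blast
  have "(\<lambda>x. u x * complex_of_real (\<psi> x)) absolutely_integrable_on K" if \<psi>: "continuous_on UNIV \<psi>" for \<psi>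
  proof -
    have c: "continuous_on K (\<lambda>x. complex_of_real (\<psi> x))"
      by (intro continuous_intros continuous_on_subset[OF \<psi>]) auto
    have "(\<lambda>x. complex_of_real (\<psi> x) * u x) absolutely_integrable_on K"
    proof (rule absolutely_integrable_bounded_measurable_product[OF bilinear_times _ _ _ u])
      show "(\<lambda>x. complex_of_real (\<psi> x)) \<in> borel_measurable (lebesgue_on K)"
        by (rule continuous_imp_measurable_on_sets_lebesgue[OF c]) (use K(1) in \<open>auto simp: compact_imp_closed\<close>)
      show "bounded ((\<lambda>x. complex_of_real (\<psi> x)) ` K)"
        by (intro compact_imp_bounded compact_continuous_image c K)
    qed (use K(1) in \<open>auto simp: compact_imp_closed\<close>)
    then show ?thesis by (simp add: mult.commute)
  qed
  note * = this[OF test_functions_continuous(1)[OF assms(2)]] this[OF test_functions_continuous(2)[OF assms(2)]]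
  show "integrable (lebesgue_on \<Omega>) (\<lambda>x. u x * complex_of_real (\<phi> x))"
    by (rule LINT_lebesgue_on_supported(2)[OF *(1) _ assms(3)])
      (use K test_functions_outside[OF assms(2)] in auto)
  show "integrable (lebesgue_on \<Omega>) (\<lambda>x. u x * complex_of_real (deriv \<phi> x))"
    by (rule LINT_lebesgue_on_supported(2)[OF *(2) _ assms(3)])
      (use K test_functions_outside[OF assms(2)] in auto)
qed

lemma has_weak_deriv_cong_AE:
  assumes w: "has_weak_deriv \<Omega> u g" and u: "AE x in lebesgue. u x = u' x"
    and g: "AE x in lebesgue. g x = g' x" and \<Omega>: "\<Omega> \<in> sets lebesgue"
  shows "has_weak_deriv \<Omega> u' g'"
proof -
  have l: "locally_integrable \<Omega> u'" "locally_integrable \<Omega> g'"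
    using locally_integrable_cong_AE u g w unfolding has_weak_deriv_def by blast+
  show ?thesis
    unfolding has_weak_deriv_def
  proof (intro conjI ballI l)
    fix \<phi> assume \<phi>: "\<phi> \<in> test_functions \<Omega>"
    have *: "AE x in lebesgue_on \<Omega>. f x = f' x" if "AE x in lebesgue. f x = f' x" for f f' :: "real \<Rightarrow> complex"
      using that \<Omega> by (subst AE_restrict_space_iff) (auto elim: eventually_mono)
    have "(LINT x|lebesgue_on \<Omega>. u' x * complex_of_real (deriv \<phi> x)) = (LINT x|lebesgue_on \<Omega>. u x * complex_of_real (deriv \<phi> x))"
      using w l *[OF u] test_product_integrable(2)[OF _ \<phi> \<Omega>] unfolding has_weak_deriv_def
      by (intro integral_cong_AE borel_measurable_integrable) (auto elim: eventually_mono)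
    moreover have "(LINT x|lebesgue_on \<Omega>. g' x * complex_of_real (\<phi> x)) = (LINT x|lebesgue_on \<Omega>. g x * complex_of_real (\<phi> x))"
      using w l *[OF g] test_product_integrable(1)[OF _ \<phi> \<Omega>] unfolding has_weak_deriv_def
      by (intro integral_cong_AE borel_measurable_integrable) (auto elim: eventually_mono)
    ultimately show "(LINT x|lebesgue_on \<Omega>. u' x * complex_of_real (deriv \<phi> x)) = - (LINT x|lebesgue_on \<Omega>. g' x * complex_of_real (\<phi> x))"
      using w \<phi> unfolding has_weak_deriv_def by simp
  qed
qed

text \<open>
  The difference of two weak derivatives is orthogonal to all test functions.
\<close>

lemma has_weak_deriv_unique:
  assumes "has_weak_deriv \<Omega> u g" "has_weak_deriv \<Omega> u h" "open \<Omega>"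
  shows "AE x in lebesgue. x \<in> \<Omega> \<longrightarrow> g x = h x"
proof -
  have \<Omega>: "\<Omega> \<in> sets lebesgue" using assms(3) by auto
  have l: "locally_integrable \<Omega> g" "locally_integrable \<Omega> h" using assms by (auto simp: has_weak_deriv_def)
  have "AE x in lebesgue. x \<in> \<Omega> \<longrightarrow> g x - h x = 0"
  proof (rule fundamental_lemma_of_variations[OF assms(3)])
    show "(\<lambda>x. g x - h x) absolutely_integrable_on {a..b}" if "{a..b} \<subseteq> \<Omega>" for a b
      using l that by (intro set_integral_diff locally_integrable_Icc)
    fix \<psi> assume \<psi>: "\<psi> \<in> test_functions \<Omega>"
    let ?D = "LINT x|lebesgue_on \<Omega>. u x * complex_of_real (deriv \<psi> x)"
    have "?D = - (LINT x|lebesgue_on \<Omega>. g x * complex_of_real (\<psi> x))"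
      using assms(1) \<psi> unfolding has_weak_deriv_def by blast
    moreover have "?D = - (LINT x|lebesgue_on \<Omega>. h x * complex_of_real (\<psi> x))"
      using assms(2) \<psi> unfolding has_weak_deriv_def by blast
    ultimately have "(LINT x|lebesgue_on \<Omega>. g x * complex_of_real (\<psi> x)) = (LINT x|lebesgue_on \<Omega>. h x * complex_of_real (\<psi> x))"
      by simp
    then show "(LINT x|lebesgue_on \<Omega>. (g x - h x) * complex_of_real (\<psi> x)) = 0"
      using test_product_integrable(1)[OF l(1) \<psi> \<Omega>] test_product_integrable(1)[OF l(2) \<psi> \<Omega>]
      by (simp add: left_diff_distrib)
  qed
  then show ?thesis by eventually_elim auto
qed

lemma weak_deriv_AE:
  assumes "has_weak_deriv (UNIV - {0}) u g"
  shows "AE x in lebesgue. weak_deriv (UNIV - {0}) u x = g x"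
proof -
  have "has_weak_deriv (UNIV - {0}) u (weak_deriv (UNIV - {0}) u)"
    unfolding weak_deriv_def by (rule someI[where P="has_weak_deriv (UNIV - {0}) u"], rule assms)
  from has_weak_deriv_unique[OF this assms open_delete[OF open_UNIV]] AE_nonzero show ?thesis
    by eventually_elim simp
qed

lemma absolutely_integrable_glue:
  assumes "B \<ge> 0" "r absolutely_integrable_on {0..B}" "l absolutely_integrable_on {-B..0}"
  shows "glue r l absolutely_integrable_on {-B..B}" "glue r l absolutely_integrable_on {0..B}"
    "glue r l absolutely_integrable_on {-B..0}"
proof -
  show 1: "glue r l absolutely_integrable_on {0..B}"
    by (rule absolutely_integrable_spike[OF assms(2), of "{0}"]) (auto simp: glue_def)
  show 2: "glue r l absolutely_integrable_on {-B..0}"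
    by (rule absolutely_integrable_spike[OF assms(3), of "{0}"]) (auto simp: glue_def)
  show "glue r l absolutely_integrable_on {-B..B}"
    by (rule absolutely_integrable_on_combine[OF 2 1]) (use assms(1) in auto)
qed

text \<open>
  Integration by parts on both half-lines leaves the boundary term \<open>(l 0 - r 0) * \<phi> 0\<close>. It vanishes either because the
  test function avoids the origin or because the halves agree there.
\<close>

lemma has_weak_deriv_glue:
  assumes r: "primitive_on {0..} r r'" and l: "primitive_on {..0} l l'"
    and \<Omega>: "\<Omega> = UNIV - {0} \<or> \<Omega> = UNIV \<and> r 0 = l 0"
  shows "has_weak_deriv \<Omega> (glue r l) (glue r' l')"
proof -
  have \<Omega>m: "\<Omega> \<in> sets lebesgue" using \<Omega> by auto
  have rB: "primitive_on {0..B} r r'" and lB: "primitive_on {-B..0} l l'" for B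
    by (rule primitive_on_subset[OF r], force) (rule primitive_on_subset[OF l], force)
  have ai: "r absolutely_integrable_on {0..B}" "l absolutely_integrable_on {-B..0}"
    "r' absolutely_integrable_on {0..B}" "l' absolutely_integrable_on {-B..0}" if "B \<ge> 0" for B
    using absolutely_integrable_continuous_real[OF primitive_on_Icc_continuous[OF rB[of B]]]
      absolutely_integrable_continuous_real[OF primitive_on_Icc_continuous[OF lB[of B]]]
      primitive_onD(1)[OF rB[of B], of 0 B] primitive_onD(1)[OF lB[of B], of "-B" 0] that by auto
  note gi = absolutely_integrable_glue[OF _ ai(1,2)] absolutely_integrable_glue[OF _ ai(3,4)]
  have li: "locally_integrable \<Omega> f" if f: "\<And>B. B \<ge> 0 \<Longrightarrow> f absolutely_integrable_on {-B..B}" for f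
    unfolding locally_integrable_def
  proof (intro allI impI)
    fix K assume K: "compact K \<and> K \<subseteq> \<Omega>"
    then obtain B where B: "\<And>x. x \<in> K \<Longrightarrow> norm x \<le> B" "B > 0"
      using compact_imp_bounded bounded_pos by metis
    have "K \<subseteq> {-B..B}" using B(1) by force
    then show "f absolutely_integrable_on K"
      using set_integrable_subset[OF f[of B]] K B(2) by (auto simp: compact_imp_closed)
  qed
  show ?thesis
    unfolding has_weak_deriv_def
  proof (intro conjI ballI)
    show lu: "locally_integrable \<Omega> (glue r l)" and lg: "locally_integrable \<Omega> (glue r' l')"
      by (rule li, rule gi; simp)+
    fix \<phi> assume \<phi>: "\<phi> \<in> test_functions \<Omega>"
    note out = test_functions_outside[OF \<phi>]
    obtain K where K: "compact K" "K \<subseteq> \<Omega>" "\<And>x. x \<notin> K \<Longrightarrow> \<phi> x = 0" "\<And>x. x \<notin> K \<Longrightarrow> deriv \<phi> x = 0"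
      using test_functionsE[OF \<phi>] by blast
    obtain B0 where B0: "\<And>x. x \<in> K \<Longrightarrow> norm x \<le> B0" "B0 > 0"
      using K(1) compact_imp_bounded bounded_pos by metis
    \<comment> \<open>One more than the bound, so that the test function vanishes at the endpoints themselves.\<close>
    define B where "B = B0 + 1"
    have B: "B > 0" using B0 by (simp add: B_def)
    have z: "\<phi> x = 0" "deriv \<phi> x = 0" if "\<not> (- B < x \<and> x < B)" for x
    proof -
      have "x \<notin> K" using B0(1)[of x] that by (auto simp: B_def)
      then show "\<phi> x = 0" "deriv \<phi> x = 0" by (rule K(3), rule K(4))
    qed
    have pi: "(\<lambda>x. f x * complex_of_real (\<phi> x)) absolutely_integrable_on {a..b}"
      "(\<lambda>x. f x * complex_of_real (deriv \<phi> x)) absolutely_integrable_on {a..b}"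
      if "f absolutely_integrable_on {a..b}" for f and a b :: real
      by (rule absolutely_integrable_continuous_mult(2)[OF continuous_on_of_real that],
          rule test_functions_continuous[OF \<phi>])+
    have split: "(LINT x|lebesgue_on \<Omega>. glue p q x * complex_of_real (\<psi> x)) =
        integral {-B..0} (\<lambda>x. q x * complex_of_real (\<psi> x)) + integral {0..B} (\<lambda>x. p x * complex_of_real (\<psi> x))"
      if \<psi>: "\<psi> = \<phi> \<or> \<psi> = deriv \<phi>" and p: "p absolutely_integrable_on {0..B}"
        and q: "q absolutely_integrable_on {-B..0}" for p q \<psi>
    proof -
      let ?f = "\<lambda>x. glue p q x * complex_of_real (\<psi> x)"
      have fi: "?f absolutely_integrable_on {-B..B}"
        using \<psi> pi[OF absolutely_integrable_glue(1)[OF _ p q]] B by auto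
      have "(LINT x|lebesgue_on \<Omega>. ?f x) = integral {-B..B} ?f"
        by (rule LINT_lebesgue_on_supported(1)[OF fi _ \<Omega>m]) (use z out \<psi> in auto)
      also have "\<dots> = integral {-B..0} ?f + integral {0..B} ?f"
        using B set_lebesgue_integral_eq_integral(1)[OF fi]
        by (intro Henstock_Kurzweil_Integration.integral_combine[symmetric]) auto
      also have "integral {-B..0} ?f = integral {-B..0} (\<lambda>x. q x * complex_of_real (\<psi> x))"
        by (rule integral_spike[of "{0}"]) (auto simp: glue_def)
      also have "integral {0..B} ?f = integral {0..B} (\<lambda>x. p x * complex_of_real (\<psi> x))"
        by (rule integral_spike[of "{0}"]) (auto simp: glue_def)
      finally show ?thesis .
    qed
    have 0: "(r 0 - l 0) * complex_of_real (\<phi> 0) = 0" using \<Omega> out[of 0] by auto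
    have "(LINT x|lebesgue_on \<Omega>. glue r l x * complex_of_real (deriv \<phi> x)) =
        integral {-B..0} (\<lambda>x. l x * complex_of_real (deriv \<phi> x)) + integral {0..B} (\<lambda>x. r x * complex_of_real (deriv \<phi> x))"
      using split[of "deriv \<phi>" r l] ai[of B] B by auto
    also have "integral {-B..0} (\<lambda>x. l x * complex_of_real (deriv \<phi> x)) = l 0 * \<phi> 0 - l (-B) * \<phi> (-B) -
        integral {-B..0} (\<lambda>x. l' x * complex_of_real (\<phi> x))"
      using integral_by_parts_test[OF lB _ \<phi>] B by simp
    also have "integral {0..B} (\<lambda>x. r x * complex_of_real (deriv \<phi> x)) = r B * \<phi> B - r 0 * \<phi> 0 -
        integral {0..B} (\<lambda>x. r' x * complex_of_real (\<phi> x))"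
      using integral_by_parts_test[OF rB _ \<phi>] B by simp
    also have "(l 0 * \<phi> 0 - l (-B) * \<phi> (-B) - integral {-B..0} (\<lambda>x. l' x * complex_of_real (\<phi> x))) +
       (r B * \<phi> B - r 0 * \<phi> 0 - integral {0..B} (\<lambda>x. r' x * complex_of_real (\<phi> x))) =
       - (integral {-B..0} (\<lambda>x. l' x * complex_of_real (\<phi> x)) + integral {0..B} (\<lambda>x. r' x * complex_of_real (\<phi> x)))"
      using 0 z(1)[of B] z(1)[of "-B"] by (auto simp: left_diff_distrib)
    also have "\<dots> = - (LINT x|lebesgue_on \<Omega>. glue r' l' x * complex_of_real (\<phi> x))"
      using split[of \<phi> r' l'] ai[of B] B by auto
    finally show "(LINT x|lebesgue_on \<Omega>. glue r l x * complex_of_real (deriv \<phi> x)) =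
        - (LINT x|lebesgue_on \<Omega>. glue r' l' x * complex_of_real (\<phi> x))" .
  qed
qed

lemma primitive_exists:
  fixes g :: "real \<Rightarrow> complex"
  assumes "g \<in> L2 UNIV"
  obtains \<Gamma> where "primitive_on UNIV \<Gamma> g"
proof -
  have gi: "g absolutely_integrable_on {a..b}" for a b
    by (rule L2_absolutely_integrable_Icc[OF assms]) auto
  define \<Gamma> where "\<Gamma> x = (if 0 \<le> x then integral {0..x} g else - integral {x..0} g)" for x
  have "primitive_on UNIV \<Gamma> g"
    unfolding primitive_on_def
  proof (intro ballI impI conjI gi)
    fix s t :: real assume "s \<le> t"
    have c: "integral {a..b} g + integral {b..c} g = integral {a..c} g" if "a \<le> b" "b \<le> c" for a b c
      using that set_lebesgue_integral_eq_integral(1)[OF gi]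
      by (intro Henstock_Kurzweil_Integration.integral_combine) auto
    show "integral {s..t} g = \<Gamma> t - \<Gamma> s"
      using \<open>s \<le> t\<close> c[of 0 s t] c[of s 0 t] c[of s t 0]
      by (auto simp: \<Gamma>_def algebra_simps not_le)
  qed
  then show ?thesis by (rule that)
qed

lemma has_weak_deriv_UNIV_E:
  assumes "has_weak_deriv UNIV u g" "g \<in> L2 UNIV"
  obtains v where "primitive_on UNIV v g" "AE x in lebesgue. u x = v x"
proof -
  obtain \<Gamma> where \<Gamma>: "primitive_on UNIV \<Gamma> g" using primitive_exists[OF assms(2)] .
  obtain \<kappa> where "AE x in lebesgue. x \<in> UNIV \<longrightarrow> u x = \<Gamma> x + \<kappa>"
    using du_Bois_Reymond[OF open_UNIV _ _ \<Gamma> assms(1)] by auto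
  moreover have "primitive_on UNIV (\<lambda>x. \<Gamma> x + \<kappa>) g"
    using primitive_on_add[OF \<Gamma> primitive_on_const[of UNIV \<kappa>]] by simp
  ultimately show ?thesis using that by auto
qed

text \<open>
  Away from the origin the two halves are primitives of the same function with independent constants of
  integration; this independence is the possible jump.
\<close>

lemma has_weak_deriv_punctured_E:
  assumes "has_weak_deriv (UNIV - {0}) u g" "g \<in> L2 (UNIV - {0})"
  obtains r l where "primitive_on {0..} r g" "primitive_on {..0} l g" "AE x in lebesgue. u x = glue r l x"
proof -
  have g: "g \<in> L2 UNIV" using assms(2) L2_minus_point by blast
  obtain \<Gamma> where \<Gamma>: "primitive_on UNIV \<Gamma> g" using primitive_exists[OF g] .
  have sub: "primitive_on J \<Gamma> g" for J by (rule primitive_on_subset[OF \<Gamma>]) auto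
  have w: "has_weak_deriv {0<..} u g" "has_weak_deriv {..<0} u g"
    by (rule has_weak_deriv_subset[OF assms(1)]; auto)+
  obtain \<kappa> where k: "AE x in lebesgue. x \<in> {0<..} \<longrightarrow> u x = \<Gamma> x + \<kappa>"
    using du_Bois_Reymond[OF _ _ _ sub w(1)] by auto
  obtain \<mu> where m: "AE x in lebesgue. x \<in> {..<0} \<longrightarrow> u x = \<Gamma> x + \<mu>"
    using du_Bois_Reymond[OF _ _ _ sub w(2)] by auto
  show ?thesis
  proof (rule that[of "\<lambda>x. \<Gamma> x + \<kappa>" "\<lambda>x. \<Gamma> x + \<mu>"])
    show "primitive_on {0..} (\<lambda>x. \<Gamma> x + \<kappa>) g" "primitive_on {..0} (\<lambda>x. \<Gamma> x + \<mu>) g"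
      using primitive_on_add[OF sub primitive_on_const] by simp_all
    show "AE x in lebesgue. u x = glue (\<lambda>x. \<Gamma> x + \<kappa>) (\<lambda>x. \<Gamma> x + \<mu>) x"
      using k m AE_nonzero by eventually_elim (auto simp: glue_def)
  qed
qed

text \<open>
  The set where two continuous functions differ is open, and nonempty open sets are not negligible.
\<close>

lemma continuous_on_AE_eq:
  fixes f g :: "real \<Rightarrow> complex"
  assumes "open S" "continuous_on S f" "continuous_on S g" "AE x in lebesgue. x \<in> S \<longrightarrow> f x = g x" "x \<in> S"
  shows "f x = g x"
proof (rule ccontr)
  assume ne: "f x \<noteq> g x"
  define U where "U = {y \<in> S. f y - g y \<in> - {0}}"
  have "open U" unfolding U_def
    using continuous_open_preimage[OF continuous_on_diff[OF assms(2,3)] assms(1), of "- {0}"]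
    by (auto simp: vimage_def Int_def open_Compl)
  moreover have "x \<in> U" using ne assms(5) by (simp add: U_def)
  ultimately have "\<not> negligible U" using open_not_negligible by blast
  moreover obtain N where "negligible N" "\<And>x. x \<notin> N \<Longrightarrow> x \<in> S \<longrightarrow> f x = g x"
    using assms(4) unfolding AE_lebesgue_negligible by blast
  then have "negligible U" by (intro negligible_subset[of N U]) (auto simp: U_def)
  ultimately show False by blast
qed

lemma cont_rep_eq:
  assumes "open S" "continuous_on S v" "AE x in lebesgue. x \<in> S \<longrightarrow> v x = u x" "x \<in> S"
  shows "cont_rep S u x = v x"
proof -
  have ae: "(AE x in lebesgue_on S. P x) \<longleftrightarrow> (AE x in lebesgue. x \<in> S \<longrightarrow> P x)" for P
    using assms(1) by (subst AE_restrict_space_iff) auto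
  have "continuous_on S (cont_rep S u) \<and> (AE x in lebesgue_on S. cont_rep S u x = u x)"
    unfolding cont_rep_def by (rule someI[of _ v]) (use assms ae in auto)
  then have c: "continuous_on S (cont_rep S u)" "AE x in lebesgue. x \<in> S \<longrightarrow> cont_rep S u x = u x"
    by (auto simp: ae)
  have "AE x in lebesgue. x \<in> S \<longrightarrow> cont_rep S u x = v x"
    using c(2) assms(3) by eventually_elim simp
  then show ?thesis by (rule continuous_on_AE_eq[OF assms(1) c(1) assms(2) _ assms(4)])
qed

section \<open>The domain and the action of the operator\<close>

text \<open>
  The continuously differentiable representative of an \<open>H\<^sup>2\<close> function on a half-line, together with its first two derivatives.
\<close>

definition H2_data :: "real set \<Rightarrow> (real \<Rightarrow> complex) \<Rightarrow> (real \<Rightarrow> complex) \<Rightarrow> (real \<Rightarrow> complex) \<Rightarrow> bool" where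
  "H2_data S f f1 f2 \<longleftrightarrow> primitive_on S f f1 \<and> primitive_on S f1 f2 \<and> f \<in> L2 S \<and> f1 \<in> L2 S \<and> f2 \<in> L2 S"

lemma primitive_on_Iic_continuous:
  assumes "primitive_on {..a} v g"
  shows "continuous_on {..a} v"
proof -
  have "continuous_on {- a..} (\<lambda>x. v (- x))"
    using primitive_on_Ici_continuous[of "- a"] primitive_on_reflect[OF assms] by simp
  then have "continuous_on (uminus ` {..a}) (\<lambda>x. v (- x))" by simp
  then have "continuous_on {..a} ((\<lambda>x. v (- x)) \<circ> uminus)"
    by (intro continuous_on_compose continuous_intros)
  then show ?thesis by (simp add: o_def)
qed

lemma open_half_subset: "{0<..} \<subseteq> {0::real..}" "{..<0} \<subseteq> {..0::real}"
  by auto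

text \<open>
  One-sided limits of the chosen continuous representative are the boundary values of the half-line
  primitive, which is continuous up to the origin.
\<close>

lemma trace_right:
  assumes r: "continuous_on {0..} r" and u: "AE x in lebesgue. u x = glue r l x"
  shows "Lim (at_right 0) (cont_rep {0<..} u) = r 0"
proof (rule tendsto_Lim)
  have "(r \<longlongrightarrow> r 0) (at 0 within {0..})" using r by (auto simp: continuous_on)
  then have "(r \<longlongrightarrow> r 0) (at_right 0)" by (rule tendsto_within_subset) auto
  moreover have "\<forall>\<^sub>F x in at_right 0. r x = cont_rep {0<..} u x"
  proof (rule eventually_at_right_less[THEN eventually_mono])
    fix x :: real assume "0 < x"
    have "AE x in lebesgue. x \<in> {0<..} \<longrightarrow> r x = u x"
      using u by eventually_elim (auto simp: glue_def)
    from cont_rep_eq[OF open_greaterThan continuous_on_subset[OF r open_half_subset(1)] this, of x]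
    show "r x = cont_rep {0<..} u x" using \<open>0 < x\<close> by auto
  qed
  ultimately show "(cont_rep {0<..} u \<longlongrightarrow> r 0) (at_right 0)" by (rule Lim_transform_eventually)
qed auto

lemma trace_left:
  assumes l: "continuous_on {..0} l" and u: "AE x in lebesgue. u x = glue r l x"
  shows "Lim (at_left 0) (cont_rep {..<0} u) = l 0"
proof (rule tendsto_Lim)
  have "(l \<longlongrightarrow> l 0) (at 0 within {..0})" using l by (auto simp: continuous_on)
  then have "(l \<longlongrightarrow> l 0) (at_left 0)" by (rule tendsto_within_subset) auto
  moreover have "\<forall>\<^sub>F x in at_left 0. l x = cont_rep {..<0} u x"
  proof (rule eventually_at_leftI[of "-1"])
    fix x :: real assume "x \<in> {-1<..<0}"
    have "AE x in lebesgue. x \<in> {..<0} \<longrightarrow> l x = u x"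
      using u by eventually_elim (auto simp: glue_def)
    from cont_rep_eq[OF open_lessThan continuous_on_subset[OF l open_half_subset(2)] this, of x]
    show "l x = cont_rep {..<0} u x" using \<open>x \<in> {-1<..<0}\<close> by auto
  qed auto
  ultimately show "(cont_rep {..<0} u \<longlongrightarrow> l 0) (at_left 0)" by (rule Lim_transform_eventually)
qed auto

lemma continuous_on_glue:
  assumes "continuous_on {0..} r" "continuous_on {..0} l" "r 0 = l 0"
  shows "continuous_on UNIV (glue r l)"
proof -
  have "continuous_on {0..} (glue r l)"
    by (rule continuous_on_eq[OF assms(1)]) (auto simp: glue_def)
  moreover have "continuous_on {..0} (glue r l)"
    by (rule continuous_on_eq[OF assms(2)]) (use assms(3) in \<open>auto simp: glue_def\<close>)
  ultimately have "continuous_on ({0..} \<union> {..0}) (glue r l)"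
    by (intro continuous_on_closed_Un) auto
  moreover have "{0..} \<union> {..0} = (UNIV :: real set)" by auto
  ultimately show ?thesis by simp
qed

lemma cont_rep_glue:
  assumes "continuous_on {0..} r" "continuous_on {..0} l" "r 0 = l 0" "AE x in lebesgue. u x = glue r l x"
  shows "cont_rep UNIV u 0 = r 0"
proof -
  have "AE x in lebesgue. x \<in> UNIV \<longrightarrow> glue r l x = u x" using assms(4) by eventually_elim simp
  from cont_rep_eq[OF open_UNIV continuous_on_glue[OF assms(1-3)] this] show ?thesis by (simp add: glue_def)
qed

lemma has_weak_deriv_AE_glue:
  assumes "primitive_on {0..} r r'" "primitive_on {..0} l l'" "\<Omega> = UNIV - {0} \<or> \<Omega> = UNIV \<and> r 0 = l 0"
    and "AE x in lebesgue. u x = glue r l x" "AE x in lebesgue. u' x = glue r' l' x"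
  shows "has_weak_deriv \<Omega> u u'"
proof (rule has_weak_deriv_cong_AE[OF has_weak_deriv_glue[OF assms(1-3)]])
  show "AE x in lebesgue. glue r l x = u x" using assms(4) by eventually_elim simp
  show "AE x in lebesgue. glue r' l' x = u' x" using assms(5) by eventually_elim simp
qed (use assms(3) in auto)

lemma weak_deriv_AE_glue:
  assumes "primitive_on {0..} r r'" "primitive_on {..0} l l'" "AE x in lebesgue. u x = glue r l x"
  shows "AE x in lebesgue. weak_deriv (UNIV - {0}) u x = glue r' l' x"
  by (rule weak_deriv_AE, rule has_weak_deriv_AE_glue[OF assms(1,2) _ assms(3)]) auto

lemma op_L_AE_glue:
  assumes r: "H2_data {0..} r r1 r2" and l: "H2_data {..0} l l1 l2" and u: "AE x in lebesgue. u x = glue r l x"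
  shows "AE x in lebesgue. op_L Vp Vm u x = glue (\<lambda>x. - r2 x + Vp * r x) (\<lambda>x. - l2 x + Vm * l x) x"
proof -
  note p = r[unfolded H2_data_def] l[unfolded H2_data_def]
  have w: "AE x in lebesgue. weak_deriv (UNIV - {0}) u x = glue r1 l1 x"
    by (rule weak_deriv_AE_glue[OF _ _ u]) (use p in auto)
  have "AE x in lebesgue. weak_deriv (UNIV - {0}) (weak_deriv (UNIV - {0}) u) x = glue r2 l2 x"
    by (rule weak_deriv_AE_glue[OF _ _ w]) (use p in auto)
  then show ?thesis using u
    by eventually_elim (auto simp: op_L_def glue_def step_potential_def)
qed

lemma dom_L_I:
  assumes r: "H2_data {0..} r r1 r2" and l: "H2_data {..0} l l1 l2"
    and cont: "r 0 = l 0" and jump: "r1 0 - l1 0 = \<alpha> * r 0"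
    and u: "AE x in lebesgue. u x = glue r l x"
  shows "u \<in> dom_L \<alpha>"
proof -
  note p = r[unfolded H2_data_def] l[unfolded H2_data_def]
  let ?\<Omega> = "UNIV - {0::real}"
  have u': "AE x in lebesgue. glue r l x = u x" using u by eventually_elim simp
  have L: "u \<in> L2 UNIV" using L2_UNIV_cong_AE[OF L2_glue(1) u'] p by blast
  have L': "glue r1 l1 \<in> L2 UNIV" "glue r2 l2 \<in> L2 UNIV" using L2_glue(1) p by blast+
  have w: "has_weak_deriv \<Omega> u (glue r1 l1)" if "\<Omega> = ?\<Omega> \<or> \<Omega> = UNIV" for \<Omega>
    by (rule has_weak_deriv_AE_glue[OF _ _ _ u]) (use p cont that in auto)
  have w2: "has_weak_deriv ?\<Omega> (glue r1 l1) (glue r2 l2)"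
    by (rule has_weak_deriv_glue) (use p in auto)
  have "u \<in> sobolev_H 1 UNIV" using L L'(1) w[of UNIV] by auto
  moreover have "u \<in> sobolev_H 2 ?\<Omega>"
    using L L' w[of ?\<Omega>] w2 by (auto simp: numeral_2_eq_2 L2_minus_point)
  moreover have wd: "AE x in lebesgue. weak_deriv ?\<Omega> u x = glue r1 l1 x"
    by (rule weak_deriv_AE_glue[OF _ _ u]) (use p in auto)
  have "continuous_on {0..} r1" "continuous_on {..0} l1" "continuous_on {0..} r" "continuous_on {..0} l"
    using p primitive_on_Ici_continuous primitive_on_Iic_continuous by blast+
  then have "Lim (at_right 0) (cont_rep {0<..} (weak_deriv ?\<Omega> u)) -
        Lim (at_left 0) (cont_rep {..<0} (weak_deriv ?\<Omega> u)) = \<alpha> * cont_rep UNIV u 0"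
    using trace_right[OF _ wd] trace_left[OF _ wd] cont_rep_glue[OF _ _ cont u] jump by simp
  ultimately show ?thesis unfolding dom_L_def by blast
qed

lemma L2_AE_glue:
  assumes "u \<in> L2 UNIV" "AE x in lebesgue. u x = glue r l x"
  shows "r \<in> L2 {0..}" "l \<in> L2 {..0}"
proof -
  have "AE x in lebesgue. x \<in> {0..} \<longrightarrow> u x = r x" "AE x in lebesgue. x \<in> {..0} \<longrightarrow> u x = l x"
    using assms(2) AE_nonzero by (eventually_elim, auto simp: glue_def)+
  then show "r \<in> L2 {0..}" "l \<in> L2 {..0}"
    using L2_subset[OF assms(1), of "{0..}"] L2_subset[OF assms(1), of "{..0}"]
    by (auto intro: L2_cong_AE)
qed

text \<open>
  Two applications of the du Bois-Reymond lemma on the punctured line produce the halves. Membership in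
  \<open>H\<^sup>1\<close> of the full line supplies a continuous representative across the origin, which forces the halves to agree there.
\<close>

lemma dom_L_E:
  assumes "u \<in> dom_L \<alpha>"
  obtains r r1 r2 l l1 l2 where "H2_data {0..} r r1 r2" "H2_data {..0} l l1 l2"
    "r 0 = l 0" "r1 0 - l1 0 = \<alpha> * r 0" "AE x in lebesgue. u x = glue r l x"
proof -
  let ?\<Omega> = "UNIV - {0::real}"
  have uL: "u \<in> L2 UNIV" using assms unfolding dom_L_def by auto
  obtain G where G: "G \<in> L2 UNIV" "has_weak_deriv UNIV u G" using assms unfolding dom_L_def by auto
  obtain g h where g: "g \<in> L2 ?\<Omega>" "has_weak_deriv ?\<Omega> u g" and h: "h \<in> L2 ?\<Omega>" "has_weak_deriv ?\<Omega> g h"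
    using assms unfolding dom_L_def numeral_2_eq_2 by auto
  obtain r1 l1 where 1: "primitive_on {0..} r1 h" "primitive_on {..0} l1 h" "AE x in lebesgue. g x = glue r1 l1 x"
    using has_weak_deriv_punctured_E[OF h(2,1)] .
  obtain r l where 0: "primitive_on {0..} r g" "primitive_on {..0} l g" "AE x in lebesgue. u x = glue r l x"
    using has_weak_deriv_punctured_E[OF g(2,1)] .
  have ae: "AE x in lebesgue. x \<in> {0..} \<longrightarrow> g x = r1 x" "AE x in lebesgue. x \<in> {..0} \<longrightarrow> g x = l1 x"
    using 1(3) AE_nonzero by (eventually_elim, auto simp: glue_def)+
  have p: "primitive_on {0..} r r1" "primitive_on {..0} l l1"
    using primitive_on_cong_AE[OF 0(1) _ ae(1)] primitive_on_cong_AE[OF 0(2) _ ae(2)] by auto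
  have hL: "h \<in> L2 UNIV" "g \<in> L2 UNIV" using g(1) h(1) by (simp_all add: L2_minus_point)
  have R: "H2_data {0..} r r1 h"
    unfolding H2_data_def using p 1 L2_AE_glue[OF uL 0(3)] L2_AE_glue[OF hL(2) 1(3)] L2_subset[OF hL(1)] by auto
  have L: "H2_data {..0} l l1 h"
    unfolding H2_data_def using p 1 L2_AE_glue[OF uL 0(3)] L2_AE_glue[OF hL(2) 1(3)] L2_subset[OF hL(1)] by auto
  have c: "continuous_on {0..} r1" "continuous_on {..0} l1" "continuous_on {0..} r" "continuous_on {..0} l"
    using p 1 primitive_on_Ici_continuous primitive_on_Iic_continuous by blast+
  obtain v where v: "primitive_on UNIV v G" "AE x in lebesgue. u x = v x"
    using has_weak_deriv_UNIV_E[OF G(2,1)] .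
  have vc: "continuous_on S v" for S
    using primitive_on_UNIV_continuous[OF v(1)] continuous_on_subset by blast
  have lim0: "v 0 = r 0" "v 0 = l 0"
  proof -
    have "AE x in lebesgue. x \<in> {0<..} \<longrightarrow> v x = r x" "AE x in lebesgue. x \<in> {..<0} \<longrightarrow> v x = l x"
      using 0(3) v(2) by (eventually_elim, auto simp: glue_def)+
    then have eq: "x > 0 \<Longrightarrow> v x = r x" "x < 0 \<Longrightarrow> v x = l x" for x
      using continuous_on_AE_eq[OF open_greaterThan vc continuous_on_subset[OF c(3) open_half_subset(1)], of x]
        continuous_on_AE_eq[OF open_lessThan vc continuous_on_subset[OF c(4) open_half_subset(2)], of x] by auto
    have "(v \<longlongrightarrow> v 0) (at_right 0)" "(v \<longlongrightarrow> v 0) (at_left 0)"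
      using vc[of UNIV] by (auto simp: continuous_on_def intro: tendsto_within_subset)
    moreover have "\<forall>\<^sub>F x in at_right 0. v x = r x"
      using eventually_at_right_less by (rule eventually_mono) (use eq in auto)
    moreover have "\<forall>\<^sub>F x in at_left 0. v x = l x"
      by (rule eventually_at_leftI[of "-1"]) (use eq in auto)
    ultimately have "(r \<longlongrightarrow> v 0) (at_right 0)" "(l \<longlongrightarrow> v 0) (at_left 0)"
      using Lim_transform_eventually by blast+
    moreover have "(r \<longlongrightarrow> r 0) (at_right 0)"
      using c(3) by (auto simp: continuous_on intro: tendsto_within_subset[of _ _ _ "{0..}"])
    moreover have "(l \<longlongrightarrow> l 0) (at_left 0)"
      using c(4) by (auto simp: continuous_on intro: tendsto_within_subset[of _ _ _ "{..0}"])
    ultimately show "v 0 = r 0" "v 0 = l 0"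
      using tendsto_unique[OF trivial_limit_at_right_real] tendsto_unique[OF trivial_limit_at_left_real] by blast+
  qed
  have wd: "AE x in lebesgue. weak_deriv ?\<Omega> u x = glue r1 l1 x"
    by (rule weak_deriv_AE_glue[OF p 0(3)])
  have cont: "r 0 = l 0" using lim0 by simp
  have "r1 0 - l1 0 = \<alpha> * r 0"
    using assms trace_right[OF c(1) wd] trace_left[OF c(2) wd] cont_rep_glue[OF c(3,4) cont 0(3)]
    unfolding dom_L_def by simp
  then show ?thesis using that[OF R L cont _ 0(3)] by blast
qed

section \<open>The resolvent equation on a half-line\<close>

lemma has_vector_derivative_exp_scaled:
  "((\<lambda>x. exp (k * complex_of_real x)) has_vector_derivative k * exp (k * complex_of_real x)) (at x)"
  by (rule has_vector_derivative_real_field) (auto intro!: derivative_eq_intros)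

lemma primitive_on_exp:
  assumes "is_interval I"
  shows "primitive_on I (\<lambda>x. exp (k * complex_of_real x)) (\<lambda>x. k * exp (k * complex_of_real x))"
  by (rule primitive_on_has_vector_derivative[OF has_vector_derivative_exp_scaled assms])
    (intro continuous_intros)

text \<open>
  The fundamental theorem for \<open>\<bar>y\<bar>\<^sup>2 = y * cnj y\<close>.
\<close>

lemma energy_identity:
  assumes y: "primitive_on {0..} y d" and X: "0 \<le> X"
  shows "((\<lambda>x. 2 * Re (d x * cnj (y x))) has_integral ((cmod (y X))\<^sup>2 - (cmod (y 0))\<^sup>2)) {0..X}"
proof -
  have p: "primitive_on {0..} (\<lambda>x. y x * cnj (y x)) (\<lambda>x. d x * cnj (y x) + y x * cnj (d x))"
    by (rule primitive_on_mult[OF _ y primitive_on_cnj[OF y]]) auto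
  have "((\<lambda>x. d x * cnj (y x) + y x * cnj (d x)) has_integral (y X * cnj (y X) - y 0 * cnj (y 0))) {0..X}"
    using integrable_integral[OF primitive_onD(3)[OF p, of 0 X]] primitive_onD(2)[OF p, of 0 X] X by simp
  from has_integral_linear[OF this bounded_linear_Re] show ?thesis
    by (simp add: o_def complex_norm_square[symmetric] algebra_simps)
qed

lemma Re_mult_cnj_le:
  assumes "\<kappa> > 0"
  shows "\<bar>2 * Re (f * cnj y)\<bar> \<le> \<kappa> * (cmod y)\<^sup>2 + (cmod f)\<^sup>2 / \<kappa>"
proof -
  have "\<bar>2 * Re (f * cnj y)\<bar> \<le> 2 * (cmod f * cmod y)"
    using abs_Re_le_cmod[of "f * cnj y"] by (simp add: norm_mult)
  also have "\<dots> \<le> \<kappa> * (cmod y)\<^sup>2 + (cmod f)\<^sup>2 / \<kappa>"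
  proof -
    have "0 \<le> (\<kappa> * cmod y - cmod f)\<^sup>2 / \<kappa>" using assms by simp
    also have "\<dots> = \<kappa> * (cmod y)\<^sup>2 + (cmod f)\<^sup>2 / \<kappa> - 2 * (cmod f * cmod y)"
      using assms by (simp add: power2_eq_square field_simps)
    finally show ?thesis by simp
  qed
  finally show ?thesis .
qed

lemma integral_sq_le_Ici:
  fixes f :: "real \<Rightarrow> complex"
  assumes "f \<in> L2 {0..}"
  shows "(\<lambda>x. (cmod (f x))\<^sup>2) integrable_on {0..X}"
    "integral {0..X} (\<lambda>x. (cmod (f x))\<^sup>2) \<le> integral {0..} (\<lambda>x. (cmod (f x))\<^sup>2)"
proof -
  have "f \<in> L2 {0..X}" by (rule L2_subset[OF assms]) auto
  then show i: "(\<lambda>x. (cmod (f x))\<^sup>2) integrable_on {0..X}" by (rule L2_sq_absolutely_integrable(2)) auto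
  show "integral {0..X} (\<lambda>x. (cmod (f x))\<^sup>2) \<le> integral {0..} (\<lambda>x. (cmod (f x))\<^sup>2)"
    by (rule integral_subset_le[OF _ i L2_sq_absolutely_integrable(2)[OF assms]]) auto
qed

text \<open>
  The equation \<open>y' = k y - f\<close> forces exponential growth away from its square integrable solution. Young's
  inequality absorbs the forcing into half of the term \<open>2 Re k \<bar>y\<bar>\<^sup>2\<close>; the price is the boundary term at \<open>X\<close>, which is harmless
  as soon as it is small or bounded for large \<open>X\<close>.
\<close>

lemma energy_growing:
  assumes y: "primitive_on {0..} y (\<lambda>x. k * y x - f x)" and f: "f \<in> L2 {0..}" and k: "Re k > 0" and X: "0 \<le> X"
  shows "Re k * integral {0..X} (\<lambda>x. (cmod (y x))\<^sup>2) + (cmod (y 0))\<^sup>2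
    \<le> (cmod (y X))\<^sup>2 + integral {0..} (\<lambda>x. (cmod (f x))\<^sup>2) / Re k"
proof -
  let ?\<kappa> = "Re k"
  have cy: "continuous_on {0..X} y"
    by (rule continuous_on_subset[OF primitive_on_Ici_continuous[OF y]]) auto
  have iy: "(\<lambda>x. (cmod (y x))\<^sup>2) integrable_on {0..X}"
    by (intro integrable_continuous_real continuous_intros cy)
  note if' = integral_sq_le_Ici[OF f, of X]
  have "integral {0..X} (\<lambda>x. ?\<kappa> * (cmod (y x))\<^sup>2 - (cmod (f x))\<^sup>2 / ?\<kappa>) \<le> (cmod (y X))\<^sup>2 - (cmod (y 0))\<^sup>2"
  proof (rule has_integral_le[OF integrable_integral energy_identity[OF y X]])
    show "(\<lambda>x. ?\<kappa> * (cmod (y x))\<^sup>2 - (cmod (f x))\<^sup>2 / ?\<kappa>) integrable_on {0..X}"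
      by (intro integrable_diff integrable_on_mult_right integrable_on_divide iy if')
    fix x
    have "Re ((k * y x - f x) * cnj (y x)) = ?\<kappa> * (cmod (y x))\<^sup>2 - Re (f x * cnj (y x))"
      unfolding left_diff_distrib mult.assoc complex_norm_square[symmetric] by (simp del: of_real_power)
    then show "?\<kappa> * (cmod (y x))\<^sup>2 - (cmod (f x))\<^sup>2 / ?\<kappa> \<le> 2 * Re ((k * y x - f x) * cnj (y x))"
      using Re_mult_cnj_le[OF k, of "f x" "y x"] by (simp add: abs_le_iff)
  qed
  also have "integral {0..X} (\<lambda>x. ?\<kappa> * (cmod (y x))\<^sup>2 - (cmod (f x))\<^sup>2 / ?\<kappa>) =
      ?\<kappa> * integral {0..X} (\<lambda>x. (cmod (y x))\<^sup>2) - integral {0..X} (\<lambda>x. (cmod (f x))\<^sup>2) / ?\<kappa>"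
    using iy if' by (subst integral_diff) (auto intro!: integrable_on_mult_right integrable_on_divide)
  finally have "?\<kappa> * integral {0..X} (\<lambda>x. (cmod (y x))\<^sup>2) + (cmod (y 0))\<^sup>2
     \<le> (cmod (y X))\<^sup>2 + integral {0..X} (\<lambda>x. (cmod (f x))\<^sup>2) / ?\<kappa>" by simp
  also have "\<dots> \<le> (cmod (y X))\<^sup>2 + integral {0..} (\<lambda>x. (cmod (f x))\<^sup>2) / ?\<kappa>"
    using if'(2) k by (simp add: divide_right_mono)
  finally show ?thesis .
qed

text \<open>
  The equation \<open>v' = - k v + y\<close> is stable towards infinity, so here the boundary term at \<open>X\<close> has the good sign.
\<close>

lemma energy_decaying:
  assumes v: "primitive_on {0..} v (\<lambda>x. y x - k * v x)" and y: "y \<in> L2 {0..}" and k: "Re k > 0" and X: "0 \<le> X"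
  shows "Re k * integral {0..X} (\<lambda>x. (cmod (v x))\<^sup>2) \<le> (cmod (v 0))\<^sup>2 + integral {0..} (\<lambda>x. (cmod (y x))\<^sup>2) / Re k"
proof -
  let ?\<kappa> = "Re k"
  have cv: "continuous_on {0..X} v"
    by (rule continuous_on_subset[OF primitive_on_Ici_continuous[OF v]]) auto
  have iv: "(\<lambda>x. (cmod (v x))\<^sup>2) integrable_on {0..X}"
    by (intro integrable_continuous_real continuous_intros cv)
  note iy = integral_sq_le_Ici[OF y, of X]
  have "(cmod (v X))\<^sup>2 - (cmod (v 0))\<^sup>2 \<le> integral {0..X} (\<lambda>x. (cmod (y x))\<^sup>2 / ?\<kappa> - ?\<kappa> * (cmod (v x))\<^sup>2)"
  proof (rule has_integral_le[OF energy_identity[OF v X] integrable_integral])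
    show "(\<lambda>x. (cmod (y x))\<^sup>2 / ?\<kappa> - ?\<kappa> * (cmod (v x))\<^sup>2) integrable_on {0..X}"
      by (intro integrable_diff integrable_on_mult_right integrable_on_divide iy iv)
    fix x
    have "Re ((y x - k * v x) * cnj (v x)) = Re (y x * cnj (v x)) - ?\<kappa> * (cmod (v x))\<^sup>2"
      unfolding left_diff_distrib mult.assoc complex_norm_square[symmetric] by (simp del: of_real_power)
    then show "2 * Re ((y x - k * v x) * cnj (v x)) \<le> (cmod (y x))\<^sup>2 / ?\<kappa> - ?\<kappa> * (cmod (v x))\<^sup>2"
      using Re_mult_cnj_le[OF k, of "y x" "v x"] by (simp add: abs_le_iff)
  qed
  also have "\<dots> = integral {0..X} (\<lambda>x. (cmod (y x))\<^sup>2) / ?\<kappa> - ?\<kappa> * integral {0..X} (\<lambda>x. (cmod (v x))\<^sup>2)"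
    using iv iy by (subst integral_diff) (auto intro!: integrable_on_mult_right integrable_on_divide)
  finally have "?\<kappa> * integral {0..X} (\<lambda>x. (cmod (v x))\<^sup>2) + (cmod (v X))\<^sup>2
      \<le> (cmod (v 0))\<^sup>2 + integral {0..X} (\<lambda>x. (cmod (y x))\<^sup>2) / ?\<kappa>" by simp
  moreover have "integral {0..X} (\<lambda>x. (cmod (y x))\<^sup>2) / ?\<kappa> \<le> integral {0..} (\<lambda>x. (cmod (y x))\<^sup>2) / ?\<kappa>"
    using iy(2) k by (simp add: divide_right_mono)
  ultimately show ?thesis using zero_le_power2[of "cmod (v X)"] by linarith
qed

lemma L2_Ici_if_bounded:
  fixes v :: "real \<Rightarrow> complex"
  assumes c: "continuous_on {0..} v" and C: "\<And>X. 0 \<le> X \<Longrightarrow> integral {0..X} (\<lambda>x. (cmod (v x))\<^sup>2) \<le> C"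
  shows "v \<in> L2 {0..}" "integral {0..} (\<lambda>x. (cmod (v x))\<^sup>2) \<le> C"
proof -
  define F where "F n x = (if x \<in> {0..real n} then (cmod (v x))\<^sup>2 else 0)" for n x
  have iv: "(\<lambda>x. (cmod (v x))\<^sup>2) integrable_on {0..real n}" for n
    by (intro integrable_continuous_real continuous_intros continuous_on_subset[OF c]) auto
  have FUi: "(F n has_integral integral {0..real n} (\<lambda>x. (cmod (v x))\<^sup>2)) {0..}" for n
    unfolding F_def by (subst has_integral_restrict) (auto intro: integrable_integral[OF iv])
  note FU = integral_unique[OF FUi] and Fi = has_integral_integrable[OF FUi]
  have mc: "(\<lambda>x. (cmod (v x))\<^sup>2) integrable_on {0..} \<and>
      (\<lambda>n. integral {0..} (F n)) \<longlonglongrightarrow> integral {0..} (\<lambda>x. (cmod (v x))\<^sup>2)"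
  proof (rule monotone_convergence_increasing)
    show "F n integrable_on {0..}" for n by (rule Fi)
    show "F n x \<le> F (Suc n) x" for n x by (auto simp: F_def)
    show "(\<lambda>n. F n x) \<longlonglongrightarrow> (cmod (v x))\<^sup>2" if "x \<in> {0..}" for x
    proof (rule tendsto_eventually)
      have "\<forall>\<^sub>F n in sequentially. x \<le> real n" 
        by (rule eventually_sequentiallyI[of "nat \<lceil>x\<rceil>"]) linarith
      then show "\<forall>\<^sub>F n in sequentially. F n x = (cmod (v x))\<^sup>2"
        by eventually_elim (use that in \<open>auto simp: F_def\<close>)
    qed
    show "bounded (range (\<lambda>n. integral {0..} (F n)))"
    proof (rule boundedI)
      fix t assume "t \<in> range (\<lambda>n. integral {0..} (F n))"
      then obtain n where t: "t = integral {0..} (F n)" by auto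
      have "t \<ge> 0" unfolding t FU by (intro integral_nonneg iv) auto
      then show "norm t \<le> C" using C[of "real n"] t FU[of n] by auto
    qed
  qed
  show "v \<in> L2 {0..}"
    by (rule L2I_integrable_on[OF continuous_imp_measurable_on_sets_lebesgue[OF c]]) (use mc in auto)
  show "integral {0..} (\<lambda>x. (cmod (v x))\<^sup>2) \<le> C"
    by (rule LIMSEQ_le_const2[OF conjunct2[OF mc]]) (use C FU in auto)
qed

lemma L2_small_values:
  assumes y: "y \<in> L2 {0..}" and "\<epsilon> > 0" "X0 \<ge> 0"
  obtains X where "X \<ge> X0" "(cmod (y X))\<^sup>2 \<le> \<epsilon>"
proof (rule ccontr)
  assume no: "\<not> thesis"
  note found = that
  have big: "(cmod (y X))\<^sup>2 > \<epsilon>" if "X \<ge> X0" for X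
    using found[OF that] no by (meson not_le)
  define I where "I = integral {0..} (\<lambda>x. (cmod (y x))\<^sup>2)"
  \<comment> \<open>On \<open>[X0, T]\<close> a lower bound \<open>\<epsilon>\<close> would contribute \<open>\<bar>I\<bar> + 1\<close>, more than the whole integral.\<close>
  define T where "T = X0 + (\<bar>I\<bar> + 1) / \<epsilon>"
  have T: "T \<ge> X0" using assms(2) by (simp add: T_def)
  have iy: "(\<lambda>x. (cmod (y x))\<^sup>2) integrable_on {X0..T}"
    by (rule L2_sq_absolutely_integrable(2), rule L2_subset[OF y]) (use assms(3) in auto)
  have "integral {X0..T} (\<lambda>x. \<epsilon>) \<le> integral {X0..T} (\<lambda>x. (cmod (y x))\<^sup>2)"
    by (rule integral_le[OF _ iy]) (use big in \<open>auto intro: less_imp_le\<close>)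
  also have "\<dots> \<le> I"
    unfolding I_def by (rule integral_subset_le[OF _ iy L2_sq_absolutely_integrable(2)[OF y]])
      (use assms(3) in auto)
  also have "integral {X0..T} (\<lambda>x. \<epsilon>) = \<bar>I\<bar> + 1" using T assms(2) by (simp add: T_def)
  finally show False by simp
qed

text \<open>
  With \<open>y = w + k v\<close> the second-order equation \<open>h = k\<^sup>2 v - f\<close> splits into the first-order equations \<open>y' = k y - f\<close> and
  \<open>v' = - k v + y\<close>. Square integrability of \<open>y\<close> makes its boundary term small along a sequence, so \<open>y\<close> and
  \<open>y 0\<close> are controlled by \<open>f\<close>, and then \<open>v\<close> by \<open>v 0\<close> and \<open>y\<close>.
\<close>

lemma half_line_estimate:
  assumes d: "H2_data {0..} v w h" and k: "Re k > 0"
  defines "F \<equiv> integral {0..} (\<lambda>x. (cmod (k\<^sup>2 * v x - h x))\<^sup>2)"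
  shows "(cmod (w 0 + k * v 0))\<^sup>2 \<le> F / Re k"
    "integral {0..} (\<lambda>x. (cmod (v x))\<^sup>2) \<le> (cmod (v 0))\<^sup>2 / Re k + F / (Re k) ^ 4"
proof -
  note D = d[unfolded H2_data_def]
  define y where "y x = w x + k * v x" for x
  define f where "f x = k\<^sup>2 * v x - h x" for x
  have yL: "y \<in> L2 {0..}" and fL: "f \<in> L2 {0..}"
    unfolding y_def f_def using D by (auto intro!: L2_add L2_diff L2_cmult)
  have "primitive_on {0..} y (\<lambda>x. h x + k * w x)"
    unfolding y_def using D by (auto intro!: primitive_on_add primitive_on_cmult)
  moreover have "(\<lambda>x. h x + k * w x) = (\<lambda>x. k * y x - f x)"
    by (auto simp: y_def f_def fun_eq_iff algebra_simps power2_eq_square)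
  ultimately have py: "primitive_on {0..} y (\<lambda>x. k * y x - f x)" by simp
  have pv: "primitive_on {0..} v (\<lambda>x. y x - k * v x)"
    using D by (simp add: y_def)
  have Ff: "F = integral {0..} (\<lambda>x. (cmod (f x))\<^sup>2)" by (simp add: F_def f_def)
  have F0: "F \<ge> 0" unfolding Ff by (intro integral_nonneg L2_sq_absolutely_integrable(2) fL) auto
  have cy: "continuous_on {0..} y" by (rule primitive_on_Ici_continuous[OF py])
  have iy: "(\<lambda>x. (cmod (y x))\<^sup>2) integrable_on {0..X}" for X
    by (intro integrable_continuous_real continuous_intros continuous_on_subset[OF cy]) auto
  have y_bound: "Re k * integral {0..X} (\<lambda>x. (cmod (y x))\<^sup>2) + (cmod (y 0))\<^sup>2 \<le> F / Re k" if X: "X \<ge> 0" for X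
  proof (rule field_le_epsilon)
    fix \<epsilon> :: real assume e: "\<epsilon> > 0"
    obtain Y where Y: "Y \<ge> X" "(cmod (y Y))\<^sup>2 \<le> \<epsilon>" using L2_small_values[OF yL e X] by blast
    have "integral {0..X} (\<lambda>x. (cmod (y x))\<^sup>2) \<le> integral {0..Y} (\<lambda>x. (cmod (y x))\<^sup>2)"
      using Y by (intro integral_subset_le iy) auto
    then have "Re k * integral {0..X} (\<lambda>x. (cmod (y x))\<^sup>2) \<le> Re k * integral {0..Y} (\<lambda>x. (cmod (y x))\<^sup>2)"
      using k by simp
    then show "Re k * integral {0..X} (\<lambda>x. (cmod (y x))\<^sup>2) + (cmod (y 0))\<^sup>2 \<le> F / Re k + \<epsilon>"
      using energy_growing[OF py fL k, of Y] Y X unfolding Ff by linarith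
  qed
  show "(cmod (w 0 + k * v 0))\<^sup>2 \<le> F / Re k"
    using y_bound[of 0] by (simp add: y_def)
  have "integral {0..X} (\<lambda>x. (cmod (y x))\<^sup>2) \<le> F / (Re k)\<^sup>2" if "X \<ge> 0" for X
  proof -
    have "Re k * integral {0..X} (\<lambda>x. (cmod (y x))\<^sup>2) \<le> F / Re k"
      using y_bound[OF that] zero_le_power2[of "cmod (y 0)"] by linarith
    then show ?thesis using k by (simp add: field_simps power2_eq_square)
  qed
  then have Iy: "integral {0..} (\<lambda>x. (cmod (y x))\<^sup>2) \<le> F / (Re k)\<^sup>2"
    by (rule L2_Ici_if_bounded(2)[OF cy])
  have "integral {0..X} (\<lambda>x. (cmod (v x))\<^sup>2) \<le> (cmod (v 0))\<^sup>2 / Re k + F / (Re k) ^ 4" if "X \<ge> 0" for X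
  proof -
    have "Re k * integral {0..X} (\<lambda>x. (cmod (v x))\<^sup>2) \<le> (cmod (v 0))\<^sup>2 + integral {0..} (\<lambda>x. (cmod (y x))\<^sup>2) / Re k"
      by (rule energy_decaying[OF pv yL k that])
    also have "\<dots> \<le> (cmod (v 0))\<^sup>2 + F / (Re k)\<^sup>2 / Re k"
      using Iy k by (intro add_left_mono divide_right_mono) auto
    also have "\<dots> = Re k * ((cmod (v 0))\<^sup>2 / Re k + F / (Re k) ^ 4)"
      using k by (simp add: field_simps power2_eq_square power4_eq_xxxx)
    finally show ?thesis using k by simp
  qed
  then show "integral {0..} (\<lambda>x. (cmod (v x))\<^sup>2) \<le> (cmod (v 0))\<^sup>2 / Re k + F / (Re k) ^ 4"
    by (rule L2_Ici_if_bounded(2)[OF primitive_on_Ici_continuous[OF pv]])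
qed

text \<open>
  Among the solutions of \<open>y' = k y - f\<close> only \<open>y x = exp (k x) * \<integral>\<^sub>x\<^sup>\<infinity> exp (- k t) f t dt\<close> does not grow. It is bounded by
  \<open>2 a b \<le> a\<^sup>2 + b\<^sup>2\<close> under the integral, and boundedness is all that the energy inequality needs to give
  square integrability.
\<close>

lemma growing_solution:
  assumes f: "f \<in> L2 {0..}" and k: "Re k > 0"
  obtains y where "primitive_on {0..} y (\<lambda>x. k * y x - f x)" "y \<in> L2 {0..}"
proof -
  let ?\<kappa> = "Re k"
  define E where "E x = exp (- k * complex_of_real x)" for x
  define F where "F = integral {0..} (\<lambda>x. (cmod (f x))\<^sup>2)"
  have normE: "cmod (E x) = exp (- ?\<kappa> * x)" for x by (simp add: E_def)
  have hexp: "((\<lambda>x. exp (- (2 * ?\<kappa>) * x)) has_integral exp (- (2 * ?\<kappa>) * c) / (2 * ?\<kappa>)) {c..}" for c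
    using k by (intro has_integral_exp_minus_to_infinity) auto
  have sqf: "(\<lambda>x. (cmod (f x))\<^sup>2) integrable_on {c..}" if "c \<ge> 0" for c
    by (rule L2_sq_absolutely_integrable(2), rule L2_subset[OF f]) (use that in auto)
  have EfI: "(\<lambda>x. E x * f x) absolutely_integrable_on {c..}" if c: "c \<ge> 0" for c
  proof (rule measurable_bounded_by_integrable_imp_absolutely_integrable)
    have "f \<in> L2 {c..}" by (rule L2_subset[OF f]) (use c in auto)
    moreover have "E \<in> borel_measurable (lebesgue_on {c..})"
      by (rule continuous_imp_measurable_on_sets_lebesgue) (auto simp: E_def intro!: continuous_intros)
    ultimately show "(\<lambda>x. E x * f x) \<in> borel_measurable (lebesgue_on {c..})"
      by (auto simp: L2_def)
    show "(\<lambda>x. exp (- (2 * ?\<kappa>) * x) + (cmod (f x))\<^sup>2) integrable_on {c..}"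
      using hexp[of c] sqf[OF c] by (intro integrable_add) blast+
    fix x
    have "cmod (E x * f x) \<le> (cmod (E x))\<^sup>2 + (cmod (f x))\<^sup>2"
      using sum_squares_bound[of "cmod (E x)" "cmod (f x)"]
        mult_nonneg_nonneg[OF norm_ge_zero[of "E x"] norm_ge_zero[of "f x"]]
      unfolding norm_mult by linarith
    moreover have "(cmod (E x))\<^sup>2 = exp (- (2 * ?\<kappa>) * x)"
      unfolding normE by (simp add: power2_eq_square flip: exp_add)
    ultimately show "cmod (E x * f x) \<le> exp (- (2 * ?\<kappa>) * x) + (cmod (f x))\<^sup>2" by simp
  qed auto
  define q where "q x = integral {x..} (\<lambda>x. E x * f x)" for x
  have pq: "primitive_on {0..} q (\<lambda>x. - (E x * f x))"
    unfolding primitive_on_def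
  proof (intro ballI impI conjI)
    fix s t :: real assume st: "s \<in> {0..}" "t \<in> {0..}" "s \<le> t"
    have a: "(\<lambda>x. E x * f x) absolutely_integrable_on {s..t}"
      by (rule set_integrable_subset[OF EfI[of 0]]) (use st in auto)
    then show "(\<lambda>x. - (E x * f x)) absolutely_integrable_on {s..t}"
      using absolutely_integrable_continuous_mult(1)[of s t "\<lambda>_. -1"] by simp
    have "((\<lambda>x. E x * f x) has_integral integral {s..t} (\<lambda>x. E x * f x) + q t) ({s..t} \<union> {t..})"
      unfolding q_def
    proof (rule has_integral_Un)
      show "((\<lambda>x. E x * f x) has_integral integral {s..t} (\<lambda>x. E x * f x)) {s..t}"
        using a set_lebesgue_integral_eq_integral(1) by blast
      show "((\<lambda>x. E x * f x) has_integral integral {t..} (\<lambda>x. E x * f x)) {t..}"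
        using EfI[of t] st set_lebesgue_integral_eq_integral(1) by auto
      have "{s..t} \<inter> {t..} \<subseteq> {t}" by auto
      then show "negligible ({s..t} \<inter> {t..})" by (rule negligible_subset[rotated]) auto
    qed
    moreover have "{s..t} \<union> {t..} = {s..}" using st by auto
    ultimately have "q s = integral {s..t} (\<lambda>x. E x * f x) + q t"
      unfolding q_def by (simp add: integral_unique)
    then show "integral {s..t} (\<lambda>x. - (E x * f x)) = q t - q s" by simp
  qed
  define y where "y x = exp (k * complex_of_real x) * q x" for x
  have "primitive_on {0..} y (\<lambda>x. k * exp (k * complex_of_real x) * q x + exp (k * complex_of_real x) * - (E x * f x))"
    unfolding y_def by (rule primitive_on_mult[OF _ primitive_on_exp pq]) auto
  moreover have "k * exp (k * complex_of_real x) * q x + exp (k * complex_of_real x) * - (E x * f x) = k * y x - f x" for x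
  proof -
    have "exp (k * complex_of_real x) * E x = 1" by (simp add: E_def flip: exp_add)
    then show ?thesis by (simp add: y_def algebra_simps)
  qed
  ultimately have py: "primitive_on {0..} y (\<lambda>x. k * y x - f x)" by simp
  have ybd: "cmod (y x) \<le> 1 / (2 * ?\<kappa>) + F" if x: "x \<ge> 0" for x
  proof -
    let ?e = "exp (2 * ?\<kappa> * x)"
    have "cmod (exp (k * complex_of_real x) * q x) = cmod (integral {x..} (\<lambda>t. exp (k * complex_of_real x) * (E t * f t)))"
      by (simp add: q_def)
    also have "\<dots> \<le> integral {x..} (\<lambda>t. ?e * exp (- (2 * ?\<kappa>) * t) + (cmod (f t))\<^sup>2)"
    proof (rule integral_norm_bound_integral)
      show "(\<lambda>t. exp (k * complex_of_real x) * (E t * f t)) integrable_on {x..}"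
        using EfI[OF x] by (intro integrable_on_mult_right set_lebesgue_integral_eq_integral(1))
      show "(\<lambda>t. ?e * exp (- (2 * ?\<kappa>) * t) + (cmod (f t))\<^sup>2) integrable_on {x..}"
        using hexp[of x] sqf[OF x] by (intro integrable_add integrable_on_mult_right) blast+
      fix t
      define a where "a = exp (?\<kappa> * x) * exp (- ?\<kappa> * t)"
      have "a > 0" by (simp add: a_def)
      have "cmod (exp (k * complex_of_real x) * (E t * f t)) = a * cmod (f t)"
        by (simp add: norm_mult normE a_def)
      also have "\<dots> \<le> a\<^sup>2 + (cmod (f t))\<^sup>2"
      proof -
        have "0 \<le> a * cmod (f t)" using \<open>a > 0\<close> by simp
        then show ?thesis using sum_squares_bound[of a "cmod (f t)"] by linarith
      qed
      also have "a\<^sup>2 = ?e * exp (- (2 * ?\<kappa>) * t)"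
        by (simp add: a_def power2_eq_square algebra_simps flip: exp_add)
      finally show "cmod (exp (k * complex_of_real x) * (E t * f t)) \<le> ?e * exp (- (2 * ?\<kappa>) * t) + (cmod (f t))\<^sup>2" .
    qed
    also have "\<dots> = integral {x..} (\<lambda>t. ?e * exp (- (2 * ?\<kappa>) * t)) + integral {x..} (\<lambda>t. (cmod (f t))\<^sup>2)"
      using hexp[of x] sqf[OF x] by (intro integral_add integrable_on_mult_right) blast+
    also have "integral {x..} (\<lambda>t. ?e * exp (- (2 * ?\<kappa>) * t)) = 1 / (2 * ?\<kappa>)"
    proof -
      have "((\<lambda>t. ?e * exp (- (2 * ?\<kappa>) * t)) has_integral ?e * (exp (- (2 * ?\<kappa>) * x) / (2 * ?\<kappa>))) {x..}"
        by (rule has_integral_mult_right[OF hexp])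
      moreover have "?e * exp (- (2 * ?\<kappa>) * x) = 1" by (simp flip: exp_add)
      ultimately show ?thesis by (metis integral_unique times_divide_eq_right)
    qed
    also have "integral {x..} (\<lambda>t. (cmod (f t))\<^sup>2) \<le> F"
      unfolding F_def by (rule integral_subset_le[OF _ sqf[OF x] sqf]) (use x in auto)
    finally show ?thesis by (simp add: y_def)
  qed
  have "integral {0..X} (\<lambda>x. (cmod (y x))\<^sup>2) \<le> ((1 / (2 * ?\<kappa>) + F)\<^sup>2 + F / ?\<kappa>) / ?\<kappa>" if X: "X \<ge> 0" for X
  proof -
    have "(cmod (y X))\<^sup>2 \<le> (1 / (2 * ?\<kappa>) + F)\<^sup>2" using ybd[OF X] by (intro power_mono) auto
    then have "?\<kappa> * integral {0..X} (\<lambda>x. (cmod (y x))\<^sup>2) \<le> (1 / (2 * ?\<kappa>) + F)\<^sup>2 + F / ?\<kappa>"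
      using energy_growing[OF py f k X] zero_le_power2[of "cmod (y 0)"] unfolding F_def by linarith
    then show ?thesis using k by (simp add: field_simps)
  qed
  then have "y \<in> L2 {0..}" by (rule L2_Ici_if_bounded(1)[OF primitive_on_Ici_continuous[OF py]])
  with py show ?thesis by (rule that)
qed

lemma decaying_solution:
  assumes y: "y \<in> L2 {0..}" and k: "Re k > 0"
  obtains v where "v 0 = a" "primitive_on {0..} v (\<lambda>x. y x - k * v x)" "v \<in> L2 {0..}"
proof -
  define E where "E x = exp (k * complex_of_real x)" for x
  have Eyi: "(\<lambda>x. E x * y x) absolutely_integrable_on {s..t}" if "s \<ge> 0" for s t
    by (rule absolutely_integrable_continuous_mult(1)[OF _ L2_absolutely_integrable_Icc[OF y]])
      (use that in \<open>auto simp: E_def intro!: continuous_intros\<close>)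
  define q where "q x = a + integral {0..x} (\<lambda>x. E x * y x)" for x
  have pq: "primitive_on {0..} q (\<lambda>x. E x * y x)"
    unfolding primitive_on_def
  proof (intro ballI impI conjI Eyi)
    fix s t :: real assume st: "s \<in> {0..}" "t \<in> {0..}" "s \<le> t"
    show "integral {s..t} (\<lambda>x. E x * y x) = q t - q s"
      using integral_Icc_diff[OF _ Eyi[of 0 t], of s] st by (simp add: q_def)
  qed auto
  define v where "v x = exp (- k * complex_of_real x) * q x" for x
  have "primitive_on {0..} v (\<lambda>x. - k * exp (- k * complex_of_real x) * q x + exp (- k * complex_of_real x) * (E x * y x))"
    unfolding v_def by (rule primitive_on_mult[OF _ primitive_on_exp pq]) auto
  moreover have "- k * exp (- k * complex_of_real x) * q x + exp (- k * complex_of_real x) * (E x * y x) = y x - k * v x" for x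
  proof -
    have "exp (- k * complex_of_real x) * E x = 1" by (simp add: E_def flip: exp_add)
    then have "exp (- k * complex_of_real x) * (E x * y x) = y x" by (metis mult.assoc mult_1)
    then show ?thesis by (simp add: v_def)
  qed
  ultimately have pv: "primitive_on {0..} v (\<lambda>x. y x - k * v x)" by simp
  have "integral {0..X} (\<lambda>x. (cmod (v x))\<^sup>2) \<le>
      ((cmod (v 0))\<^sup>2 + integral {0..} (\<lambda>x. (cmod (y x))\<^sup>2) / Re k) / Re k" if "X \<ge> 0" for X
    using energy_decaying[OF pv y k that] k by (simp add: field_simps)
  then have "v \<in> L2 {0..}" by (rule L2_Ici_if_bounded(1)[OF primitive_on_Ici_continuous[OF pv]])
  moreover have "v 0 = a" by (simp add: v_def q_def)
  ultimately show ?thesis using that pv by blast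
qed

text \<open>
  The number \<open>y0\<close> depends on \<open>k\<close> and \<open>f\<close> only, while the boundary value \<open>a\<close> is free: this freedom is used to satisfy the
  interface condition at the origin.
\<close>

lemma half_line_solution:
  assumes f: "f \<in> L2 {0..}" and k: "Re k > 0"
  obtains y0 where "\<And>a. \<exists>v w h. H2_data {0..} v w h \<and> v 0 = a \<and> w 0 + k * a = y0 \<and> (\<forall>x. k\<^sup>2 * v x - h x = f x)"
proof -
  obtain y where y: "primitive_on {0..} y (\<lambda>x. k * y x - f x)" "y \<in> L2 {0..}"
    using growing_solution[OF f k] .
  show ?thesis
  proof (rule that[of "y 0"])
    fix a
    obtain v where v: "v 0 = a" "primitive_on {0..} v (\<lambda>x. y x - k * v x)" "v \<in> L2 {0..}"
      using decaying_solution[OF y(2) k] by metis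
    define w where "w x = y x - k * v x" for x
    define h where "h x = k\<^sup>2 * v x - f x" for x
    have "primitive_on {0..} (\<lambda>x. y x + (- k) * v x) (\<lambda>x. k * y x - f x + (- k) * (y x - k * v x))"
      by (rule primitive_on_add[OF y(1) primitive_on_cmult[OF v(2)]])
    moreover have "(\<lambda>x. y x + (- k) * v x) = w" "(\<lambda>x. k * y x - f x + (- k) * (y x - k * v x)) = h"
      by (auto simp: w_def h_def fun_eq_iff algebra_simps power2_eq_square)
    ultimately have "primitive_on {0..} w h" by simp
    moreover have "w \<in> L2 {0..}" "h \<in> L2 {0..}"
      unfolding w_def h_def by (intro L2_diff L2_cmult v y f)+
    ultimately have "H2_data {0..} v w h" using v by (simp add: H2_data_def w_def[abs_def])
    then show "\<exists>v w h. H2_data {0..} v w h \<and> v 0 = a \<and> w 0 + k * a = y 0 \<and> (\<forall>x. k\<^sup>2 * v x - h x = f x)"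
      using v(1) by (intro exI[of _ v] exI[of _ w] exI[of _ h]) (auto simp: w_def h_def)
  qed
qed

section \<open>Points of the resolvent set\<close>

lemma uminus_image_half_lines: "uminus ` {..0::real} = {0..}" "uminus ` {0::real..} = {..0}"
  by auto

lemma H2_data_reflect:
  assumes "H2_data S v w h" "S \<in> sets lebesgue" "uminus ` S \<in> sets lebesgue"
  shows "H2_data (uminus ` S) (\<lambda>x. v (- x)) (\<lambda>x. - w (- x)) (\<lambda>x. h (- x))"
proof -
  note d = assms(1)[unfolded H2_data_def]
  have "primitive_on (uminus ` S) (\<lambda>x. - w (- x)) (\<lambda>x. h (- x))"
    using primitive_on_cmult[OF primitive_on_reflect, of S w h "-1"] d by simp
  moreover have "(\<lambda>x. - w (- x)) \<in> L2 (uminus ` S)"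
    using L2_cmult[OF L2_reflect(1)[OF _ assms(2,3)], of w "-1"] d by simp
  ultimately show ?thesis
    using d primitive_on_reflect L2_reflect(1)[OF _ assms(2,3)] unfolding H2_data_def by blast
qed

lemma H2_data_diff:
  assumes "H2_data S v w h" "H2_data S v' w' h'"
  shows "H2_data S (\<lambda>x. v x - v' x) (\<lambda>x. w x - w' x) (\<lambda>x. h x - h' x)"
proof -
  have p: "primitive_on S (\<lambda>x. f x - f' x) (\<lambda>x. g x - g' x)"
    if "primitive_on S f g" "primitive_on S f' g'" for f g f' g'
    using primitive_on_add[OF that(1) primitive_on_cmult[OF that(2), of "-1"]] by simp
  show ?thesis using assms unfolding H2_data_def by (auto intro: p L2_diff)
qed

lemma shifted_op_AE_glue:
  assumes r: "H2_data {0..} r r1 r2" and l: "H2_data {..0} l l1 l2" and u: "AE x in lebesgue. u x = glue r l x"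
    and k: "kp\<^sup>2 = Vp - z" "km\<^sup>2 = Vm - z"
  shows "AE x in lebesgue. op_L Vp Vm u x - z * u x = glue (\<lambda>x. kp\<^sup>2 * r x - r2 x) (\<lambda>x. km\<^sup>2 * l x - l2 x) x"
  using op_L_AE_glue[OF r l u, of Vp Vm] u
  by eventually_elim (auto simp: glue_def k algebra_simps)

lemma shifted_op_norm:
  assumes r: "H2_data {0..} r r1 r2" and l: "H2_data {..0} l l1 l2" and u: "AE x in lebesgue. u x = glue r l x"
    and k: "kp\<^sup>2 = Vp - z" "km\<^sup>2 = Vm - z"
  shows "(L2_norm (\<lambda>x. op_L Vp Vm u x - z * u x))\<^sup>2 =
     integral {0..} (\<lambda>x. (cmod (kp\<^sup>2 * r x - r2 x))\<^sup>2) + integral {..0} (\<lambda>x. (cmod (km\<^sup>2 * l x - l2 x))\<^sup>2)"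
proof -
  have L: "(\<lambda>x. kp\<^sup>2 * r x - r2 x) \<in> L2 {0..}" "(\<lambda>x. km\<^sup>2 * l x - l2 x) \<in> L2 {..0}"
    using r l unfolding H2_data_def by (auto intro!: L2_diff L2_cmult)
  have ae: "AE x in lebesgue. glue (\<lambda>x. kp\<^sup>2 * r x - r2 x) (\<lambda>x. km\<^sup>2 * l x - l2 x) x = op_L Vp Vm u x - z * u x"
    using shifted_op_AE_glue[OF r l u k] by eventually_elim simp
  show ?thesis
    using L2_norm_cong_AE[OF L2_glue(1)[OF L] ae] L2_glue(2)[OF L] by simp
qed

lemma norm_AE_glue:
  assumes "r \<in> L2 {0..}" "l \<in> L2 {..0}" "AE x in lebesgue. u x = glue r l x"
  shows "(L2_norm u)\<^sup>2 = integral {0..} (\<lambda>x. (cmod (r x))\<^sup>2) + integral {..0} (\<lambda>x. (cmod (l x))\<^sup>2)"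
proof -
  have ae: "AE x in lebesgue. glue r l x = u x" using assms(3) by eventually_elim simp
  show ?thesis using L2_norm_cong_AE[OF L2_glue(1)[OF assms(1,2)] ae] L2_glue(2)[OF assms(1,2)] by simp
qed

text \<open>
  Reflecting the left half turns the interface condition into \<open>(kp + km + \<alpha>) * r 0 = yp + ym\<close>, where \<open>yp\<close> and \<open>ym\<close> are the
  boundary values controlled by the half-line estimates. Hence the value at the origin, and then both
  halves, are controlled by the right-hand side.
\<close>

lemma coupled_estimate:
  assumes r: "H2_data {0..} r r1 r2" and l: "H2_data {..0} l l1 l2"
    and cont: "r 0 = l 0" and jump: "r1 0 - l1 0 = \<alpha> * r 0"
    and kp: "Re kp > 0" and km: "Re km > 0" and D: "kp + km + \<alpha> \<noteq> 0"
  shows "integral {0..} (\<lambda>x. (cmod (r x))\<^sup>2) + integral {..0} (\<lambda>x. (cmod (l x))\<^sup>2)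
    \<le> ((1 / Re kp + 1 / Re km) * (2 / (cmod (kp + km + \<alpha>))\<^sup>2) * (1 / Re kp + 1 / Re km)
         + 1 / Re kp ^ 4 + 1 / Re km ^ 4)
      * (integral {0..} (\<lambda>x. (cmod (kp\<^sup>2 * r x - r2 x))\<^sup>2) + integral {..0} (\<lambda>x. (cmod (km\<^sup>2 * l x - l2 x))\<^sup>2))"
    (is "_ \<le> ((1 / ?p + 1 / ?m) * (2 / ?D\<^sup>2) * _ + _ + _) * (?F + ?G)")
proof -
  have m: "{..0} \<in> sets (lebesgue::real measure)" "uminus ` {..0} \<in> sets (lebesgue::real measure)"
    by (auto simp: uminus_image_half_lines)
  note refl = H2_data_reflect[OF l m, unfolded uminus_image_half_lines]
  have lL: "l \<in> L2 {..0}" and gL: "(\<lambda>x. km\<^sup>2 * l x - l2 x) \<in> L2 {..0}"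
    using l unfolding H2_data_def by (auto intro!: L2_diff L2_cmult)
  have G: "integral {0..} (\<lambda>x. (cmod (km\<^sup>2 * l (- x) - l2 (- x)))\<^sup>2) = ?G"
    using L2_reflect(2)[OF gL m] by (simp add: uminus_image_half_lines)
  have ll: "integral {0..} (\<lambda>x. (cmod (l (- x)))\<^sup>2) = integral {..0} (\<lambda>x. (cmod (l x))\<^sup>2)"
    using L2_reflect(2)[OF lL m] by (simp add: uminus_image_half_lines)
  have FG: "?F \<ge> 0" "?G \<ge> 0"
    using gL r unfolding H2_data_def
    by (auto intro!: integral_nonneg L2_sq_absolutely_integrable(2) L2_diff L2_cmult)
  define yp ym where "yp = r1 0 + kp * r 0" and "ym = - l1 0 + km * l 0"
  note Er = half_line_estimate[OF r kp] and El = half_line_estimate[OF refl km, unfolded G]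
  have yp: "(cmod yp)\<^sup>2 \<le> ?F / ?p" using Er(1) by (simp add: yp_def)
  have ym: "(cmod ym)\<^sup>2 \<le> ?G / ?m" using El(1) by (simp add: ym_def)
  have "(kp + km + \<alpha>) * r 0 = yp + ym"
    using jump cont by (simp add: yp_def ym_def algebra_simps)
  then have "?D\<^sup>2 * (cmod (r 0))\<^sup>2 = (cmod (yp + ym))\<^sup>2" by (metis norm_mult power_mult_distrib)
  also have "\<dots> \<le> 2 * (?F / ?p) + 2 * (?G / ?m)"
    using cmod_add_sq_le[of yp ym] yp ym by linarith
  also have "\<dots> \<le> 2 * ((1 / ?p + 1 / ?m) * (?F + ?G))"
    using FG kp km by (simp add: algebra_simps)
  finally have r0: "(cmod (r 0))\<^sup>2 \<le> (2 / ?D\<^sup>2) * (1 / ?p + 1 / ?m) * (?F + ?G)"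
    using D by (simp add: field_simps)
  have "integral {0..} (\<lambda>x. (cmod (r x))\<^sup>2) + integral {..0} (\<lambda>x. (cmod (l x))\<^sup>2)
      \<le> ((cmod (r 0))\<^sup>2 / ?p + ?F / ?p ^ 4) + ((cmod (r 0))\<^sup>2 / ?m + ?G / ?m ^ 4)"
    using Er(2) El(2) by (simp add: ll cont)
  also have "\<dots> = (1 / ?p + 1 / ?m) * (cmod (r 0))\<^sup>2 + ?F / ?p ^ 4 + ?G / ?m ^ 4"
    by (simp add: algebra_simps)
  also have "\<dots> \<le> (1 / ?p + 1 / ?m) * ((2 / ?D\<^sup>2) * (1 / ?p + 1 / ?m) * (?F + ?G)) + (?F + ?G) / ?p ^ 4 + (?F + ?G) / ?m ^ 4"
    using r0 FG kp km by (intro add_mono mult_left_mono divide_right_mono) auto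
  also have "\<dots> = ((1 / ?p + 1 / ?m) * (2 / ?D\<^sup>2) * (1 / ?p + 1 / ?m) + 1 / ?p ^ 4 + 1 / ?m ^ 4) * (?F + ?G)"
  proof -
    have "A * (B * A * S) + S / p + S / m = (A * B * A + 1 / p + 1 / m) * S" for A B S p m :: real
      by (simp add: distrib_right mult.assoc)
    then show ?thesis .
  qed
  finally show ?thesis .
qed

lemma integral_sq_AE_zero:
  assumes "AE x in lebesgue. x \<in> S \<longrightarrow> f x = (0::complex)"
  shows "integral S (\<lambda>x::real. (cmod (f x))\<^sup>2) = 0"
proof -
  obtain N where N: "negligible N" "\<And>x. x \<notin> N \<Longrightarrow> x \<in> S \<longrightarrow> f x = 0"
    using assms unfolding AE_lebesgue_negligible by blast
  show ?thesis by (rule integral_unique, rule has_integral_negligible[OF N(1)]) (use N in auto)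
qed

lemma L2_norm_zero_AE:
  assumes "f \<in> L2 UNIV" "(L2_norm f)\<^sup>2 \<le> 0"
  shows "AE x in lebesgue. f x = 0"
proof -
  have i: "integrable lebesgue (\<lambda>x. (cmod (f x))\<^sup>2)" using assms(1) by (simp add: L2_UNIV_iff)
  have "(LINT x|lebesgue. (cmod (f x))\<^sup>2) = 0"
    using assms(2) by (intro antisym) (simp_all add: L2_norm_def)
  then show ?thesis using integral_nonneg_eq_0_iff_AE[OF i] by simp
qed

lemma L2_norm_nonneg: "L2_norm f \<ge> 0"
  by (simp add: L2_norm_def)

text \<open>
  Injectivity and boundedness come from the coupled estimate. For surjectivity the value \<open>a\<close> at the origin is chosen
  such that \<open>(kp + km + \<alpha>) * a = yp + ym\<close>.
\<close>

lemma rho_L_I: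
  assumes k: "kp\<^sup>2 = Vp - z" "km\<^sup>2 = Vm - z"
    and kp: "Re kp > 0" and km: "Re km > 0" and D: "kp + km + \<alpha> \<noteq> 0"
  shows "z \<in> rho_L Vp Vm \<alpha>"
  unfolding rho_L_def resolvent_set_def
proof (intro CollectI conjI ballI impI)
  fix u v assume u: "u \<in> dom_L \<alpha>" and v: "v \<in> dom_L \<alpha>"
    and eq: "AE x in lebesgue. op_L Vp Vm u x - z * u x = op_L Vp Vm v x - z * v x"
  obtain r r1 r2 l l1 l2 where U: "H2_data {0..} r r1 r2" "H2_data {..0} l l1 l2"
    "r 0 = l 0" "r1 0 - l1 0 = \<alpha> * r 0" "AE x in lebesgue. u x = glue r l x" using dom_L_E[OF u] .
  obtain R R1 R2 L L1 L2' where V: "H2_data {0..} R R1 R2" "H2_data {..0} L L1 L2'"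
    "R 0 = L 0" "R1 0 - L1 0 = \<alpha> * R 0" "AE x in lebesgue. v x = glue R L x" using dom_L_E[OF v] .
  note d = H2_data_diff[OF U(1) V(1)] H2_data_diff[OF U(2) V(2)]
  have ae: "AE x in lebesgue. glue (\<lambda>x. kp\<^sup>2 * r x - r2 x) (\<lambda>x. km\<^sup>2 * l x - l2 x) x =
      glue (\<lambda>x. kp\<^sup>2 * R x - R2 x) (\<lambda>x. km\<^sup>2 * L x - L2' x) x"
    using eq shifted_op_AE_glue[OF U(1,2,5) k] shifted_op_AE_glue[OF V(1,2,5) k] by eventually_elim simp
  have 0: "integral {0..} (\<lambda>x. (cmod (kp\<^sup>2 * (r x - R x) - (r2 x - R2 x)))\<^sup>2) = 0"
    by (rule integral_sq_AE_zero) (use ae in \<open>eventually_elim, auto simp: glue_def algebra_simps\<close>)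
  have 1: "integral {..0} (\<lambda>x. (cmod (km\<^sup>2 * (l x - L x) - (l2 x - L2' x)))\<^sup>2) = 0"
  proof (rule integral_sq_AE_zero)
    show "AE x in lebesgue. x \<in> {..0} \<longrightarrow> km\<^sup>2 * (l x - L x) - (l2 x - L2' x) = 0"
      using ae AE_nonzero by eventually_elim (auto simp: glue_def algebra_simps)
  qed
  have dL: "(\<lambda>x. r x - R x) \<in> L2 {0..}" "(\<lambda>x. l x - L x) \<in> L2 {..0}" using d by (auto simp: H2_data_def)
  have "integral {0..} (\<lambda>x. (cmod (r x - R x))\<^sup>2) + integral {..0} (\<lambda>x. (cmod (l x - L x))\<^sup>2) \<le> 0"
    using coupled_estimate[OF d _ _ kp km D] U V 0 1 by (simp add: algebra_simps)
  then have "(L2_norm (glue (\<lambda>x. r x - R x) (\<lambda>x. l x - L x)))\<^sup>2 \<le> 0" by (simp add: L2_glue(2)[OF dL])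
  then have "AE x in lebesgue. glue (\<lambda>x. r x - R x) (\<lambda>x. l x - L x) x = 0"
    by (rule L2_norm_zero_AE[OF L2_glue(1)[OF dL]])
  then show "AE x in lebesgue. u x = v x"
    using U(5) V(5) by eventually_elim (auto simp: glue_def split: if_splits)
next
  fix f assume f: "f \<in> L2 UNIV"
  have m: "{..0} \<in> sets (lebesgue::real measure)" "uminus ` {..0} \<in> sets (lebesgue::real measure)"
    "{0..} \<in> sets (lebesgue::real measure)" "uminus ` {0..} \<in> sets (lebesgue::real measure)"
    by (auto simp: uminus_image_half_lines)
  have fp: "f \<in> L2 {0..}" and fm0: "f \<in> L2 {..0}" using L2_subset[OF f] by auto
  have fm: "(\<lambda>x. f (- x)) \<in> L2 {0..}" using L2_reflect(1)[OF fm0 m(1,2)] by (simp add: uminus_image_half_lines)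
  obtain yp where yp: "\<And>a. \<exists>v w h. H2_data {0..} v w h \<and> v 0 = a \<and> w 0 + kp * a = yp \<and> (\<forall>x. kp\<^sup>2 * v x - h x = f x)"
    using half_line_solution[OF fp kp] by metis
  obtain ym where ym: "\<And>a. \<exists>v w h. H2_data {0..} v w h \<and> v 0 = a \<and> w 0 + km * a = ym \<and> (\<forall>x. km\<^sup>2 * v x - h x = f (- x))"
    using half_line_solution[OF fm km] by metis
  define a where "a = (yp + ym) / (kp + km + \<alpha>)"
  have a: "(kp + km + \<alpha>) * a = yp + ym" using D by (simp add: a_def)
  obtain r r1 r2 where r: "H2_data {0..} r r1 r2" "r 0 = a" "r1 0 + kp * a = yp" "\<And>x. kp\<^sup>2 * r x - r2 x = f x"
    using yp[of a] by blast
  obtain s s1 s2 where s: "H2_data {0..} s s1 s2" "s 0 = a" "s1 0 + km * a = ym" "\<And>x. km\<^sup>2 * s x - s2 x = f (- x)"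
    using ym[of a] by blast
  have l: "H2_data {..0} (\<lambda>x. s (- x)) (\<lambda>x. - s1 (- x)) (\<lambda>x. s2 (- x))"
    using H2_data_reflect[OF s(1) m(3,4)] by (simp add: uminus_image_half_lines)
  let ?u = "glue r (\<lambda>x. s (- x))"
  have "?u \<in> dom_L \<alpha>"
  proof (rule dom_L_I[OF r(1) l])
    have "r1 0 + s1 0 = \<alpha> * a" using a r(3) s(3) by algebra
    then show "r1 0 - - s1 (- 0) = \<alpha> * r 0" using r(2) by simp
  qed (use r s in auto)
  moreover have "AE x in lebesgue. op_L Vp Vm ?u x - z * ?u x = f x"
  proof -
    have "AE x in lebesgue. ?u x = ?u x" by simp
    moreover have "glue (\<lambda>x. kp\<^sup>2 * r x - r2 x) (\<lambda>x. km\<^sup>2 * s (- x) - s2 (- x)) = f"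
      by (auto simp: glue_def fun_eq_iff r(4) s(4))
    ultimately show ?thesis using shifted_op_AE_glue[OF r(1) l _ k, of ?u] by (simp only:)
  qed
  ultimately show "\<exists>u\<in>dom_L \<alpha>. AE x in lebesgue. op_L Vp Vm u x - z * u x = f x" by blast
next
  let ?C = "(1 / Re kp + 1 / Re km) * (2 / (cmod (kp + km + \<alpha>))\<^sup>2) * (1 / Re kp + 1 / Re km)
         + 1 / Re kp ^ 4 + 1 / Re km ^ 4"
  have C: "?C \<ge> 0" using kp km by simp
  show "\<exists>C. \<forall>u\<in>dom_L \<alpha>. L2_norm u \<le> C * L2_norm (\<lambda>x. op_L Vp Vm u x - z * u x)"
  proof (intro exI ballI)
    fix u assume u: "u \<in> dom_L \<alpha>"
    obtain r r1 r2 l l1 l2 where U: "H2_data {0..} r r1 r2" "H2_data {..0} l l1 l2"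
      "r 0 = l 0" "r1 0 - l1 0 = \<alpha> * r 0" "AE x in lebesgue. u x = glue r l x" using dom_L_E[OF u] .
    have "r \<in> L2 {0..}" "l \<in> L2 {..0}" using U by (auto simp: H2_data_def)
    then have "(L2_norm u)\<^sup>2 \<le> ?C * (L2_norm (\<lambda>x. op_L Vp Vm u x - z * u x))\<^sup>2"
      using coupled_estimate[OF U(1-4) kp km D] norm_AE_glue[OF _ _ U(5)] shifted_op_norm[OF U(1,2,5) k] by simp
    also have "\<dots> = (sqrt ?C * L2_norm (\<lambda>x. op_L Vp Vm u x - z * u x))\<^sup>2"
      using C by (simp only: power_mult_distrib real_sqrt_pow2)
    finally show "L2_norm u \<le> sqrt ?C * L2_norm (\<lambda>x. op_L Vp Vm u x - z * u x)"
      by (rule power2_le_imp_le) (use C L2_norm_nonneg in simp)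
  qed
qed

section \<open>Points of the spectrum\<close>

lemma L2_exp_decay:
  assumes "Re s > 0"
  shows "(\<lambda>x. c * exp (- s * complex_of_real x)) \<in> L2 {0..}"
    "((\<lambda>x. (cmod (c * exp (- s * complex_of_real x)))\<^sup>2) has_integral (cmod c)\<^sup>2 / (2 * Re s)) {0..}"
proof -
  have "((\<lambda>x. (cmod c)\<^sup>2 * exp (- (2 * Re s) * x)) has_integral (cmod c)\<^sup>2 * (exp (- (2 * Re s) * 0) / (2 * Re s))) {0..}"
    using assms by (intro has_integral_mult_right has_integral_exp_minus_to_infinity) auto
  moreover have "(cmod (c * exp (- s * complex_of_real x)))\<^sup>2 = (cmod c)\<^sup>2 * exp (- (2 * Re s) * x)" for x
  proof -
    have "(exp (- (Re s * x)))\<^sup>2 = exp (- (2 * Re s) * x)" by (simp add: power2_eq_square flip: exp_add)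
    then show ?thesis by (simp add: norm_mult power_mult_distrib)
  qed
  ultimately show *: "((\<lambda>x. (cmod (c * exp (- s * complex_of_real x)))\<^sup>2) has_integral (cmod c)\<^sup>2 / (2 * Re s)) {0..}"
    by simp
  show "(\<lambda>x. c * exp (- s * complex_of_real x)) \<in> L2 {0..}"
    by (rule L2I_integrable_on[OF continuous_imp_measurable_on_sets_lebesgue])
      (use * in \<open>auto intro!: continuous_intros\<close>)
qed

lemma H2_data_two_exponentials:
  assumes "Re s > 0" "Re t > 0"
  shows "H2_data {0..} (\<lambda>x. a * exp (- s * complex_of_real x) + b * exp (- t * complex_of_real x))
     (\<lambda>x. (- s * a) * exp (- s * complex_of_real x) + (- t * b) * exp (- t * complex_of_real x))
     (\<lambda>x. (s\<^sup>2 * a) * exp (- s * complex_of_real x) + (t\<^sup>2 * b) * exp (- t * complex_of_real x))"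
proof -
  have p: "primitive_on {0..} (\<lambda>x. a * exp (- s * complex_of_real x) + b * exp (- t * complex_of_real x))
     (\<lambda>x. a * (- s * exp (- s * complex_of_real x)) + b * (- t * exp (- t * complex_of_real x)))" for a b
    by (intro primitive_on_add primitive_on_cmult primitive_on_exp) auto
  have e: "(\<lambda>x. a * (- s * exp (- s * complex_of_real x)) + b * (- t * exp (- t * complex_of_real x))) =
     (\<lambda>x. (- s * a) * exp (- s * complex_of_real x) + (- t * b) * exp (- t * complex_of_real x))" for a b
    by (auto simp: fun_eq_iff)
  have L: "(\<lambda>x. a * exp (- s * complex_of_real x) + b * exp (- t * complex_of_real x)) \<in> L2 {0..}" for a b
    by (rule L2_add[OF L2_exp_decay(1)[OF assms(1)] L2_exp_decay(1)[OF assms(2)]])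
  have sq: "- s * (- s * a) = s\<^sup>2 * a" "- t * (- t * b) = t\<^sup>2 * b" by (simp_all add: power2_eq_square)
  show ?thesis
    unfolding H2_data_def
    using p[of a b, unfolded e] p[of "- s * a" "- t * b", unfolded e sq] L by blast
qed

text \<open>
  The bound on the inverse, with the left half reflected to \<open>{0..}\<close>. In this form it is symmetric in the two
  half-lines, so spectral obstructions need to be examined on one side only.
\<close>

definition coupled_bound :: "complex \<Rightarrow> complex \<Rightarrow> complex \<Rightarrow> real \<Rightarrow> bool" where
  "coupled_bound \<alpha> kp km C \<longleftrightarrow>
    (\<forall>r r1 r2 s s1 s2. H2_data {0..} r r1 r2 \<and> H2_data {0..} s s1 s2 \<and> r 0 = s 0 \<and> r1 0 + s1 0 = \<alpha> * r 0 \<longrightarrow>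
       integral {0..} (\<lambda>x. (cmod (r x))\<^sup>2) + integral {0..} (\<lambda>x. (cmod (s x))\<^sup>2) \<le>
       C * (integral {0..} (\<lambda>x. (cmod (kp\<^sup>2 * r x - r2 x))\<^sup>2) + integral {0..} (\<lambda>x. (cmod (km\<^sup>2 * s x - s2 x))\<^sup>2)))"

lemma coupled_boundD:
  assumes "coupled_bound \<alpha> kp km C" "H2_data {0..} r r1 r2" "H2_data {0..} s s1 s2"
    "r 0 = s 0" "r1 0 + s1 0 = \<alpha> * r 0"
  shows "integral {0..} (\<lambda>x. (cmod (r x))\<^sup>2) + integral {0..} (\<lambda>x. (cmod (s x))\<^sup>2) \<le>
       C * (integral {0..} (\<lambda>x. (cmod (kp\<^sup>2 * r x - r2 x))\<^sup>2) + integral {0..} (\<lambda>x. (cmod (km\<^sup>2 * s x - s2 x))\<^sup>2))"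
  using assms(1)[unfolded coupled_bound_def, rule_format, of r r1 r2 s s1 s2] assms(2-5) by blast

lemma coupled_bound_swap:
  assumes "coupled_bound \<alpha> kp km C"
  shows "coupled_bound \<alpha> km kp C"
  unfolding coupled_bound_def
proof (intro allI impI, elim conjE)
  fix r r1 r2 s s1 s2
  assume r: "H2_data {0..} r r1 r2" and s: "H2_data {0..} s s1 s2" and 0: "r 0 = s 0" "r1 0 + s1 0 = \<alpha> * r 0"
  show "integral {0..} (\<lambda>x. (cmod (r x))\<^sup>2) + integral {0..} (\<lambda>x. (cmod (s x))\<^sup>2) \<le>
       C * (integral {0..} (\<lambda>x. (cmod (km\<^sup>2 * r x - r2 x))\<^sup>2) + integral {0..} (\<lambda>x. (cmod (kp\<^sup>2 * s x - s2 x))\<^sup>2))"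
    using coupled_boundD[OF assms s r] 0 by (simp add: add.commute)
qed

lemma half_line_sets:
  "{..0} \<in> sets (lebesgue::real measure)" "uminus ` {..0} \<in> sets (lebesgue::real measure)"
  "{0..} \<in> sets (lebesgue::real measure)" "uminus ` {0..} \<in> sets (lebesgue::real measure)"
  by (auto simp: uminus_image_half_lines)

lemma rho_L_coupled_bound:
  assumes z: "z \<in> rho_L Vp Vm \<alpha>" and k: "kp\<^sup>2 = Vp - z" "km\<^sup>2 = Vm - z"
  obtains C where "coupled_bound \<alpha> kp km C"
proof -
  obtain C where C: "\<And>u. u \<in> dom_L \<alpha> \<Longrightarrow> L2_norm u \<le> C * L2_norm (\<lambda>x. op_L Vp Vm u x - z * u x)"
    using z unfolding rho_L_def resolvent_set_def by blast
  have "coupled_bound \<alpha> kp km (C\<^sup>2)"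
    unfolding coupled_bound_def
  proof (intro allI impI, elim conjE)
    fix r r1 r2 s s1 s2
    assume r: "H2_data {0..} r r1 r2" and s: "H2_data {0..} s s1 s2" and 0: "r 0 = s 0" "r1 0 + s1 0 = \<alpha> * r 0"
    have l: "H2_data {..0} (\<lambda>x. s (- x)) (\<lambda>x. - s1 (- x)) (\<lambda>x. s2 (- x))"
      using H2_data_reflect[OF s half_line_sets(3,4)] by (simp add: uminus_image_half_lines)
    let ?u = "glue r (\<lambda>x. s (- x))"
    have u: "AE x in lebesgue. ?u x = ?u x" by simp
    have "?u \<in> dom_L \<alpha>" by (rule dom_L_I[OF r l _ _ u]) (use 0 in auto)
    from C[OF this] have "(L2_norm ?u)\<^sup>2 \<le> (C * L2_norm (\<lambda>x. op_L Vp Vm ?u x - z * ?u x))\<^sup>2"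
      using L2_norm_nonneg by (intro power_mono)
    moreover have "integral {..0} (\<lambda>x. (cmod (km\<^sup>2 * s (- x) - s2 (- x)))\<^sup>2) = integral {0..} (\<lambda>x. (cmod (km\<^sup>2 * s x - s2 x))\<^sup>2)"
      using L2_reflect(2)[OF _ half_line_sets(3,4), of "\<lambda>x. km\<^sup>2 * s x - s2 x"] s
      by (simp add: uminus_image_half_lines H2_data_def L2_diff L2_cmult)
    moreover have "integral {..0} (\<lambda>x. (cmod (s (- x)))\<^sup>2) = integral {0..} (\<lambda>x. (cmod (s x))\<^sup>2)"
      using L2_reflect(2)[OF _ half_line_sets(3,4), of s] s by (simp add: uminus_image_half_lines H2_data_def)
    ultimately show "integral {0..} (\<lambda>x. (cmod (r x))\<^sup>2) + integral {0..} (\<lambda>x. (cmod (s x))\<^sup>2) \<le>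
       C\<^sup>2 * (integral {0..} (\<lambda>x. (cmod (kp\<^sup>2 * r x - r2 x))\<^sup>2) + integral {0..} (\<lambda>x. (cmod (km\<^sup>2 * s x - s2 x))\<^sup>2))"
      using shifted_op_norm[OF r l u k] norm_AE_glue[OF _ _ u] r l
      by (simp add: power_mult_distrib H2_data_def)
  qed
  then show ?thesis by (rule that)
qed

lemma integral_nonneg_sq: "integral S (\<lambda>x::real. (cmod (f x))\<^sup>2) \<ge> 0"
  by (cases "(\<lambda>x. (cmod (f x))\<^sup>2) integrable_on S") (auto simp: integral_nonneg not_integrable_integral)

text \<open>
  If \<open>kp\<close> is imaginary then \<open>exp (- kp x)\<close> is a bounded non-decaying solution. Damping it by \<open>exp (- \<epsilon> x)\<close>
  gives a function of squared norm \<open>1 / (2 * \<epsilon>)\<close> whose residual stays bounded, also after it is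
  continued by two fixed decaying exponentials on the other side. As \<open>\<epsilon>\<close> tends to zero this violates every bound.
\<close>

lemma coupled_bound_Re_nonzero:
  assumes C: "coupled_bound \<alpha> kp km C"
  shows "Re kp \<noteq> 0"
proof
  assume kp: "Re kp = 0"
  define Q where "Q = 3 + cmod kp + cmod \<alpha>"
  \<comment> \<open>The residuals for \<open>\<epsilon> \<le> 1\<close>, with \<open>Q\<close> bounding the two coefficients on the other side.\<close>
  define N where "N = \<bar>C\<bar> * ((2 * cmod kp + 1)\<^sup>2 / 2 +
      (2 * ((cmod (km\<^sup>2 - 1) * Q)\<^sup>2 / 2) + 2 * ((cmod (km\<^sup>2 - 4) * Q)\<^sup>2 / 4)))"
  have N0: "N \<ge> 0" by (simp add: N_def)
  have main: "1 / (2 * \<epsilon>) \<le> N" if e: "\<epsilon> > 0" "\<epsilon> \<le> 1" for \<epsilon>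
  proof -
    define \<mu> where "\<mu> = kp + complex_of_real \<epsilon>"
    have Re\<mu>: "Re \<mu> = \<epsilon>" using kp by (simp add: \<mu>_def)
    have n\<mu>: "cmod \<mu> \<le> cmod kp + 1" unfolding \<mu>_def
      by (rule order_trans[OF norm_triangle_ineq]) (use e in simp)
    \<comment> \<open>\<open>A + B = 1\<close> and \<open>- \<mu> - A - 2 * B = \<alpha>\<close>: the other half matches the value and the jump at the origin.\<close>
    define A where "A = 2 + \<mu> + \<alpha>"
    define B where "B = - 1 - \<mu> - \<alpha>"
    have "cmod A \<le> 2 + cmod \<mu> + cmod \<alpha>" unfolding A_def
      using norm_triangle_ineq[of "2 + \<mu>" \<alpha>] norm_triangle_ineq[of 2 \<mu>] by simp
    then have nA: "cmod A \<le> Q" using n\<mu> by (simp add: Q_def)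
    have "cmod B \<le> 1 + cmod \<mu> + cmod \<alpha>" unfolding B_def
      using norm_triangle_ineq4[of "- 1 - \<mu>" \<alpha>] norm_triangle_ineq4[of "-1" \<mu>] by simp
    then have nB: "cmod B \<le> Q" using n\<mu> by (simp add: Q_def)
    let ?e = "\<lambda>s x. exp (- s * complex_of_real x)"
    have r: "H2_data {0..} (?e \<mu>) (\<lambda>x. - \<mu> * ?e \<mu> x) (\<lambda>x. \<mu>\<^sup>2 * ?e \<mu> x)"
      using H2_data_two_exponentials[of \<mu> \<mu> 1 0] Re\<mu> e by simp
    have s: "H2_data {0..} (\<lambda>x. A * ?e 1 x + B * ?e 2 x) (\<lambda>x. (- 1 * A) * ?e 1 x + (- 2 * B) * ?e 2 x)
        (\<lambda>x. (1\<^sup>2 * A) * ?e 1 x + (2\<^sup>2 * B) * ?e 2 x)"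
      by (rule H2_data_two_exponentials) auto
    have "integral {0..} (\<lambda>x. (cmod (?e \<mu> x))\<^sup>2) + integral {0..} (\<lambda>x. (cmod (A * ?e 1 x + B * ?e 2 x))\<^sup>2) \<le>
       C * (integral {0..} (\<lambda>x. (cmod (kp\<^sup>2 * ?e \<mu> x - \<mu>\<^sup>2 * ?e \<mu> x))\<^sup>2) +
            integral {0..} (\<lambda>x. (cmod (km\<^sup>2 * (A * ?e 1 x + B * ?e 2 x) - ((1\<^sup>2 * A) * ?e 1 x + (2\<^sup>2 * B) * ?e 2 x)))\<^sup>2))"
      (is "?I1 + ?I2 \<le> C * (?F + ?G)")
      by (rule coupled_boundD[OF C r s]) (auto simp: A_def B_def algebra_simps)
    moreover have "?I1 = 1 / (2 * \<epsilon>)"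
      using integral_unique[OF L2_exp_decay(2)[of \<mu> 1]] Re\<mu> e by simp
    moreover have "?I2 \<ge> 0" by (rule integral_nonneg_sq)
    moreover have "C * (?F + ?G) \<le> N"
    proof -
      have "?F = integral {0..} (\<lambda>x. (cmod ((kp\<^sup>2 - \<mu>\<^sup>2) * ?e \<mu> x))\<^sup>2)" by (simp add: left_diff_distrib)
      also have "\<dots> = (cmod (kp\<^sup>2 - \<mu>\<^sup>2))\<^sup>2 / (2 * \<epsilon>)"
        using integral_unique[OF L2_exp_decay(2)[of \<mu>]] Re\<mu> e by simp
      also have "kp\<^sup>2 - \<mu>\<^sup>2 = - complex_of_real \<epsilon> * (2 * kp + complex_of_real \<epsilon>)"
        by (simp add: \<mu>_def power2_eq_square algebra_simps)
      also have "(cmod \<dots>)\<^sup>2 / (2 * \<epsilon>) = \<epsilon> * ((cmod (2 * kp + complex_of_real \<epsilon>))\<^sup>2 / 2)"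
        using e by (simp add: norm_mult power_mult_distrib power2_eq_square)
      also have "\<dots> \<le> 1 * ((2 * cmod kp + 1)\<^sup>2 / 2)"
      proof (intro mult_mono divide_right_mono power_mono)
        show "cmod (2 * kp + complex_of_real \<epsilon>) \<le> 2 * cmod kp + 1"
          by (rule order_trans[OF norm_triangle_ineq]) (use e in \<open>simp add: norm_mult\<close>)
      qed (use e in auto)
      finally have F: "?F \<le> (2 * cmod kp + 1)\<^sup>2 / 2" by simp
      let ?a = "(km\<^sup>2 - 1) * A" and ?b = "(km\<^sup>2 - 4) * B"
      have hi: "((\<lambda>x. 2 * (cmod (?a * ?e 1 x))\<^sup>2 + 2 * (cmod (?b * ?e 2 x))\<^sup>2) has_integral
          2 * ((cmod ?a)\<^sup>2 / (2 * Re 1)) + 2 * ((cmod ?b)\<^sup>2 / (2 * Re 2))) {0..}"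
        by (intro has_integral_add has_integral_mult_right L2_exp_decay(2)) auto
      have ii: "(\<lambda>x. (cmod (?a * ?e 1 x + ?b * ?e 2 x))\<^sup>2) integrable_on {0..}"
        by (rule L2_sq_absolutely_integrable(2)[OF L2_add[OF L2_exp_decay(1) L2_exp_decay(1)]]) auto
      have le: "integral {0..} (\<lambda>x. (cmod (?a * ?e 1 x + ?b * ?e 2 x))\<^sup>2)
          \<le> 2 * ((cmod ?a)\<^sup>2 / (2 * Re 1)) + 2 * ((cmod ?b)\<^sup>2 / (2 * Re 2))"
        by (rule has_integral_le[OF integrable_integral[OF ii] hi]) (rule cmod_add_sq_le)
      have eq: "km\<^sup>2 * (A * ?e 1 x + B * ?e 2 x) - ((1\<^sup>2 * A) * ?e 1 x + (2\<^sup>2 * B) * ?e 2 x) = ?a * ?e 1 x + ?b * ?e 2 x" for x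
        by (simp add: algebra_simps power2_eq_square)
      have "?G \<le> 2 * ((cmod ?a)\<^sup>2 / 2) + 2 * ((cmod ?b)\<^sup>2 / 4)"
        unfolding eq using le by simp
      also have "\<dots> \<le> 2 * ((cmod (km\<^sup>2 - 1) * Q)\<^sup>2 / 2) + 2 * ((cmod (km\<^sup>2 - 4) * Q)\<^sup>2 / 4)"
        unfolding norm_mult by (intro add_mono mult_left_mono divide_right_mono power_mono nA nB) auto
      finally have G: "?G \<le> 2 * ((cmod (km\<^sup>2 - 1) * Q)\<^sup>2 / 2) + 2 * ((cmod (km\<^sup>2 - 4) * Q)\<^sup>2 / 4)" .
      have "C * (?F + ?G) \<le> \<bar>C\<bar> * (?F + ?G)" by (intro mult_right_mono add_nonneg_nonneg integral_nonneg_sq) auto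
      also have "\<dots> \<le> N" unfolding N_def by (intro mult_left_mono add_mono F G) auto
      finally show ?thesis .
    qed
    ultimately show ?thesis by linarith
  qed
  define \<epsilon> where "\<epsilon> = 1 / (2 * (N + 1))"
  have "\<epsilon> > 0" "\<epsilon> \<le> 1" using N0 by (auto simp: \<epsilon>_def field_simps)
  from main[OF this] show False using N0 by (simp add: \<epsilon>_def)
qed

text \<open>
  If \<open>kp + km + \<alpha> = 0\<close>, the decaying exponentials satisfy the interface condition and form an eigenfunction.
\<close>

lemma coupled_bound_sum_nonzero:
  assumes C: "coupled_bound \<alpha> kp km C" and k: "Re kp > 0" "Re km > 0"
  shows "kp + km + \<alpha> \<noteq> 0"
proof
  assume 0: "kp + km + \<alpha> = 0"
  let ?e = "\<lambda>s x. exp (- s * complex_of_real x)"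
  have d: "H2_data {0..} (?e s) (\<lambda>x. - s * ?e s x) (\<lambda>x. s\<^sup>2 * ?e s x)" if "Re s > 0" for s
    using H2_data_two_exponentials[of s s 1 0] that by simp
  have "integral {0..} (\<lambda>x. (cmod (?e kp x))\<^sup>2) + integral {0..} (\<lambda>x. (cmod (?e km x))\<^sup>2) \<le>
       C * (integral {0..} (\<lambda>x. (cmod (kp\<^sup>2 * ?e kp x - kp\<^sup>2 * ?e kp x))\<^sup>2) +
            integral {0..} (\<lambda>x. (cmod (km\<^sup>2 * ?e km x - km\<^sup>2 * ?e km x))\<^sup>2))"
  proof (rule coupled_boundD[OF C d[OF k(1)] d[OF k(2)]])
    have "- kp - km = \<alpha>" using 0 by algebra
    then show "- kp * ?e kp 0 + - km * ?e km 0 = \<alpha> * ?e kp 0" by simp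
  qed simp
  moreover have "integral {0..} (\<lambda>x. (cmod (?e kp x))\<^sup>2) = 1 / (2 * Re kp)"
    using integral_unique[OF L2_exp_decay(2)[OF k(1), of 1]] by simp
  moreover have "integral {0..} (\<lambda>x. (cmod (?e km x))\<^sup>2) \<ge> 0" by (rule integral_nonneg_sq)
  moreover have "1 / (2 * Re kp) > 0" using k by simp
  ultimately show False by simp
qed

lemma wave_k_square: "(wave_k V z)\<^sup>2 = V - z"
  by (simp add: wave_k_def)

lemma rho_L_D:
  assumes "z \<in> rho_L Vp Vm \<alpha>"
  shows "Re (wave_k Vp z) > 0" "Re (wave_k Vm z) > 0" "wave_k Vp z + wave_k Vm z + \<alpha> \<noteq> 0"
proof -
  obtain C where C: "coupled_bound \<alpha> (wave_k Vp z) (wave_k Vm z) C"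
    using rho_L_coupled_bound[OF assms wave_k_square wave_k_square] .
  have "Re (wave_k Vp z) \<ge> 0" "Re (wave_k Vm z) \<ge> 0"
    using csqrt_principal[of "Vp - z"] csqrt_principal[of "Vm - z"] by (auto simp: wave_k_def)
  then show k: "Re (wave_k Vp z) > 0" "Re (wave_k Vm z) > 0"
    using coupled_bound_Re_nonzero[OF C] coupled_bound_Re_nonzero[OF coupled_bound_swap[OF C]] by auto
  show "wave_k Vp z + wave_k Vm z + \<alpha> \<noteq> 0"
    by (rule coupled_bound_sum_nonzero[OF C k])
qed

section \<open>The pseudomodes\<close>

definition Psi_right :: "complex \<Rightarrow> complex \<Rightarrow> complex \<Rightarrow> complex \<Rightarrow> real \<Rightarrow> complex" where
  "Psi_right Vp Vm \<alpha> z x = p1 Vp Vm \<alpha> z * exp (- wave_k Vp z * complex_of_real x)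
     + p2 Vm z * exp (- cnj (wave_k Vp z) * complex_of_real x)"

text \<open>
  The left half of the pseudomode, reflected to the positive half-line.
\<close>

definition Psi_left :: "complex \<Rightarrow> complex \<Rightarrow> complex \<Rightarrow> complex \<Rightarrow> real \<Rightarrow> complex" where
  "Psi_left Vp Vm \<alpha> z x = n1 Vp Vm \<alpha> z * exp (- wave_k Vm z * complex_of_real x)
     + n2 Vp z * exp (- cnj (wave_k Vm z) * complex_of_real x)"

lemma Psi_AE_glue:
  "AE x in lebesgue. Psi Vp Vm \<alpha> z x = glue (Psi_right Vp Vm \<alpha> z) (\<lambda>x. Psi_left Vp Vm \<alpha> z (- x)) x"
  using AE_nonzero
  by eventually_elim (auto simp: Psi_def glue_def Psi_right_def Psi_left_def indicator_def)

text \<open>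
  The coefficients \<open>n1\<close> and \<open>p1\<close> solve the linear system given by continuity and by the jump condition. The
  exponentials with exponents \<open>k\<close> and \<open>m\<close> are annihilated by the shifted operator, while those with
  conjugate exponents are multiplied by \<open>k\<^sup>2 - (cnj k)\<^sup>2 = 2 \<i> Im (k\<^sup>2)\<close>, which makes the norm of the residual explicit.
\<close>

lemma Psi_dom_and_residual:
  assumes kp: "Re (wave_k Vp z) > 0" and km: "Re (wave_k Vm z) > 0"
    and D: "wave_k Vp z + wave_k Vm z + \<alpha> \<noteq> 0"
  shows "Psi Vp Vm \<alpha> z \<in> dom_L \<alpha>"
    "(L2_norm (\<lambda>x. op_L Vp Vm (Psi Vp Vm \<alpha> z) x - z * Psi Vp Vm \<alpha> z x))\<^sup>2 =
       4 * (\<bar>Im Vp - Im z\<bar> * \<bar>Im Vm - Im z\<bar>)\<^sup>2 * (1 / (2 * Re (wave_k Vp z)) + 1 / (2 * Re (wave_k Vm z)))"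
    "(L2_norm (Psi Vp Vm \<alpha> z))\<^sup>2 = integral {0..} (\<lambda>x. (cmod (Psi_right Vp Vm \<alpha> z x))\<^sup>2)
       + integral {0..} (\<lambda>x. (cmod (Psi_left Vp Vm \<alpha> z x))\<^sup>2)"
proof -
  define k m where "k = wave_k Vp z" and "m = wave_k Vm z"
  define a b where "a = complex_of_real \<bar>Im Vp - Im z\<bar>" and "b = complex_of_real \<bar>Im Vm - Im z\<bar>"
  define N1 P1 where "N1 = n1 Vp Vm \<alpha> z" and "P1 = p1 Vp Vm \<alpha> z"
  have n2: "n2 Vp z = - a" and p2: "p2 Vm z = b" by (simp_all add: n2_def p2_def a_def b_def)
  have k2: "k\<^sup>2 = Vp - z" and m2: "m\<^sup>2 = Vm - z" by (simp_all add: k_def m_def wave_k_square)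
  have kp': "Re k > 0" "Re (cnj k) > 0" and km': "Re m > 0" "Re (cnj m) > 0"
    using kp km by (auto simp: k_def m_def)
  have D': "k + m + \<alpha> \<noteq> 0" using D by (simp add: k_def m_def)
  have N1: "(k + m + \<alpha>) * N1 = (k + cnj m + \<alpha>) * a + (k - cnj k) * b"
  proof -
    have "d * (x / d * a + y / d * b) = x * a + y * b" if "d \<noteq> 0" for d x y :: complex
      using that by (simp add: distrib_left)
    from this[OF D'] show ?thesis unfolding N1_def n1_def k_def m_def a_def b_def .
  qed
  have P1: "(k + m + \<alpha>) * P1 = - (m - cnj m) * a - (cnj k + m + \<alpha>) * b"
  proof -
    have "d * (- (x / d) * a - y / d * b) = - x * a - y * b" if "d \<noteq> 0" for d x y :: complex
      using that by (simp add: right_diff_distrib)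
    from this[OF D'] show ?thesis unfolding P1_def p1_def k_def m_def a_def b_def .
  qed
  have "(k + m + \<alpha>) * (P1 + b) = (k + m + \<alpha>) * (N1 - a)"
    using N1 P1 by algebra
  then have match: "P1 + b = N1 - a" using D' by simp
  have "(k + m + \<alpha>) * ((- k * P1 - cnj k * b) + (- m * N1 + cnj m * a)) = (k + m + \<alpha>) * (\<alpha> * (P1 + b))"
    using N1 P1 by algebra
  then have jump: "(- k * P1 - cnj k * b) + (- m * N1 + cnj m * a) = \<alpha> * (P1 + b)" using D' by simp
  note r = H2_data_two_exponentials[OF kp', of P1 b]
  note s = H2_data_two_exponentials[OF km', of N1 "- a"]
  define R where "R = (\<lambda>x. P1 * exp (- k * complex_of_real x) + b * exp (- cnj k * complex_of_real x))"
  define S where "S = (\<lambda>x. N1 * exp (- m * complex_of_real x) + - a * exp (- cnj m * complex_of_real x))"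
  have RS: "Psi_right Vp Vm \<alpha> z = R" "Psi_left Vp Vm \<alpha> z = S"
    by (auto simp: fun_eq_iff R_def S_def Psi_right_def Psi_left_def n2 p2 P1_def N1_def simp flip: k_def m_def)
  have l: "H2_data {..0} (\<lambda>x. S (- x))
     (\<lambda>x. - ((- m * N1) * exp (- m * complex_of_real (- x)) + (- cnj m * - a) * exp (- cnj m * complex_of_real (- x))))
     (\<lambda>x. (m\<^sup>2 * N1) * exp (- m * complex_of_real (- x)) + ((cnj m)\<^sup>2 * - a) * exp (- cnj m * complex_of_real (- x)))"
    using H2_data_reflect[OF s half_line_sets(3,4)] by (simp only: uminus_image_half_lines S_def)
  note u = Psi_AE_glue[of Vp Vm \<alpha> z, unfolded RS]
  note r' = r[folded R_def]
  show "Psi Vp Vm \<alpha> z \<in> dom_L \<alpha>"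
    by (rule dom_L_I[OF r' l _ _ u]) (use match jump in \<open>auto simp: R_def S_def algebra_simps\<close>)
  have RL: "R \<in> L2 {0..}" and SL: "S \<in> L2 {0..}" "(\<lambda>x. S (- x)) \<in> L2 {..0}"
    using r' s[folded S_def] l by (auto simp: H2_data_def)
  show "(L2_norm (Psi Vp Vm \<alpha> z))\<^sup>2 = integral {0..} (\<lambda>x. (cmod (Psi_right Vp Vm \<alpha> z x))\<^sup>2)
       + integral {0..} (\<lambda>x. (cmod (Psi_left Vp Vm \<alpha> z x))\<^sup>2)"
    using norm_AE_glue[OF RL SL(2) u] L2_reflect(2)[OF SL(1) half_line_sets(3,4)]
    by (simp add: RS uminus_image_half_lines)
  have diff: "w\<^sup>2 - (cnj w)\<^sup>2 = 2 * \<i> * complex_of_real (Im (w\<^sup>2))" for w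
    by (simp add: complex_eq_iff power2_eq_square)
  have nrm: "cmod (2 * \<i> * complex_of_real (Im c) * d) = 2 * (\<bar>Im c\<bar> * cmod d)" for c d
    by (simp add: norm_mult)
  have 1: "integral {0..} (\<lambda>x. (cmod (k\<^sup>2 * R x - ((k\<^sup>2 * P1) * exp (- k * complex_of_real x) + ((cnj k)\<^sup>2 * b) * exp (- cnj k * complex_of_real x))))\<^sup>2)
       = (2 * (\<bar>Im Vp - Im z\<bar> * \<bar>Im Vm - Im z\<bar>))\<^sup>2 / (2 * Re k)"
  proof -
    have e: "k\<^sup>2 * R x - ((k\<^sup>2 * P1) * exp (- k * complex_of_real x) + ((cnj k)\<^sup>2 * b) * exp (- cnj k * complex_of_real x))
       = ((k\<^sup>2 - (cnj k)\<^sup>2) * b) * exp (- cnj k * complex_of_real x)" for x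
      by (simp add: R_def algebra_simps)
    have "cmod ((k\<^sup>2 - (cnj k)\<^sup>2) * b) = 2 * (\<bar>Im Vp - Im z\<bar> * \<bar>Im Vm - Im z\<bar>)"
      unfolding diff nrm by (simp add: k2 b_def)
    then show ?thesis
      unfolding e using integral_unique[OF L2_exp_decay(2)[OF kp'(2)]] by simp
  qed
  have 2: "integral {..0} (\<lambda>x. (cmod (m\<^sup>2 * S (- x) - ((m\<^sup>2 * N1) * exp (- m * complex_of_real (- x)) + ((cnj m)\<^sup>2 * - a) * exp (- cnj m * complex_of_real (- x)))))\<^sup>2)
       = (2 * (\<bar>Im Vm - Im z\<bar> * \<bar>Im Vp - Im z\<bar>))\<^sup>2 / (2 * Re m)"
  proof -
    have e: "m\<^sup>2 * S x - ((m\<^sup>2 * N1) * exp (- m * complex_of_real x) + ((cnj m)\<^sup>2 * - a) * exp (- cnj m * complex_of_real x))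
       = ((m\<^sup>2 - (cnj m)\<^sup>2) * - a) * exp (- cnj m * complex_of_real x)" for x
      by (simp add: S_def algebra_simps)
    have "cmod ((m\<^sup>2 - (cnj m)\<^sup>2) * - a) = 2 * (\<bar>Im Vm - Im z\<bar> * \<bar>Im Vp - Im z\<bar>)"
      unfolding diff nrm by (simp add: m2 a_def)
    then have "integral {0..} (\<lambda>x. (cmod (((m\<^sup>2 - (cnj m)\<^sup>2) * - a) * exp (- cnj m * complex_of_real x)))\<^sup>2)
        = (2 * (\<bar>Im Vm - Im z\<bar> * \<bar>Im Vp - Im z\<bar>))\<^sup>2 / (2 * Re m)"
      using integral_unique[OF L2_exp_decay(2)[OF km'(2)]] by simp
    then show ?thesis
      unfolding e using L2_reflect(2)[OF L2_exp_decay(1)[OF km'(2)] half_line_sets(3,4)]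
      by (simp only: uminus_image_half_lines)
  qed
  have "(L2_norm (\<lambda>x. op_L Vp Vm (Psi Vp Vm \<alpha> z) x - z * Psi Vp Vm \<alpha> z x))\<^sup>2 =
     (2 * (\<bar>Im Vp - Im z\<bar> * \<bar>Im Vm - Im z\<bar>))\<^sup>2 / (2 * Re k) + (2 * (\<bar>Im Vm - Im z\<bar> * \<bar>Im Vp - Im z\<bar>))\<^sup>2 / (2 * Re m)"
    unfolding shifted_op_norm[OF r' l u k2 m2] 1 2 ..
  moreover have "(2 * t)\<^sup>2 / (2 * u) + (2 * t)\<^sup>2 / (2 * v) = 4 * t\<^sup>2 * (1 / (2 * u) + 1 / (2 * v))" for t u v :: real
    by (simp add: power_mult_distrib distrib_left)
  ultimately show "(L2_norm (\<lambda>x. op_L Vp Vm (Psi Vp Vm \<alpha> z) x - z * Psi Vp Vm \<alpha> z x))\<^sup>2 =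
       4 * (\<bar>Im Vp - Im z\<bar> * \<bar>Im Vm - Im z\<bar>)\<^sup>2 * (1 / (2 * Re (wave_k Vp z)) + 1 / (2 * Re (wave_k Vm z)))"
    unfolding k_def m_def by (simp only: mult.commute[of "\<bar>Im Vm - Im z\<bar>" "\<bar>Im Vp - Im z\<bar>"])
qed

text \<open>
  Both exponentials have modulus \<open>exp (- Re k * x)\<close>, so the modulus of the sum lies pointwise between
  \<open>(R - C) * exp (- Re k * x)\<close> and \<open>(R + C) * exp (- Re k * x)\<close>.
\<close>

lemma two_exponentials_norm_bounds:
  assumes k: "Re k > 0" and R: "\<bar>cmod c - R\<bar> + cmod d \<le> C" "C \<le> R"
  shows "(R - C)\<^sup>2 / (2 * Re k) \<le> integral {0..} (\<lambda>x. (cmod (c * exp (- k * complex_of_real x) + d * exp (- cnj k * complex_of_real x)))\<^sup>2)"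
    "integral {0..} (\<lambda>x. (cmod (c * exp (- k * complex_of_real x) + d * exp (- cnj k * complex_of_real x)))\<^sup>2) \<le> (R + C)\<^sup>2 / (2 * Re k)"
proof -
  let ?f = "\<lambda>x. c * exp (- k * complex_of_real x) + d * exp (- cnj k * complex_of_real x)"
  have k': "Re (cnj k) > 0" using k by simp
  have i: "(\<lambda>x. (cmod (?f x))\<^sup>2) integrable_on {0..}"
    by (rule L2_sq_absolutely_integrable(2)[OF L2_add[OF L2_exp_decay(1)[OF k] L2_exp_decay(1)[OF k']]]) auto
  have e: "((\<lambda>x. (cmod (complex_of_real t * exp (- k * complex_of_real x)))\<^sup>2) has_integral t\<^sup>2 / (2 * Re k)) {0..}" for t
    using L2_exp_decay(2)[OF k, of "complex_of_real t"] by simp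
  have C0: "C \<ge> 0" using R(1) by (smt (verit) norm_ge_zero)
  have b: "(R - C) * exp (- Re k * x) \<le> cmod (?f x)" "cmod (?f x) \<le> (R + C) * exp (- Re k * x)" for x
  proof -
    define w where "w = exp (- Re k * x)"
    have w: "w > 0" by (simp add: w_def)
    have n: "cmod (c * exp (- k * complex_of_real x)) = cmod c * w" "cmod (d * exp (- cnj k * complex_of_real x)) = cmod d * w"
      by (simp_all add: norm_mult w_def)
    have "cmod (?f x) \<le> (cmod c + cmod d) * w"
      using norm_triangle_ineq[of "c * exp (- k * complex_of_real x)" "d * exp (- cnj k * complex_of_real x)"]
      unfolding n by (simp add: distrib_right)
    also have "\<dots> \<le> (R + C) * w" using R(1) w by (intro mult_right_mono) auto
    finally show "cmod (?f x) \<le> (R + C) * exp (- Re k * x)" by (simp add: w_def)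
    have "(R - C) * w \<le> (cmod c - cmod d) * w" using R(1) w by (intro mult_right_mono) auto
    also have "\<dots> \<le> cmod (?f x)"
      using norm_diff_ineq[of "c * exp (- k * complex_of_real x)" "d * exp (- cnj k * complex_of_real x)"]
      unfolding n by (simp add: left_diff_distrib)
    finally show "(R - C) * exp (- Re k * x) \<le> cmod (?f x)" by (simp add: w_def)
  qed
  have c: "cmod (complex_of_real t * exp (- k * complex_of_real x)) = t * exp (- Re k * x)" if "t \<ge> 0" for t x
    using that by (simp add: norm_mult)
  show "(R - C)\<^sup>2 / (2 * Re k) \<le> integral {0..} (\<lambda>x. (cmod (?f x))\<^sup>2)"
    by (rule has_integral_le[OF e integrable_integral[OF i]])
      (use R b c[of "R - C"] in \<open>auto intro!: power_mono\<close>)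
  show "integral {0..} (\<lambda>x. (cmod (?f x))\<^sup>2) \<le> (R + C)\<^sup>2 / (2 * Re k)"
    by (rule has_integral_le[OF integrable_integral[OF i] e])
      (use R C0 b c[of "R + C"] in \<open>auto intro!: power_mono\<close>)
qed

text \<open>
  The imaginary part of \<open>k = csqrt w\<close> has the sign of \<open>Im w\<close>. For \<open>q = \<plusminus> \<i> r\<close> with that sign there is no cancellation
  in \<open>k + q\<close>, so \<open>\<bar>k + q\<bar> \<ge> r\<close> and \<open>(k - q) (k + q) = w + r\<^sup>2\<close> gives the bound.
\<close>

lemma csqrt_asymptotics:
  assumes "Im w \<noteq> 0" "r > 0" "cmod (w + (complex_of_real r)\<^sup>2) \<le> B"
  shows "Re (csqrt w) > 0" "cmod (csqrt w - complex_of_real (sgn (Im w)) * \<i> * complex_of_real r) \<le> B / r"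
proof -
  define k where "k = csqrt w"
  have k2: "k\<^sup>2 = w" by (simp add: k_def)
  have "Re k \<ge> 0" using csqrt_principal[of w] by (auto simp: k_def)
  have im: "2 * (Re k * Im k) = Im w" using k2 by (auto simp: power2_eq_square complex_eq_iff mult.commute)
  then show Re: "Re (csqrt w) > 0" using \<open>Re k \<ge> 0\<close> assms(1) by (auto simp: k_def less_le)
  define s where "s = sgn (Im w)"
  have s: "s = 1 \<or> s = -1" using assms(1) by (auto simp: s_def sgn_if)
  have sIm: "s * Im k \<ge> 0"
  proof -
    have "s * Im w \<ge> 0" by (auto simp: s_def sgn_if)
    moreover have "s * Im k = s * Im w / (2 * Re k)" using im Re by (simp add: k_def field_simps)
    ultimately show ?thesis using Re by (simp add: k_def)
  qed
  define q where "q = complex_of_real s * \<i> * complex_of_real r"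
  have s2: "(complex_of_real s)\<^sup>2 = 1" using s by auto
  have "(k - q) * (k + q) = k\<^sup>2 - q\<^sup>2" by (simp add: algebra_simps power2_eq_square)
  also have "q\<^sup>2 = - (complex_of_real r)\<^sup>2" unfolding q_def power_mult_distrib s2 by simp
  finally have "cmod (k - q) * cmod (k + q) \<le> B" using assms(3) k2 by (simp flip: norm_mult)
  moreover have "cmod (k + q) \<ge> r"
  proof -
    have "r \<le> \<bar>s * Im k + r\<bar>" using sIm assms(2) by simp
    also have "\<bar>s * Im k + r\<bar> = \<bar>Im (k + q)\<bar>" using s by (auto simp: q_def)
    also have "\<dots> \<le> cmod (k + q)" by (rule abs_Im_le_cmod)
    finally show ?thesis .
  qed
  ultimately have "cmod (k - q) * r \<le> B"
    by (smt (verit) mult_left_mono norm_ge_zero)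
  then have "cmod (k - q) \<le> B / r" using assms(2) by (simp add: field_simps)
  then show "cmod (csqrt w - complex_of_real (sgn (Im w)) * \<i> * complex_of_real r) \<le> B / r"
    by (simp add: k_def q_def s_def)
qed

text \<open>
  Solving \<open>D c = q + X\<close> with \<open>D\<close> close to \<open>\<alpha>\<close>: the large term \<open>q\<close> is of size \<open>r\<close>, but \<open>D - \<alpha>\<close> is of size \<open>1 / r\<close>, so replacing
  \<open>D\<close> by \<open>\<alpha>\<close> in the denominator costs only a bounded amount.
\<close>

lemma coefficient_bound:
  fixes D X c q \<alpha> :: complex and r L B :: real
  assumes D: "cmod (D - \<alpha>) \<le> 2 * B / r" "cmod D \<ge> cmod \<alpha> / 2" and \<alpha>: "\<alpha> \<noteq> 0" and r: "r > 0" and L: "L \<ge> 0"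
    and c: "D * c = q + X" and q: "cmod q = 2 * r * L" and X: "cmod X \<le> K"
  shows "\<bar>cmod c - 2 * r * L / cmod \<alpha>\<bar> \<le> 2 * K / cmod \<alpha> + 8 * B * L / (cmod \<alpha>)\<^sup>2"
proof -
  have a: "cmod \<alpha> > 0" using \<alpha> by simp
  have d: "cmod D > 0" using D(2) a by linarith
  have K: "K \<ge> 0" using X norm_ge_zero order_trans by blast
  have "\<bar>cmod D * cmod c - 2 * r * L\<bar> \<le> K"
  proof -
    have "cmod D * cmod c = cmod (q + X)" using c by (simp flip: norm_mult)
    then show ?thesis using norm_triangle_ineq3[of "q + X" q] X by (simp add: q)
  qed
  moreover have "cmod D * cmod c - 2 * r * L = cmod D * (cmod c - 2 * r * L / cmod D)" using d by (simp add: field_simps)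
  ultimately have "cmod D * \<bar>cmod c - 2 * r * L / cmod D\<bar> \<le> K" using d by (simp add: abs_mult)
  then have "\<bar>cmod c - 2 * r * L / cmod D\<bar> \<le> K / cmod D" using d by (simp add: field_simps)
  also have "\<dots> \<le> K / (cmod \<alpha> / 2)" by (rule divide_left_mono) (use D(2) a d K in auto)
  finally have 1: "\<bar>cmod c - 2 * r * L / cmod D\<bar> \<le> 2 * K / cmod \<alpha>" by (simp add: mult.commute)
  have "2 * r * L / cmod D - 2 * r * L / cmod \<alpha> = 2 * r * L * (cmod \<alpha> - cmod D) / (cmod D * cmod \<alpha>)"
    using a d by (simp add: field_simps)
  also have "\<bar>\<dots>\<bar> = 2 * r * L * \<bar>cmod \<alpha> - cmod D\<bar> / (cmod D * cmod \<alpha>)"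
    using r L by (simp add: abs_mult)
  also have "\<dots> \<le> 2 * r * L * (2 * B / r) / (cmod \<alpha> / 2 * cmod \<alpha>)"
  proof (intro frac_le mult_left_mono mult_right_mono)
    show "\<bar>cmod \<alpha> - cmod D\<bar> \<le> 2 * B / r"
      using norm_triangle_ineq3[of \<alpha> D] D(1) by (simp add: norm_minus_commute)
    show "0 \<le> 2 * r * L * (2 * B / r)"
      using r L D(1) norm_ge_zero[of "D - \<alpha>"] by (intro mult_nonneg_nonneg) linarith+
  qed (use a D(2) r L in auto)
  also have "\<dots> = 8 * B * L / (cmod \<alpha>)\<^sup>2" using a r by (simp add: field_simps power2_eq_square)
  finally have 2: "\<bar>2 * r * L / cmod D - 2 * r * L / cmod \<alpha>\<bar> \<le> 8 * B * L / (cmod \<alpha>)\<^sup>2" .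
  have "\<bar>x - z\<bar> \<le> s + t" if "\<bar>x - y\<bar> \<le> s" "\<bar>y - z\<bar> \<le> t" for x y z s t :: real
    using that by linarith
  from this[OF 1 2] show ?thesis .
qed


lemma open_segment_real_cases:
  fixes x y t :: real
  assumes "t \<in> open_segment x y"
  shows "x \<noteq> t" "y \<noteq> t" "sgn (x - t) = - sgn (y - t)" "\<bar>x - t\<bar> + \<bar>y - t\<bar> = \<bar>x - y\<bar>"
    "\<bar>t\<bar> \<le> \<bar>x\<bar> + \<bar>y\<bar>"
proof -
  have "x < t \<and> t < y \<or> y < t \<and> t < x"
    using assms by (auto simp: open_segment_eq_real_ivl split: if_splits)
  then show "x \<noteq> t" "y \<noteq> t" "sgn (x - t) = - sgn (y - t)" "\<bar>x - t\<bar> + \<bar>y - t\<bar> = \<bar>x - y\<bar>"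
    "\<bar>t\<bar> \<le> \<bar>x\<bar> + \<bar>y\<bar>"
    by (auto simp: sgn_if)
qed

text \<open>
  With \<open>q = \<plusminus> \<i> r\<close> one has \<open>k = q + O(1 / r)\<close> and \<open>m = - q + O(1 / r)\<close>, the signs being opposite because \<open>Im z\<close> lies strictly
  between \<open>Im Vp\<close> and \<open>Im Vm\<close>. Thus \<open>k + m + \<alpha>\<close> is close to \<open>\<alpha>\<close>, and \<open>n1\<close> and \<open>p1\<close> both have modulus
  \<open>R = 2 r L / \<bar>\<alpha>\<bar>\<close> up to a bounded error. The common factor \<open>sqrt S\<close>, which carries the delicate quantities \<open>Re k\<close>
  and \<open>Re m\<close>, cancels in the quotient of the norms, and the normalised quotient is \<open>R / \<rho>\<close> with \<open>\<bar>R - \<rho>\<bar> \<le> C\<close>.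
\<close>

lemma pseudomode_asymptotics:
  fixes Vp Vm \<alpha> z :: complex
  defines "r \<equiv> sqrt (Re z)" and "L \<equiv> \<bar>Im Vp - Im Vm\<bar>" and "B \<equiv> 2 * (cmod Vp + cmod Vm)"
  defines "C \<equiv> 2 * ((2 * B + cmod \<alpha>) * L) / cmod \<alpha> + 8 * B * L / (cmod \<alpha>)\<^sup>2 + L"
  assumes V: "Im Vp \<noteq> Im Vm" and \<alpha>: "\<alpha> \<noteq> 0" and z: "Im z \<in> open_segment (Im Vp) (Im Vm)"
    and r1: "r \<ge> 1" and rB: "r \<ge> 4 * B / cmod \<alpha>" and rC: "r \<ge> C * cmod \<alpha> / L"
  shows "z \<in> rho_L Vp Vm \<alpha>"
    "\<bar>(L2_norm (\<lambda>x. op_L Vp Vm (Psi Vp Vm \<alpha> z) x - z * Psi Vp Vm \<alpha> z x)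
           / L2_norm (Psi Vp Vm \<alpha> z))
         / (cmod \<alpha> / L * (\<bar>Im Vp - Im z\<bar> * \<bar>Im Vm - Im z\<bar> / r)) - 1\<bar> \<le> (C * cmod \<alpha> / L) / r"
proof -
  define k m where "k = wave_k Vp z" and "m = wave_k Vm z"
  define a b where "a = \<bar>Im Vp - Im z\<bar>" and "b = \<bar>Im Vm - Im z\<bar>"
  note seg = open_segment_real_cases[OF z]
  have ab: "a > 0" "b > 0" "a + b = L" using seg by (auto simp: a_def b_def L_def)
  have L: "L > 0" using V by (simp add: L_def)
  have A: "cmod \<alpha> > 0" using \<alpha> by simp
  have r: "r > 0" using r1 by simp
  have r2: "(complex_of_real r)\<^sup>2 = complex_of_real (Re z)"
  proof -
    have "Re z \<ge> 0" using r by (simp add: r_def real_sqrt_gt_zero)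
    then show ?thesis by (simp add: r_def flip: of_real_power)
  qed
  have B0: "B \<ge> 0" by (simp add: B_def)
  have VB: "cmod (V - z + (complex_of_real r)\<^sup>2) \<le> B" if "V = Vp \<or> V = Vm" for V
  proof -
    have "V - z + (complex_of_real r)\<^sup>2 = V - \<i> * complex_of_real (Im z)"
      unfolding r2 by (simp add: complex_eq_iff)
    then have "cmod (V - z + (complex_of_real r)\<^sup>2) = cmod (V - \<i> * complex_of_real (Im z))" by (rule arg_cong)
    also have "\<dots> \<le> cmod V + \<bar>Im z\<bar>"
      using norm_triangle_ineq4[of V "\<i> * complex_of_real (Im z)"] by (simp add: norm_mult)
    also have "\<dots> \<le> B"
      using seg(5) abs_Im_le_cmod[of Vp] abs_Im_le_cmod[of Vm] norm_ge_zero[of Vp] norm_ge_zero[of Vm] that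
      unfolding B_def by auto
    finally show ?thesis .
  qed
  define \<sigma> where "\<sigma> = sgn (Im Vp - Im z)"
  define q where "q = complex_of_real \<sigma> * \<i> * complex_of_real r"
  have \<sigma>: "\<bar>\<sigma>\<bar> = 1" using seg(1) by (auto simp: \<sigma>_def sgn_if)
  have nq: "cmod q = r" using \<sigma> r by (simp add: q_def norm_mult)
  have cq: "cnj q = - q" by (simp add: q_def)
  define e f where "e = k - q" and "f = m + q"
  have kp: "Re k > 0" and ke: "cmod e \<le> B / r"
    using csqrt_asymptotics[OF _ r VB, of Vp] seg(1) by (auto simp: k_def wave_k_def \<sigma>_def q_def e_def)
  have km: "Re m > 0" and me: "cmod f \<le> B / r"
    using csqrt_asymptotics[OF _ r VB, of Vm] seg(2,3) by (auto simp: m_def wave_k_def \<sigma>_def q_def f_def)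
  have km_eq: "k = q + e" "m = - q + f" by (simp_all add: e_def f_def)
  have "B / r \<le> B" using r1 B0 by (simp add: divide_le_eq mult_le_cancel_left1)
  then have eB: "cmod e \<le> B" "cmod f \<le> B" using ke me by linarith+
  define D where "D = k + m + \<alpha>"
  have DA: "cmod (D - \<alpha>) \<le> 2 * B / r"
    using norm_triangle_ineq[of e f] ke me by (simp add: D_def km_eq)
  also have "\<dots> \<le> cmod \<alpha> / 2" using rB r A by (simp add: field_simps)
  finally have "cmod (D - \<alpha>) \<le> cmod \<alpha> / 2" .
  then have DA2: "cmod D \<ge> cmod \<alpha> / 2"
    using norm_triangle_ineq2[of \<alpha> D] by (simp add: norm_minus_commute)
  then have D0: "k + m + \<alpha> \<noteq> 0" using A by (auto simp: D_def)
  show "z \<in> rho_L Vp Vm \<alpha>"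
    by (rule rho_L_I[OF _ _ kp km D0]) (simp_all add: k_def m_def wave_k_square)
  define N1 P1 where "N1 = n1 Vp Vm \<alpha> z" and "P1 = p1 Vp Vm \<alpha> z"
  define X where "X = (e + cnj f + \<alpha>) * complex_of_real a + (e - cnj e) * complex_of_real b"
  define Y where "Y = - ((f - cnj f) * complex_of_real a) - (cnj e + f + \<alpha>) * complex_of_real b"
  have aux: "d * (x / d * s + y / d * t) = x * s + y * t" "d * (- (x / d) * s - y / d * t) = - x * s - y * t"
    if "d \<noteq> 0" for d x y s t :: complex
    using that by (simp_all add: distrib_left right_diff_distrib)
  have "D * N1 = (k + cnj m + \<alpha>) * complex_of_real a + (k - cnj k) * complex_of_real b"
    unfolding N1_def n1_def D_def k_def m_def a_def b_def by (rule aux(1)) (use D0 in \<open>simp add: k_def m_def\<close>)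
  also have "\<dots> = 2 * q * complex_of_real (a + b) + X"
    unfolding km_eq X_def by (simp add: cq algebra_simps)
  finally have N1: "D * N1 = 2 * q * complex_of_real L + X" by (simp add: ab)
  have "D * P1 = - (m - cnj m) * complex_of_real a - (cnj k + m + \<alpha>) * complex_of_real b"
    unfolding P1_def p1_def D_def k_def m_def a_def b_def by (rule aux(2)) (use D0 in \<open>simp add: k_def m_def\<close>)
  also have "\<dots> = 2 * q * complex_of_real (a + b) + Y"
    unfolding km_eq Y_def by (simp add: cq algebra_simps)
  finally have P1: "D * P1 = 2 * q * complex_of_real L + Y" by (simp add: ab)
  have q2: "cmod (2 * q * complex_of_real L) = 2 * r * L" using L by (simp add: norm_mult nq)
  have sum3: "cmod (x + y + \<alpha>) \<le> 2 * B + cmod \<alpha>" if "cmod x \<le> B" "cmod y \<le> B" for x y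
    using norm_triangle_ineq[of "x + y" \<alpha>] norm_triangle_ineq[of x y] that by linarith
  have dif2: "cmod (x - y) \<le> 2 * B + cmod \<alpha>" if "cmod x \<le> B" "cmod y \<le> B" for x y
    using norm_triangle_ineq4[of x y] that norm_ge_zero[of \<alpha>] by linarith
  have comb: "cmod x * a + cmod y * b \<le> (2 * B + cmod \<alpha>) * L"
    if "cmod x \<le> 2 * B + cmod \<alpha>" "cmod y \<le> 2 * B + cmod \<alpha>" for x y :: complex
  proof -
    have "cmod x * a + cmod y * b \<le> (2 * B + cmod \<alpha>) * a + (2 * B + cmod \<alpha>) * b"
      using that ab by (intro add_mono mult_right_mono) auto
    then show ?thesis by (simp add: ab(3)[symmetric] distrib_left)
  qed
  have X: "cmod X \<le> (2 * B + cmod \<alpha>) * L"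
  proof -
    have "cmod X \<le> cmod (e + cnj f + \<alpha>) * a + cmod (e - cnj e) * b"
      using norm_triangle_ineq[of "(e + cnj f + \<alpha>) * complex_of_real a" "(e - cnj e) * complex_of_real b"] ab
      by (simp add: X_def norm_mult)
    also have "\<dots> \<le> (2 * B + cmod \<alpha>) * L" using eB by (intro comb sum3 dif2) auto
    finally show ?thesis .
  qed
  have Y: "cmod Y \<le> (2 * B + cmod \<alpha>) * L"
  proof -
    have "cmod Y \<le> cmod (f - cnj f) * a + cmod (cnj e + f + \<alpha>) * b"
      using norm_triangle_ineq4[of "- ((f - cnj f) * complex_of_real a)" "(cnj e + f + \<alpha>) * complex_of_real b"] ab
      by (simp add: Y_def norm_mult)
    also have "\<dots> \<le> (2 * B + cmod \<alpha>) * L" using eB by (intro comb sum3 dif2) auto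
    finally show ?thesis .
  qed
  define R where "R = 2 * r * L / cmod \<alpha>"
  have "\<bar>cmod N1 - R\<bar> + cmod (n2 Vp z) \<le> C" "\<bar>cmod P1 - R\<bar> + cmod (p2 Vm z) \<le> C"
    using coefficient_bound[OF DA DA2 \<alpha> r less_imp_le[OF L] N1 q2 X]
      coefficient_bound[OF DA DA2 \<alpha> r less_imp_le[OF L] P1 q2 Y] ab
    by (simp_all add: R_def C_def n2_def p2_def a_def b_def)
  note NP = this
  have R: "R > 0" using r L A by (simp add: R_def)
  have C0: "C \<ge> 0" using NP(1) by (smt (verit) norm_ge_zero)
  have RC: "2 * C \<le> R" using rC L A by (simp add: R_def field_simps)
  then have CR: "C \<le> R" using C0 by simp
  define S where "S = 1 / (2 * Re k) + 1 / (2 * Re m)"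
  have S: "S > 0" using kp km by (simp add: S_def add_pos_pos)
  note P = Psi_dom_and_residual[OF kp[unfolded k_def] km[unfolded m_def] D0[unfolded k_def m_def]]
  define \<rho> where "\<rho> = L2_norm (Psi Vp Vm \<alpha> z) / sqrt S"
  have sS: "sqrt S > 0" "(sqrt S)\<^sup>2 = S" using S by simp_all
  have \<rho>: "L2_norm (Psi Vp Vm \<alpha> z) = \<rho> * sqrt S" using sS by (simp add: \<rho>_def)
  have \<rho>0: "\<rho> \<ge> 0" using sS L2_norm_nonneg by (simp add: \<rho>_def)
  note br = two_exponentials_norm_bounds[OF kp NP(2) CR, unfolded P1_def k_def]
  note bl = two_exponentials_norm_bounds[OF km NP(1) CR, unfolded N1_def m_def]
  have "(R - C)\<^sup>2 * S \<le> (L2_norm (Psi Vp Vm \<alpha> z))\<^sup>2" "(L2_norm (Psi Vp Vm \<alpha> z))\<^sup>2 \<le> (R + C)\<^sup>2 * S"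
    unfolding P(3) Psi_right_def Psi_left_def S_def k_def m_def using br bl by (simp_all add: distrib_left)
  then have "(R - C)\<^sup>2 * S \<le> \<rho>\<^sup>2 * S" "\<rho>\<^sup>2 * S \<le> (R + C)\<^sup>2 * S"
    unfolding \<rho> power_mult_distrib sS(2) .
  then have "(R - C)\<^sup>2 \<le> \<rho>\<^sup>2" "\<rho>\<^sup>2 \<le> (R + C)\<^sup>2" using S by simp_all
  then have \<rho>b: "R - C \<le> \<rho>" "\<rho> \<le> R + C"
    using \<rho>0 R C0 by (auto intro: power2_le_imp_le)
  then have \<rho>pos: "\<rho> > 0" and \<rho>half: "R / 2 \<le> \<rho>" using RC R by linarith+
  have "(L2_norm (\<lambda>x. op_L Vp Vm (Psi Vp Vm \<alpha> z) x - z * Psi Vp Vm \<alpha> z x))\<^sup>2 = (2 * (a * b) * sqrt S)\<^sup>2"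
    unfolding P(2) power_mult_distrib sS(2) by (simp add: S_def k_def m_def a_def b_def power_mult_distrib)
  then have res: "L2_norm (\<lambda>x. op_L Vp Vm (Psi Vp Vm \<alpha> z) x - z * Psi Vp Vm \<alpha> z x) = 2 * (a * b) * sqrt S"
    using ab sS by (intro power2_eq_imp_eq[OF _ L2_norm_nonneg]) auto
  have "L2_norm (\<lambda>x. op_L Vp Vm (Psi Vp Vm \<alpha> z) x - z * Psi Vp Vm \<alpha> z x) / L2_norm (Psi Vp Vm \<alpha> z)
        / (cmod \<alpha> / L * (a * b / r)) = R / \<rho>"
    unfolding res \<rho> R_def using sS(1) ab r L A \<rho>pos by (simp add: field_simps)
  moreover have "\<bar>R / \<rho> - 1\<bar> \<le> (C * cmod \<alpha> / L) / r"
  proof -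
    have "\<bar>R / \<rho> - 1\<bar> = \<bar>R - \<rho>\<bar> / \<rho>"
    proof -
      have "R / \<rho> - 1 = (R - \<rho>) / \<rho>" using \<rho>pos by (simp add: diff_divide_distrib)
      then show ?thesis using \<rho>pos by (simp add: abs_divide)
    qed
    also have "\<dots> \<le> C / (R / 2)"
      by (rule frac_le) (use \<rho>b \<rho>half R C0 in auto)
    also have "\<dots> = (C * cmod \<alpha> / L) / r" using r L A by (simp add: R_def field_simps)
    finally show ?thesis .
  qed
  ultimately show "\<bar>(L2_norm (\<lambda>x. op_L Vp Vm (Psi Vp Vm \<alpha> z) x - z * Psi Vp Vm \<alpha> z x)
           / L2_norm (Psi Vp Vm \<alpha> z))
         / (cmod \<alpha> / L * (\<bar>Im Vp - Im z\<bar> * \<bar>Im Vm - Im z\<bar> / r)) - 1\<bar> \<le> (C * cmod \<alpha> / L) / r"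
    unfolding a_def b_def by simp
qed

theorem theorem2p15:
  fixes Vp Vm \<alpha> :: complex
  assumes "Im Vp \<noteq> Im Vm" and "\<alpha> \<noteq> 0"
  shows "(\<forall>z\<in>rho_L Vp Vm \<alpha>. Psi Vp Vm \<alpha> z \<in> dom_L \<alpha>) \<and>
    (\<exists>M>0. \<exists>C>0. \<forall>z::complex. Re z \<ge> M \<and> Im z \<in> open_segment (Im Vp) (Im Vm) \<longrightarrow>
       z \<in> rho_L Vp Vm \<alpha> \<and>
       \<bar>(L2_norm (\<lambda>x. op_L Vp Vm (Psi Vp Vm \<alpha> z) x - z * Psi Vp Vm \<alpha> z x)
           / L2_norm (Psi Vp Vm \<alpha> z))
         / (cmod \<alpha> / \<bar>Im Vp - Im Vm\<bar>
             * (\<bar>Im Vp - Im z\<bar> * \<bar>Im Vm - Im z\<bar> / sqrt (Re z)))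
         - 1\<bar> \<le> C / \<bar>Re z\<bar> powr (1 / 2))"
proof (intro conjI ballI)
  fix z assume "z \<in> rho_L Vp Vm \<alpha>"
  from rho_L_D[OF this] show "Psi Vp Vm \<alpha> z \<in> dom_L \<alpha>" by (rule Psi_dom_and_residual(1))
next
  define L B where "L = \<bar>Im Vp - Im Vm\<bar>" and "B = 2 * (cmod Vp + cmod Vm)"
  define C where "C = 2 * ((2 * B + cmod \<alpha>) * L) / cmod \<alpha> + 8 * B * L / (cmod \<alpha>)\<^sup>2 + L"
  \<comment> \<open>Thresholds for \<open>sqrt (Re z)\<close>: the errors of the roots are bounded, \<open>\<bar>D\<bar> \<ge> \<bar>\<alpha>\<bar> / 2\<close>, and \<open>R \<ge> 2 C\<close>.\<close>
  define T where "T = max 1 (max (4 * B / cmod \<alpha>) (C * cmod \<alpha> / L))"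
  have L: "L > 0" using assms by (simp add: L_def)
  have C: "C > 0" unfolding C_def
    by (rule add_nonneg_pos) (use L in \<open>simp_all add: B_def\<close>)
  have T: "T \<ge> 1" "T \<ge> 4 * B / cmod \<alpha>" "T \<ge> C * cmod \<alpha> / L" by (auto simp: T_def)
  show "\<exists>M>0. \<exists>C>0. \<forall>z::complex. Re z \<ge> M \<and> Im z \<in> open_segment (Im Vp) (Im Vm) \<longrightarrow>
       z \<in> rho_L Vp Vm \<alpha> \<and>
       \<bar>(L2_norm (\<lambda>x. op_L Vp Vm (Psi Vp Vm \<alpha> z) x - z * Psi Vp Vm \<alpha> z x)
           / L2_norm (Psi Vp Vm \<alpha> z))
         / (cmod \<alpha> / \<bar>Im Vp - Im Vm\<bar>
             * (\<bar>Im Vp - Im z\<bar> * \<bar>Im Vm - Im z\<bar> / sqrt (Re z)))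
         - 1\<bar> \<le> C / \<bar>Re z\<bar> powr (1 / 2)"
  proof (rule exI[of _ "T\<^sup>2"], rule conjI, use T in simp,
      rule exI[of _ "C * cmod \<alpha> / L"], rule conjI, use C L assms(2) in simp, intro allI impI, elim conjE)
    fix z :: complex assume z: "T\<^sup>2 \<le> Re z" "Im z \<in> open_segment (Im Vp) (Im Vm)"
    have r: "sqrt (Re z) \<ge> T" using z(1) by (rule real_le_rsqrt)
    have "Re z \<ge> 0" using z(1) zero_le_power2[of T] by linarith
    then have powr: "\<bar>Re z\<bar> powr (1 / 2) = sqrt (Re z)" by (simp add: powr_half_sqrt)
    note A = pseudomode_asymptotics[OF assms z(2), folded L_def B_def, folded C_def]
    have h: "sqrt (Re z) \<ge> 1" "sqrt (Re z) \<ge> 4 * B / cmod \<alpha>" "sqrt (Re z) \<ge> C * cmod \<alpha> / L"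
      using r T by linarith+
    show "z \<in> rho_L Vp Vm \<alpha> \<and>
       \<bar>(L2_norm (\<lambda>x. op_L Vp Vm (Psi Vp Vm \<alpha> z) x - z * Psi Vp Vm \<alpha> z x)
           / L2_norm (Psi Vp Vm \<alpha> z))
         / (cmod \<alpha> / \<bar>Im Vp - Im Vm\<bar>
             * (\<bar>Im Vp - Im z\<bar> * \<bar>Im Vm - Im z\<bar> / sqrt (Re z)))
         - 1\<bar> \<le> (C * cmod \<alpha> / L) / \<bar>Re z\<bar> powr (1 / 2)"
      unfolding powr L_def[symmetric] using A[OF h] by (rule conjI)
  qed
qed

end
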